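(* Let $\alpha,\beta$ be integers different from $1$ with $v_2(\alpha-1)=v_2(\beta-1)=m>1$, and suppose $v_2(\alpha-\beta)=2m-1$. Then $|G_2|=2^{7m-3}$, the nilpotency class of $G_2$ is $5$, $o(a)=o(b)=2^{3m-1}$ and $o(c)=2^{2m}$.
   Context: $G(\alpha,\beta)=\langle A,B\mid A^{[A,B]}=A^{\alpha},\ B^{[B,A]}=B^{\beta}\rangle$ with $[x,y]=x^{-1}y^{-1}xy$, $y^x=x^{-1}yx$, and $C=[A,B]$. The group $G(\alpha,\beta)$ is finite and nilpotent, hence the direct product of its Sylow subgroups; $G_2$ denotes its Sylow $2$-subgroup and $a,b,c$ denote the images of $A,B,C$ under the canonical projection $G(\alpha,\beta)\to G_2$. $v_2$ is the $2$-adic valuation and $o(x)$ the order of $x$. *)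

theory Defs
  imports "HOL-Algebra.Algebra" "HOL-Computational_Algebra.Computational_Algebra"
begin

definition gcomm :: "('a, 'b) monoid_scheme \<Rightarrow> 'a \<Rightarrow> 'a \<Rightarrow> 'a" where
  "gcomm G x y = inv\<^bsub>G\<^esub> x \<otimes>\<^bsub>G\<^esub> inv\<^bsub>G\<^esub> y \<otimes>\<^bsub>G\<^esub> x \<otimes>\<^bsub>G\<^esub> y"

definition gconj :: "('a, 'b) monoid_scheme \<Rightarrow> 'a \<Rightarrow> 'a \<Rightarrow> 'a" where
  "gconj G y x = inv\<^bsub>G\<^esub> x \<otimes>\<^bsub>G\<^esub> y \<otimes>\<^bsub>G\<^esub> x"

definition rels :: "('a, 'b) monoid_scheme \<Rightarrow> 'a \<Rightarrow> 'a \<Rightarrow> int \<Rightarrow> int \<Rightarrow> bool" where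
  "rels H x y \<alpha> \<beta> \<longleftrightarrow>
     gconj H x (gcomm H x y) = x [^]\<^bsub>H\<^esub> \<alpha> \<and>
     gconj H y (gcomm H y x) = y [^]\<^bsub>H\<^esub> \<beta>"

text \<open>G with generators A, B is (a copy of) the finitely presented group
  G(alpha,beta) = < A, B | A^[A,B] = A^alpha, B^[B,A] = B^beta >:
  it is a group generated by A, B satisfying the relations, and it has the
  universal property with respect to all groups on the same (infinite) element
  type.\<close>
definition presents_G :: "'a monoid \<Rightarrow> 'a \<Rightarrow> 'a \<Rightarrow> int \<Rightarrow> int \<Rightarrow> bool" where
  "presents_G G A B \<alpha> \<beta> \<longleftrightarrow>
     group G \<and> A \<in> carrier G \<and> B \<in> carrier G \<and>
     generate G {A, B} = carrier G \<and> rels G A B \<alpha> \<beta> \<and>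
     (\<forall>(H :: 'a monoid) x y. group H \<and> x \<in> carrier H \<and> y \<in> carrier H \<and> rels H x y \<alpha> \<beta>
        \<longrightarrow> (\<exists>h \<in> hom G H. h A = x \<and> h B = y))"

text \<open>Sylow 2-subgroup of a finite nilpotent group: its 2-elements.\<close>
definition sylow2_set :: "('a, 'b) monoid_scheme \<Rightarrow> 'a set" where
  "sylow2_set G = {x \<in> carrier G. \<exists>n::nat. group.ord G x = 2 ^ n}"

definition odd_set :: "('a, 'b) monoid_scheme \<Rightarrow> 'a set" where
  "odd_set G = {x \<in> carrier G. odd (group.ord G x)}"

text \<open>Canonical projection onto the Sylow 2-subgroup in G = G_2 x G_{2'}:
  the G_2-component of x.\<close>
definition proj2 :: "('a, 'b) monoid_scheme \<Rightarrow> 'a \<Rightarrow> 'a" where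
  "proj2 G x = (THE p. p \<in> sylow2_set G \<and> (\<exists>h \<in> odd_set G. x = p \<otimes>\<^bsub>G\<^esub> h))"

text \<open>Lower central series: lcs G 0 = G (= gamma_1), lcs G (i+1) = [lcs G i, G].\<close>
fun lcs :: "('a, 'b) monoid_scheme \<Rightarrow> nat \<Rightarrow> 'a set" where
  "lcs G 0 = carrier G"
| "lcs G (Suc i) = generate G {gcomm G x y | x y. x \<in> lcs G i \<and> y \<in> carrier G}"

definition nilpotency_class :: "('a, 'b) monoid_scheme \<Rightarrow> nat \<Rightarrow> bool" where
  "nilpotency_class G c \<longleftrightarrow> lcs G c = {\<one>\<^bsub>G\<^esub>} \<and> (\<forall>k < c. lcs G k \<noteq> {\<one>\<^bsub>G\<^esub>})"

end

theory Submission
  imports Defs "HOL-Number_Theory.Number_Theory"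
begin

text \<open>
  With $C = [A,B]$ the relations read $AC = CA^\alpha$, $CB = B^\beta C$, $AB = BAC$, so every word can be
  rewritten to the form $B^jC^kA^i$. Since $A^{\alpha^k} = C^{-k}AC^k$, computing the conjugates of $B$ by
  $A^{\alpha^k}$ in two ways expresses a nonzero power of $B$ through $A$ and $C$; conjugating by $C$ then
  makes a power of $B$ central, which forces $A$ and $B$ to have finite order. Varying $k$ shows that the
  primes dividing $o(A)$ divide $\alpha - 1$, and likewise for $B$; hence a suitable power of $A$, $B$ or $C$
  is central in every nontrivial quotient, and $G$ is finite and nilpotent.

  On the Sylow 2-subgroup the case $k = 1$ reads $b^F = c^\delta a^\epsilon$ with
  $v_2(F) = v_2(\delta) = v_2(\epsilon) = 2m-1$. As $b$ commutes with this element,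
  $c^\epsilon$ lies in $\langle a\rangle$, so it centralises $a$, whence $a^{2^{3m-1}} = 1$,
  $c^{2^{2m-1}} = a^{2^{3m-2}}$ and $b^{2^{2m-1}} \in \langle a^{2^{2m-1}}\rangle$. This bounds the order
  by $2^{7m-3}$ and the class by 5. For the converse, right multiplication by $A$, $B$, $C$ on the normal
  forms $B^jC^kA^i$ is written down explicitly on triples $(j,k,i)$ modulo the relations just found; all
  relations but $CB = B^\beta C$ hold identically, and that one is a polynomial congruence.
\<close>

section \<open>Geometric sums\<close>

text \<open>Rewriting alone cannot exclude further collapse, so the lower bound needs a concrete
  group. Write P = 2^(m-1). The upper-bound argument leaves t in b^(2P^2) = a^(2P^2 t) open, whereas
  a model has to fix it: compatibility with C B = B^\<beta> C demands that 2P divide u^2 (1 + t) + P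
  with u odd, which leaves only t = P - 1 modulo 2P. The order of the permutation group so obtained
  never has to be determined: the images of a single base point already separate 2^(7m-3) elements
  of G_2 and detect the full orders of a, b, c. That v_2(\<alpha> - \<beta>) is exactly 2m-1 acts
  twice. It makes the exponent of c in the k = 1 relation an odd multiple of 2^(2m-1), and in the
  model it produces the summand 2P^2 i of \<open>qq_be\<close>, hence the term P in the condition on
  t. Two further devices shape the proof. The symmetry exchanging A with B, \<alpha> with \<beta>
  and C with its inverse halves most arguments. The universal property speaks about G, not G_2; an
  exponent e that is 1 modulo a large power of 2 carries it over to A^e and B^e.\<close>

hide_const (open) Divisibility.prime
lemmas poly_simps = algebra_simps power2_eq_square power3_eq_cube power4_eq_xxxx

definition geo :: "int \<Rightarrow> nat \<Rightarrow> int" where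
  "geo q n = (\<Sum>i<n. q ^ i)"

lemma geo_0 [simp]: "geo q 0 = 0"
  by (simp add: geo_def)

lemma geo_Suc: "geo q (Suc n) = geo q n + q ^ n"
  by (simp add: geo_def)

lemma geo_1 [simp]: "geo q (Suc 0) = 1"
  by (simp add: geo_def)

lemma geo_mult_eq: "(q - 1) * geo q n = q ^ n - 1"
  by (induction n) (simp_all add: geo_Suc algebra_simps)

lemma geo_add: "geo q (m + n) = geo q m + q ^ m * geo q n"
  by (induction n) (simp_all add: geo_Suc algebra_simps power_add)

lemma geo_Suc': "geo q (Suc n) = 1 + q * geo q n"
  using geo_add[of q 1 n] by simp

lemma geo_mult: "geo q (m * n) = geo q m * geo (q ^ m) n"
proof (induction n)
  case (Suc n)
  have "geo q (m * Suc n) = geo q (m + m * n)" by simp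
  also have "\<dots> = geo q m * geo (q ^ m) (Suc n)"
    unfolding geo_add geo_Suc' Suc by (simp add: algebra_simps)
  finally show ?case .
qed simp

lemma dvd_diff_imp: "(a::int) dvd b - c \<Longrightarrow> \<exists>t. b = c + a * t"
  by (auto simp: dvd_def algebra_simps)

lemma geo_cong_n: "q - 1 dvd geo q n - int n"
proof (induction n)
  case (Suc n)
  have "geo q (Suc n) - int (Suc n) = (geo q n - int n) + (q - 1) * geo q n"
    by (simp add: geo_Suc geo_mult_eq)
  then show ?case using Suc by (metis dvd_add dvd_triv_left)
qed simp

lemma dvd_power_minus_one: "(q::int) - 1 dvd q ^ n - 1"
  by (metis geo_mult_eq dvd_triv_left)

lemma geo_expand:
  "\<exists>r. geo (1 + x) n = int n + int (n choose 2) * x + int (n choose 3) * x^2 + x^3 * r"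
proof (induction n)
  case (Suc n)
  then obtain r where r: "geo (1 + x) n = int n + int (n choose 2) * x + int (n choose 3) * x^2 + x^3 * r"
    by blast
  have c: "Suc n choose 2 = n + (n choose 2)" "Suc n choose 3 = (n choose 2) + (n choose 3)"
    by (simp_all add: numeral_2_eq_2 numeral_3_eq_3)
  have "geo (1 + x) (Suc n) = int (Suc n) + int (Suc n choose 2) * x + int (Suc n choose 3) * x^2
      + x^3 * (int (n choose 3) + r + x * r)"
    by (simp add: geo_Suc' r c power2_eq_square power3_eq_cube algebra_simps)
  then show ?case by blast
qed (auto intro!: exI[of _ 0] simp: binomial_eq_0)

lemma power_expand:
  "\<exists>r. (1 + y) ^ n = 1 + int n * y + int (n choose 2) * y^2 + y^3 * r"
proof -
  obtain r where r: "geo (1 + y) n = int n + int (n choose 2) * y + int (n choose 3) * y^2 + y^3 * r"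
    using geo_expand by blast
  have "(1 + y) ^ n = 1 + y * geo (1 + y) n"
    using geo_mult_eq[of "1 + y" n] by simp
  then show ?thesis
    by (intro exI[of _ "int (n choose 3) + y * r"])
      (simp add: r power2_eq_square power3_eq_cube algebra_simps)
qed

lemma two_choose_two: "2 * int (n choose 2) = int n * (int n - 1)"
proof (induction n)
  case (Suc n)
  have "Suc n choose 2 = n + (n choose 2)" by (simp add: numeral_2_eq_2)
  then show ?case using Suc by (simp add: algebra_simps)
qed simp

lemma six_choose_three: "6 * int (n choose 3) = int n * (int n - 1) * (int n - 2)"
proof (induction n)
  case (Suc n)
  have c: "Suc n choose 3 = (n choose 2) + (n choose 3)" by (simp add: numeral_2_eq_2 numeral_3_eq_3)
  have "6 * int (Suc n choose 3) = 3 * (2 * int (n choose 2)) + 6 * int (n choose 3)" by (simp add: c)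
  also have "\<dots> = int (Suc n) * (int (Suc n) - 1) * (int (Suc n) - 2)"
    unfolding Suc two_choose_two by (simp add: algebra_simps)
  finally show ?case .
qed simp

text \<open>For p different from r the two divisibilities combine by coprimality. For p = r odd the
  linear term of the expansion in q - 1 carries (p choose 2), itself a multiple of p. For p = r = 2
  the difference is q - 1, hence the condition modulo 4.\<close>

lemma geo_prime_cong:
  assumes p: "prime (p::nat)" "int p dvd q - 1" and p4: "p = 2 \<Longrightarrow> 4 dvd q - 1"
    and r: "prime (r::nat)" "int r dvd q - 1"
  shows "int (p * r) dvd geo q r - int r"
proof (cases "p = r")
  case False
  have "int p dvd geo q r - int r" using p(2) geo_cong_n dvd_trans by blast
  moreover have "int r dvd geo q r - int r" using r(2) geo_cong_n dvd_trans by blast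
  moreover have "coprime (int p) (int r)" using False p r by (simp add: primes_coprime)
  ultimately show ?thesis by (simp add: divides_mult)
next
  case True
  obtain t where t: "q = 1 + int p * t" using p(2) dvd_diff_imp by blast
  show ?thesis
  proof (cases "p = 2")
    case True
    then show ?thesis using p4 \<open>p = r\<close> by (simp add: geo_def numeral_2_eq_2)
  next
    case False
    obtain s where s: "geo q p = int p + int (p choose 2) * (int p * t) + int (p choose 3) * (int p * t)^2 + (int p * t)^3 * s"
      using geo_expand[of "int p * t" p] t by auto
    have "odd p" using False p(1) prime_odd_nat prime_ge_2_nat[OF p(1)] by auto
    then obtain h where "p = 2 * h + 1" by (auto elim: oddE)
    then have "int (p choose 2) = int p * int h" using two_choose_two[of p] by simp
    then have "geo q p - int p = int (p * p) * (int h * t + int (p choose 3) * t^2 + int p * t^3 * s)"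
      unfolding s by (simp add: power2_eq_square power3_eq_cube algebra_simps)
    then show ?thesis using True by (metis dvd_triv_left)
  qed
qed

text \<open>The factor p on top of n is what later makes a proper power of A commute with B.
  Induction strips a prime r from n by \<open>geo_mult\<close>; the hypotheses pass from q to q^r
  because q - 1 divides q^r - 1.\<close>

lemma geo_cong_strong:
  assumes p: "prime (p::nat)" and "n > 0"
    and "\<And>r. prime r \<Longrightarrow> r dvd n \<Longrightarrow> int r dvd q - 1"
    and "int p dvd q - 1" "p = 2 \<Longrightarrow> 4 dvd q - 1"
  shows "int (p * n) dvd geo q n - int n"
  using assms(2-)
proof (induction n arbitrary: q rule: prime_divisors_induct)
  case zero
  then show ?case by simp
next
  case (unit u)
  then show ?case by simp
next
  case (factor r n)
  have q4: "p = 2 \<Longrightarrow> 4 dvd q ^ r - 1" and qp: "int p dvd q ^ r - 1"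
    using dvd_trans[OF _ dvd_power_minus_one[of q r]] factor.prems by simp_all
  have n: "n > 0" using factor.prems by simp
  have "int (p * n) dvd geo (q ^ r) n - int n"
  proof (rule factor.IH[OF n _ qp q4])
    fix s :: nat assume "prime s" "s dvd n"
    then have "int s dvd q - 1" using factor.prems(2) by simp
    then show "int s dvd q ^ r - 1" using dvd_trans dvd_power_minus_one by blast
  qed
  then obtain s where s: "geo (q ^ r) n = int n + int (p * n) * s"
    using dvd_diff_imp by blast
  have "int (p * r) dvd geo q r - int r"
    by (rule geo_prime_cong) (use p factor in auto)
  then obtain t where t: "geo q r = int r + int (p * r) * t"
    using dvd_diff_imp by blast
  have "geo q (r * n) - int (r * n) = int (p * (r * n)) * (s + t + int p * s * t)"
    unfolding geo_mult s t by (simp add: algebra_simps)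
  then show ?case by (metis dvd_triv_left)
qed

lemma geo_dvd:
  assumes "n > 0" and *: "\<And>r. prime r \<Longrightarrow> r dvd n \<Longrightarrow> int r dvd q - 1"
  shows "int n dvd geo q n"
  using assms
proof (induction n arbitrary: q rule: prime_divisors_induct)
  case (factor r n)
  have "int n dvd geo (q ^ r) n"
  proof (rule factor.IH)
    fix s :: nat assume "prime s" "s dvd n"
    then have "int s dvd q - 1" using factor.prems(2) by simp
    then show "int s dvd q ^ r - 1" using dvd_trans dvd_power_minus_one by blast
  qed (use factor.prems in simp)
  moreover have "int r dvd geo q r"
  proof -
    have "int r dvd q - 1" using factor by auto
    then have "int r dvd geo q r - int r" using geo_cong_n dvd_trans by blast
    then show ?thesis by (metis diff_add_cancel dvd_add dvd_refl)
  qed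
  ultimately show ?case by (simp add: geo_mult mult_dvd_mono)
qed auto

text \<open>Lifting the exponent at 2: the sum and n have the same 2-adic valuation. Halving n
  replaces q by q^2 and splits off 1 + q, which is twice an odd number. Most valuation counts in the
  2-part rest on this.\<close>

lemma two_power_dvd_geo_iff:
  assumes "4 dvd q - 1"
  shows "2 ^ N dvd geo q n \<longleftrightarrow> 2 ^ N dvd n"
  using assms
proof (induction N arbitrary: q n)
  case (Suc N)
  have odd_iff: "even (geo q n) \<longleftrightarrow> even n"
  proof -
    have "2 dvd q - 1" using Suc.prems by (rule dvd_trans[rotated]) simp
    then have "2 dvd geo q n - int n" using geo_cong_n dvd_trans by blast
    then show ?thesis by simp
  qed
  show ?case
  proof (cases "even n")
    case False
    then show ?thesis using odd_iff
      by (auto dest: dvd_mult_left)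
  next
    case True
    then obtain k where k: "n = 2 * k" by blast
    obtain t where t: "q = 1 + 4 * t" using Suc.prems dvd_diff_imp by blast
    have "geo q n = 2 * ((1 + 2 * t) * geo (q^2) k)"
      unfolding k geo_mult by (simp add: geo_def numeral_2_eq_2 t algebra_simps)
    moreover have "coprime (2 ^ N) (1 + 2 * t)" by simp
    moreover have "4 dvd q^2 - 1" using Suc.prems dvd_power_minus_one dvd_trans by blast
    ultimately show ?thesis using Suc.IH[of "q^2" k] k
      by (simp add: coprime_dvd_mult_right_iff)
  qed
qed simp

section \<open>Consequences of the defining relations\<close>

context group
begin

lemma pow_intertwine:
  assumes "x \<in> carrier G" "y \<in> carrier G" "c \<in> carrier G" "x \<otimes> c = c \<otimes> y"
  shows "x [^] (n::int) \<otimes> c = c \<otimes> y [^] n"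
proof -
  have nat: "x [^] (n::nat) \<otimes> c = c \<otimes> y [^] n" for n
  proof (induction n)
    case (Suc n)
    have "x [^] Suc n \<otimes> c = x [^] n \<otimes> (x \<otimes> c)" using assms by (simp add: m_assoc)
    also have "\<dots> = (x [^] n \<otimes> c) \<otimes> y" using assms by (simp add: m_assoc)
    also have "\<dots> = c \<otimes> y [^] Suc n" using assms Suc by (simp add: m_assoc)
    finally show ?case .
  qed (use assms in simp)
  show ?thesis
  proof (cases "n \<ge> 0")
    case True
    then show ?thesis using nat[of "nat n"] by (simp flip: int_pow_int)
  next
    case False
    define k where "k = nat (- n)"
    have n: "n = - int k" using False by (simp add: k_def)
    have "x [^] k \<otimes> (c \<otimes> inv (y [^] k)) = c \<otimes> y [^] k \<otimes> inv (y [^] k)"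
      using assms nat by (simp add: m_assoc[symmetric])
    then have "c \<otimes> inv (y [^] k) = inv (x [^] k) \<otimes> c"
      using assms by (subst inv_solve_left) (simp_all add: m_assoc)
    then show ?thesis using assms by (simp add: n int_pow_neg_int)
  qed
qed

lemma commute_pow:
  assumes "x \<in> carrier G" "c \<in> carrier G" "x \<otimes> c = c \<otimes> x"
  shows "x [^] (n::int) \<otimes> c = c \<otimes> x [^] n"
  using pow_intertwine assms by blast

end

text \<open>C is a parameter tied to A and B by \<open>AB\<close> only, so that the locale passes
  verbatim to homomorphic images, to subgroups and to the pair (B, A). The relations are oriented so
  as to move B to the left and A to the right.\<close>

locale macd = group G for G (structure) +
  fixes A B C :: 'a and \<alpha> \<beta> :: int
  assumes A_closed [simp, intro]: "A \<in> carrier G"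
    and B_closed [simp, intro]: "B \<in> carrier G"
    and C_closed [simp, intro]: "C \<in> carrier G"
    and AC: "A \<otimes> C = C \<otimes> A [^] \<alpha>"
    and CB: "C \<otimes> B = B [^] \<beta> \<otimes> C"
    and AB: "A \<otimes> B = B \<otimes> A \<otimes> C"
begin

lemma C_eq: "C = gcomm G A B"
proof -
  have "inv A \<otimes> inv B \<otimes> (A \<otimes> B) = inv A \<otimes> inv B \<otimes> (B \<otimes> A \<otimes> C)" by (simp only: AB)
  then have "gcomm G A B = inv A \<otimes> (inv B \<otimes> (B \<otimes> (A \<otimes> C)))" by (simp add: gcomm_def m_assoc)
  also have "\<dots> = C" by (simp add: m_assoc[symmetric])
  finally show ?thesis by simp
qed

lemma invC_eq: "inv C = gcomm G B A"
  unfolding C_eq gcomm_def by (simp add: inv_mult_group m_assoc)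

lemma swap: "macd G B A (inv C) \<beta> \<alpha>"
proof
  have "C \<otimes> (B \<otimes> inv C) = B [^] \<beta> \<otimes> C \<otimes> inv C" by (simp add: CB[symmetric] m_assoc)
  then show "B \<otimes> inv C = inv C \<otimes> B [^] \<beta>" by (subst inv_solve_left) (simp_all add: m_assoc)
  have "C \<otimes> (A [^] \<alpha> \<otimes> inv C) = A \<otimes> C \<otimes> inv C" by (simp add: AC m_assoc)
  then show "inv C \<otimes> A = A [^] \<alpha> \<otimes> inv C" by (subst inv_solve_left') (simp_all add: m_assoc)
  have "A \<otimes> B \<otimes> inv C = B \<otimes> A \<otimes> C \<otimes> inv C" by (simp only: AB)
  then show "B \<otimes> A = A \<otimes> B \<otimes> inv C" by (simp add: m_assoc)
qed simp_all

lemma A_pow_C: "A [^] (i::int) \<otimes> C [^] (k::nat) = C [^] k \<otimes> A [^] (i * \<alpha> ^ k)"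
proof (induction k arbitrary: i)
  case (Suc k)
  have "A [^] i \<otimes> C [^] Suc k = (A [^] i \<otimes> C [^] k) \<otimes> C" by (simp add: m_assoc)
  also have "\<dots> = C [^] k \<otimes> (A [^] (i * \<alpha> ^ k) \<otimes> C)" by (simp add: Suc m_assoc)
  also have "A [^] (i * \<alpha> ^ k) \<otimes> C = C \<otimes> (A [^] \<alpha>) [^] (i * \<alpha> ^ k)"
    by (rule pow_intertwine) (simp_all add: AC)
  also have "C [^] k \<otimes> (C \<otimes> (A [^] \<alpha>) [^] (i * \<alpha> ^ k)) = C [^] Suc k \<otimes> A [^] (i * \<alpha> ^ Suc k)"
    by (simp add: m_assoc int_pow_pow mult.commute mult.left_commute)
  finally show ?case .
qed simp

lemma C_pow_B: "C [^] (k::nat) \<otimes> B [^] (j::int) = B [^] (j * \<beta> ^ k) \<otimes> C [^] k"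
proof (induction k arbitrary: j)
  case (Suc k)
  have "(B [^] \<beta>) [^] j \<otimes> C = C \<otimes> B [^] j"
    by (rule pow_intertwine) (simp_all add: CB)
  then have "C \<otimes> B [^] j = B [^] (j * \<beta>) \<otimes> C" by (simp add: int_pow_pow mult.commute)
  then have "C [^] Suc k \<otimes> B [^] j = (C [^] k \<otimes> B [^] (j * \<beta>)) \<otimes> C" by (simp add: m_assoc)
  also have "\<dots> = B [^] (j * \<beta> ^ Suc k) \<otimes> C [^] Suc k" by (simp add: Suc m_assoc mult.assoc)
  finally show ?case .
qed simp

text \<open>Conjugation by B turns A into A C. Collecting the i factors C of (A C)^i on the left
  multiplies the exponents of the A's that are passed by powers of \<alpha>, which add up to
  \<alpha> + ... + \<alpha>^i.\<close>

lemma A_pow_B: "A [^] (i::nat) \<otimes> B = B \<otimes> (C [^] i \<otimes> A [^] (\<alpha> * geo \<alpha> i))"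
proof (induction i)
  case (Suc i)
  have "A [^] Suc i \<otimes> B = A [^] i \<otimes> (B \<otimes> A \<otimes> C)" by (simp add: m_assoc AB)
  also have "\<dots> = (A [^] i \<otimes> B) \<otimes> (A \<otimes> C)" by (simp add: m_assoc)
  also have "\<dots> = B \<otimes> (C [^] i \<otimes> (A [^] (\<alpha> * geo \<alpha> i) \<otimes> A [^] (1::int) \<otimes> C [^] (1::nat)))"
    by (simp add: Suc m_assoc)
  also have "\<dots> = B \<otimes> (C [^] i \<otimes> (A [^] (\<alpha> * geo \<alpha> i + 1) \<otimes> C [^] (1::nat)))"
    by (simp add: int_pow_mult)
  also have "\<dots> = B \<otimes> (C [^] i \<otimes> (C [^] (1::nat) \<otimes> A [^] ((\<alpha> * geo \<alpha> i + 1) * \<alpha>)))"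
    unfolding A_pow_C by simp
  also have "(\<alpha> * geo \<alpha> i + 1) * \<alpha> = \<alpha> * geo \<alpha> (Suc i)" by (simp add: geo_Suc')
  finally show ?case by (simp add: m_assoc)
qed simp

lemma B_pow_A: "B [^] (i::nat) \<otimes> A = A \<otimes> (inv C [^] i \<otimes> B [^] (\<beta> * geo \<beta> i))"
  by (rule macd.A_pow_B[OF swap])

lemma C_pow_conj_B: "C [^] (n::nat) \<otimes> B = B \<otimes> (B [^] (\<beta> ^ n - 1) \<otimes> C [^] n)"
proof -
  have "C [^] n \<otimes> B = B [^] (1 + (\<beta> ^ n - 1)) \<otimes> C [^] n"
    using C_pow_B[of n 1] by simp
  also have "\<dots> = B \<otimes> (B [^] (\<beta> ^ n - 1) \<otimes> C [^] n)"
    by (subst int_pow_mult) (simp_all add: m_assoc)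
  finally show ?thesis .
qed

text \<open>Rewriting $C^kA^{n'}B$ in two ways gives $B^{-n}AB^n$, and rewriting $B^nA$ gives a second expression
  for it.\<close>
lemma key:
  assumes n: "B [^] n = B [^] (\<beta> ^ k)" and n': "A [^] n' = A [^] (\<alpha> ^ k)"
  shows "B [^] (\<beta> ^ (n + k) - \<beta> * geo \<beta> n) \<otimes> C [^] (n + k)
       = C [^] (n' + k) \<otimes> A [^] (\<alpha> * geo \<alpha> n' - \<alpha> ^ (n' + k))"
proof -
  let ?g = "\<alpha> * geo \<alpha> n'" and ?h = "\<beta> * geo \<beta> n"
  have CkB: "C [^] k \<otimes> B = B [^] n \<otimes> C [^] k"
    using C_pow_B[of k 1] by (simp add: n)
  have "A \<otimes> B [^] n \<otimes> C [^] k = A \<otimes> (C [^] k \<otimes> B)" by (simp add: CkB m_assoc)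
  also have "\<dots> = (A \<otimes> C [^] k) \<otimes> B" by (simp add: m_assoc)
  also have "A \<otimes> C [^] k = C [^] k \<otimes> A [^] n'" using A_pow_C[of 1 k] by (simp add: n')
  also have "C [^] k \<otimes> A [^] n' \<otimes> B = (C [^] k \<otimes> B) \<otimes> (C [^] n' \<otimes> A [^] ?g)"
    by (simp add: m_assoc A_pow_B)
  also have "\<dots> = B [^] n \<otimes> (C [^] (n' + k) \<otimes> A [^] ?g)"
    by (simp add: CkB m_assoc nat_pow_mult[symmetric] nat_pow_comm)
  finally have 1: "A \<otimes> (B [^] n \<otimes> C [^] k) = B [^] n \<otimes> (C [^] (n' + k) \<otimes> A [^] ?g)"
    by (simp add: m_assoc)
  have Cn: "C [^] n \<otimes> inv C [^] n = \<one>" by (simp add: nat_pow_inv)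
  have "C [^] (n + k) \<otimes> B = C [^] n \<otimes> (B [^] n \<otimes> C [^] k)"
    by (simp add: nat_pow_mult[symmetric] m_assoc CkB)
  then have "B [^] n \<otimes> C [^] k = inv C [^] n \<otimes> (C [^] (n + k) \<otimes> B)"
    by (simp add: nat_pow_inv inv_solve_left)
  also have "C [^] (n + k) \<otimes> B = B [^] (\<beta> ^ (n + k)) \<otimes> C [^] (n + k)"
    using C_pow_B[of "n + k" 1] by simp
  also have "\<dots> = B [^] ?h \<otimes> (B [^] (\<beta> ^ (n + k) - ?h) \<otimes> C [^] (n + k))"
    by (simp add: m_assoc[symmetric] int_pow_mult[symmetric])
  finally have "A \<otimes> (B [^] n \<otimes> C [^] k)
      = A \<otimes> (inv C [^] n \<otimes> B [^] ?h) \<otimes> (B [^] (\<beta> ^ (n + k) - ?h) \<otimes> C [^] (n + k))"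
    by (simp add: m_assoc)
  also have "\<dots> = B [^] n \<otimes> (A \<otimes> (B [^] (\<beta> ^ (n + k) - ?h) \<otimes> C [^] (n + k)))"
    by (simp add: B_pow_A[symmetric] m_assoc)
  finally have "B [^] n \<otimes> (A \<otimes> (B [^] (\<beta> ^ (n + k) - ?h) \<otimes> C [^] (n + k)))
      = B [^] n \<otimes> (C [^] (n' + k) \<otimes> A [^] ?g)" using 1 by simp
  then have 2: "A \<otimes> (B [^] (\<beta> ^ (n + k) - ?h) \<otimes> C [^] (n + k)) = C [^] (n' + k) \<otimes> A [^] ?g"
    by simp
  have "C [^] (n' + k) \<otimes> A [^] ?g = C [^] (n' + k) \<otimes> A [^] (1 * \<alpha> ^ (n' + k)) \<otimes> A [^] (?g - \<alpha> ^ (n' + k))"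
    by (simp add: m_assoc int_pow_mult[symmetric])
  also have "\<dots> = A \<otimes> (C [^] (n' + k) \<otimes> A [^] (?g - \<alpha> ^ (n' + k)))"
    unfolding A_pow_C[symmetric] by (simp add: m_assoc)
  finally show ?thesis using 2 by simp
qed

text \<open>Multiplying the relation by C on the left and on the right and comparing gives a power
  of B that C^s conjugates into <A>. As C^s also conjugates A into <A>, this power commutes with A;
  it commutes with B, hence with the commutator C. Conjugation by C both fixes it and raises it to
  the power \<beta>, so \<beta> - 1 kills it.\<close>

lemma key_central:
  fixes r r' :: nat and F e :: int
  assumes k: "B [^] F \<otimes> C [^] r = C [^] r' \<otimes> A [^] e"
  shows "A \<otimes> B [^] ((\<beta> - 1) * F) = B [^] ((\<beta> - 1) * F) \<otimes> A"
    and "C \<otimes> B [^] ((\<beta> - 1) * F) = B [^] ((\<beta> - 1) * F) \<otimes> C"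
    and "B [^] ((\<beta> - 1) * ((\<beta> - 1) * F)) = \<one>"
    and "\<exists>i. B [^] ((\<beta> - 1) * F) = A [^] (i::int)"
proof -
  let ?w = "B [^] ((\<beta> - 1) * F)"
  define s t where "s = Suc r'" and "t = Suc r"
  have st: "C [^] s = C \<otimes> C [^] r'" "C [^] t = C \<otimes> C [^] r" "C [^] t = C [^] r \<otimes> C" "C [^] s = C [^] r' \<otimes> C"
    unfolding s_def t_def using nat_pow_Suc2[of C r] nat_pow_Suc2[of C r'] by simp_all
  have "B [^] (F * \<beta>) \<otimes> C [^] t = (C \<otimes> B [^] F) \<otimes> C [^] r"
    using C_pow_B[of 1 F] by (simp add: m_assoc st(2))
  also have "\<dots> = C [^] s \<otimes> A [^] e" by (simp add: m_assoc k st(1))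
  finally have 1: "B [^] (F * \<beta>) \<otimes> C [^] t = C [^] s \<otimes> A [^] e" .
  have "B [^] F \<otimes> C [^] t = C [^] r' \<otimes> (A [^] e \<otimes> C)" by (simp add: m_assoc[symmetric] k st(3))
  also have "\<dots> = C [^] s \<otimes> A [^] (e * \<alpha>)" using A_pow_C[of e 1] by (simp add: m_assoc st(4))
  finally have 2: "B [^] F \<otimes> C [^] t = C [^] s \<otimes> A [^] (e * \<alpha>)" .
  have "?w \<otimes> (C [^] s \<otimes> A [^] (e * \<alpha>)) = B [^] ((\<beta> - 1) * F) \<otimes> B [^] F \<otimes> C [^] t"
    by (simp add: 2[symmetric] m_assoc)
  also have "\<dots> = C [^] s \<otimes> A [^] e"
    unfolding 1[symmetric] by (simp add: int_pow_mult[symmetric] algebra_simps)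
  also have "\<dots> = C [^] s \<otimes> A [^] (e - e * \<alpha>) \<otimes> A [^] (e * \<alpha>)"
    by (simp add: m_assoc int_pow_mult[symmetric])
  finally have 3: "?w \<otimes> C [^] s = C [^] s \<otimes> A [^] (e - e * \<alpha>)"
    by (simp add: m_assoc[symmetric])
  have "A \<otimes> ?w \<otimes> C [^] s = (A [^] (1::int) \<otimes> C [^] s) \<otimes> A [^] (e - e * \<alpha>)"
    by (simp add: m_assoc 3)
  also have "\<dots> = C [^] s \<otimes> A [^] (e - e * \<alpha>) \<otimes> A [^] (1 * \<alpha> ^ s)"
    unfolding A_pow_C by (simp add: m_assoc int_pow_mult[symmetric] add.commute)
  also have "\<dots> = ?w \<otimes> (A [^] (1::int) \<otimes> C [^] s)"
    unfolding A_pow_C 3[symmetric] by (simp add: m_assoc)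
  finally show A: "A \<otimes> ?w = ?w \<otimes> A" by (simp add: m_assoc[symmetric])
  have BB: "B \<otimes> ?w = ?w \<otimes> B" using commute_pow[of B B] by simp
  show C: "C \<otimes> ?w = ?w \<otimes> C"
  proof -
    have "B \<otimes> A \<otimes> (C \<otimes> ?w) = A \<otimes> B \<otimes> ?w" by (simp add: AB m_assoc)
    also have "\<dots> = A \<otimes> ?w \<otimes> B" by (simp add: BB m_assoc)
    also have "\<dots> = ?w \<otimes> B \<otimes> A \<otimes> C" by (simp add: A AB m_assoc)
    also have "\<dots> = B \<otimes> (?w \<otimes> A) \<otimes> C" by (simp add: BB[symmetric] m_assoc)
    also have "\<dots> = B \<otimes> A \<otimes> (?w \<otimes> C)" by (simp add: A[symmetric] m_assoc)
    finally show ?thesis by simp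
  qed
  have "?w [^] \<beta> \<otimes> C = C \<otimes> ?w" using C_pow_B[of 1 "(\<beta> - 1) * F"] by (simp add: int_pow_pow)
  then have "?w [^] \<beta> = ?w" using C by simp
  then have "?w [^] (\<beta> - 1) = \<one>" by (simp add: int_pow_diff)
  then show "B [^] ((\<beta> - 1) * ((\<beta> - 1) * F)) = \<one>" by (simp add: int_pow_pow mult.commute)
  \<comment> \<open>Commutation with C lets C^s cancel, so that ?w itself, and not only a conjugate,
    is a power of A.\<close>
  have "C [^] s \<otimes> ?w = ?w \<otimes> C [^] s" using commute_pow[of C ?w "int s"] C
    by (simp add: int_pow_int)
  then have "?w = A [^] (e - e * \<alpha>)" using 3 by (simp)
  then show "\<exists>i. B [^] ((\<beta> - 1) * F) = A [^] (i::int)" by blast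
qed

end

section \<open>Equivalence with the relations of the presentation\<close>

lemma (in group) rels_macd:
  assumes "A \<in> carrier G" "B \<in> carrier G" "rels G A B \<alpha> \<beta>"
  shows "macd G A B (gcomm G A B) \<alpha> \<beta>"
proof
  let ?C = "gcomm G A B"
  show C: "?C \<in> carrier G" using assms by (simp add: gcomm_def)
  have "inv ?C = gcomm G B A" using assms by (simp add: gcomm_def inv_mult_group m_assoc)
  then have r: "inv ?C \<otimes> A \<otimes> ?C = A [^] \<alpha>" "?C \<otimes> B \<otimes> inv ?C = B [^] \<beta>"
    using assms C by (auto simp: rels_def gconj_def) (metis inv_inv)
  show "A \<otimes> ?C = ?C \<otimes> A [^] \<alpha>"
    unfolding r(1)[symmetric] using assms C by (simp add: m_assoc[symmetric])
  show "?C \<otimes> B = B [^] \<beta> \<otimes> ?C"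
    unfolding r(2)[symmetric] using assms C by (simp add: m_assoc)
  show "A \<otimes> B = B \<otimes> A \<otimes> ?C"
    using assms by (simp add: gcomm_def m_assoc[symmetric]) (simp add: m_assoc)
qed (use assms in simp_all)

lemma (in macd) macd_rels: "rels G A B \<alpha> \<beta>"
proof -
  have "inv C \<otimes> (A \<otimes> C) = inv C \<otimes> (C \<otimes> A [^] \<alpha>)" by (simp only: AC)
  moreover have "C \<otimes> B \<otimes> inv C = B [^] \<beta> \<otimes> C \<otimes> inv C" by (simp only: CB)
  ultimately show ?thesis
    unfolding rels_def gconj_def C_eq[symmetric] invC_eq[symmetric]
    by (simp add: m_assoc) (simp add: m_assoc[symmetric])
qed

section \<open>Torsion, normal form and the centre\<close>

text \<open>If $d > 1$ were the order of $b$ modulo $p$, the choice $k = \varphi(d)$ would give $b^k \equiv 1$ modulo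
  both $d$ and $p$, hence $d \mid \varphi(d) < d$.\<close>
lemma prime_dvd_minus_one_of_key:
  fixes p b l :: nat
  assumes p: "prime p" "\<not> p dvd b" and l: "[b ^ l = 1] (mod p)" "coprime b l"
    and key: "\<And>k. int p dvd int b ^ (b ^ k + k) - int b * geo (int b) (b ^ k)"
  shows "int p dvd int b - 1"
proof (rule ccontr)
  assume n1: "\<not> int p dvd int b - 1"
  define d where "d = ord p b"
  have cop: "coprime p b" using p by (simp add: prime_imp_coprime_nat)
  have "d dvd l" using l(1) by (simp only: d_def ord_divides)
  then have cd: "coprime b d" using l(2) coprime_divisors dvd_refl by blast
  have "d \<noteq> 0" using cop by (simp add: d_def)
  have "d \<noteq> 1"
  proof
    assume "d = 1"
    then have "[b ^ 1 = 1] (mod p)" unfolding ord_divides d_def by simp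
    then have "[int b = 1] (mod int p)" by (metis cong_int_iff of_nat_1 power_one_right)
    then show False using n1 by (simp add: cong_iff_dvd_diff)
  qed
  then have d1: "d > 1" using \<open>d \<noteq> 0\<close> by linarith
  define k where "k = totient d"
  define n where "n = b ^ k"
  have k: "0 < k" "k < d" using d1 totient_less[of d] by (auto simp: k_def)
  have "[n = 1] (mod d)" using euler_theorem[OF cd] by (simp add: n_def k_def)
  then have "[b ^ n = b ^ 1] (mod p)" unfolding order_divides_expdiff[OF cop] d_def .
  then have "[int b ^ n = int b] (mod int p)" by (metis cong_int_iff of_nat_power power_one_right)
  then obtain t where t: "int b ^ n = int b + int p * t"
    using dvd_diff_imp by (metis cong_iff_dvd_diff)
  have "int p dvd (int b - 1) * (int b ^ (n + k) - int b * geo (int b) n)"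
    using key[of k] by (simp add: n_def)
  also have "(int b - 1) * (int b ^ (n + k) - int b * geo (int b) n)
      = int b ^ n * int b ^ k * (int b - 1) - int b * ((int b - 1) * geo (int b) n)"
    by (simp add: power_add algebra_simps)
  also have "\<dots> = int b * (int b - 1) * (int b ^ k - 1) + int p * (t * int b ^ k * (int b - 1) - int b * t)"
    unfolding geo_mult_eq t by (simp add: algebra_simps)
  finally have "int p dvd int b * (int b - 1) * (int b ^ k - 1)"
    by (metis dvd_add_left_iff dvd_triv_left)
  moreover have "prime (int p)" "\<not> int p dvd int b" using p by simp_all
  ultimately have "int p dvd int b ^ k - 1" using n1 by (simp add: prime_dvd_mult_iff)
  then have "[int (b ^ k) = int 1] (mod int p)" by (simp add: cong_iff_dvd_diff)
  then have "[b ^ k = 1] (mod p)" using cong_int_iff by blast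
  then have "d dvd k" by (simp only: ord_divides d_def)
  then show False using k by (simp add: nat_dvd_not_less)
qed

section \<open>Product sets, orders and centralisers\<close>

context group
begin

text \<open>The fibre of multiplication over h k consists of the pairs (h t, t^-1 k) with t in both
  subgroups, so all fibres have the size of the intersection. The product set need not be a
  subgroup.\<close>

lemma card_set_mult_dvd:
  assumes H: "subgroup H G" and K: "subgroup K G" and fin: "finite H" "finite K"
  shows "card (H <#> K) dvd card H * card K"
proof -
  have sub: "H \<subseteq> carrier G" "K \<subseteq> carrier G" using H K subgroup.subset by auto
  have fib: "card {(h, k). h \<in> H \<and> k \<in> K \<and> h \<otimes> k = g} = card (H \<inter> K)" if gHK: "g \<in> H <#> K" for g
  proof -
    obtain h k where g: "g = h \<otimes> k" and hk: "h \<in> H" "k \<in> K"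
      using gHK by (auto simp: set_mult_def)
    have "bij_betw (\<lambda>t. (h \<otimes> t, inv t \<otimes> k)) (H \<inter> K) {(h, k). h \<in> H \<and> k \<in> K \<and> h \<otimes> k = g}"
    proof (rule bij_betw_imageI)
      show "inj_on (\<lambda>t. (h \<otimes> t, inv t \<otimes> k)) (H \<inter> K)"
      proof (rule inj_onI)
        fix t u assume "t \<in> H \<inter> K" "u \<in> H \<inter> K" "(h \<otimes> t, inv t \<otimes> k) = (h \<otimes> u, inv u \<otimes> k)"
        moreover have "h \<in> carrier G" "t \<in> carrier G" "u \<in> carrier G" using sub hk calculation by auto
        ultimately show "t = u" by simp
      qed
      show "(\<lambda>t. (h \<otimes> t, inv t \<otimes> k)) ` (H \<inter> K) = {(h, k). h \<in> H \<and> k \<in> K \<and> h \<otimes> k = g}"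
      proof (intro equalityI subsetI)
        fix x assume "x \<in> (\<lambda>t. (h \<otimes> t, inv t \<otimes> k)) ` (H \<inter> K)"
        then obtain t where t: "t \<in> H" "t \<in> K" "x = (h \<otimes> t, inv t \<otimes> k)" by blast
        have "t \<in> carrier G" "h \<in> carrier G" "k \<in> carrier G" using sub hk t by auto
        then have "(h \<otimes> t) \<otimes> (inv t \<otimes> k) = g" by (metis g inv_closed m_assoc m_closed r_inv r_one)
        then show "x \<in> {(h, k). h \<in> H \<and> k \<in> K \<and> h \<otimes> k = g}"
          using t hk H K by (auto simp: subgroup.m_closed subgroup.m_inv_closed)
      next
        fix x assume "x \<in> {(h, k). h \<in> H \<and> k \<in> K \<and> h \<otimes> k = g}"
        then obtain h' k' where x: "x = (h', k')" "h' \<in> H" "k' \<in> K" "h' \<otimes> k' = h \<otimes> k"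
          using g by blast
        have c: "h \<in> carrier G" "k \<in> carrier G" "h' \<in> carrier G" "k' \<in> carrier G"
          using sub hk x by auto
        have "h' = h \<otimes> k \<otimes> inv k'" using x(4)[symmetric] c by (simp add: m_assoc)
        then have e: "inv h \<otimes> h' = k \<otimes> inv k'" using c by (simp add: m_assoc[symmetric])
        have "inv h \<otimes> h' \<in> H \<inter> K"
          using hk x H K e by (metis IntI subgroup.m_closed subgroup.m_inv_closed)
        moreover have "x = (h \<otimes> (inv h \<otimes> h'), inv (inv h \<otimes> h') \<otimes> k)"
          using c by (simp add: x(1) m_assoc[symmetric]) (simp add: e inv_mult_group m_assoc)
        ultimately show "x \<in> (\<lambda>t. (h \<otimes> t, inv t \<otimes> k)) ` (H \<inter> K)" by blast
      qed
    qed
    then show ?thesis by (simp add: bij_betw_same_card)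
  qed
  have "H \<times> K = (\<Union>g\<in>H <#> K. {(h, k). h \<in> H \<and> k \<in> K \<and> h \<otimes> k = g})"
    by (auto simp: set_mult_def)
  moreover have "finite (H <#> K)" using fin by (auto simp: set_mult_def)
  ultimately have "card (H \<times> K) = (\<Sum>g\<in>H <#> K. card {(h, k). h \<in> H \<and> k \<in> K \<and> h \<otimes> k = g})"
    using fin by (simp only:) (rule card_UN_disjoint, auto intro: finite_subset[of _ "H \<times> K"])
  also have "\<dots> = card (H <#> K) * card (H \<inter> K)" by (simp add: fib)
  finally show ?thesis by (metis card_cartesian_product dvd_triv_left)
qed

lemma ord_gt_0_int_pow:
  assumes "x \<in> carrier G" "ord x > 0"
  shows "x [^] (i::int) = x [^] nat (i mod int (ord x))"
proof -
  have "x [^] i = x [^] (i mod int (ord x))"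
    using assms(1) by (simp add: int_pow_eq mod_eq_dvd_iff[symmetric])
  also have "\<dots> = x [^] nat (i mod int (ord x))"
    using assms(2) by (simp flip: int_pow_int)
  finally show ?thesis .
qed

lemma finite_ord_gt_0: "finite (carrier G) \<Longrightarrow> x \<in> carrier G \<Longrightarrow> ord x > 0"
  using ord_ge_1 by fastforce

lemma generate_centralizes:
  assumes "S \<subseteq> carrier G" "z \<in> carrier G" "\<And>s. s \<in> S \<Longrightarrow> s \<otimes> z = z \<otimes> s" "g \<in> generate G S"
  shows "g \<otimes> z = z \<otimes> g"
  using assms(4)
proof (induction rule: generate.induct)
  case (inv h)
  then have h: "h \<in> carrier G" "h \<otimes> z = z \<otimes> h" using assms by auto
  have "h [^] (-1::int) \<otimes> z = z \<otimes> h [^] (-1::int)"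
    by (rule commute_pow) (use assms h in auto)
  then show ?case using h by (simp add: int_pow_neg)
next
  case (eng g h)
  then have "g \<in> carrier G" "h \<in> carrier G" using assms(1) generate_in_carrier by blast+
  then show ?case using eng assms(2) by (metis m_assoc)
qed (use assms in auto)

end

section \<open>Finite orders and the primes dividing them\<close>

context macd
begin

text \<open>Serves twice: \<beta> is replaced by a natural number in \<open>prime_dvd_ord_B\<close>,
  and the model, built for natural exponents, becomes one for the given integers.\<close>

lemma macd_cong:
  assumes "int (ord A) dvd \<alpha> - \<alpha>'" "int (ord B) dvd \<beta> - \<beta>'"
  shows "macd G A B C \<alpha>' \<beta>'"
proof -
  have "A [^] \<alpha>' = A [^] \<alpha>" "B [^] \<beta>' = B [^] \<beta>" using assms by (simp_all add: int_pow_eq)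
  then show ?thesis using AC CB AB by unfold_locales simp_all
qed

lemma key_exponent:
  assumes "ord A > 0" "int (ord B) dvd \<beta> ^ k - int n"
  shows "int (ord B) dvd (\<beta> - 1) * ((\<beta> - 1) * (\<beta> ^ (n + k) - \<beta> * geo \<beta> n))"
proof -
  define n' where "n' = nat (\<alpha> ^ k mod int (ord A))"
  have n': "A [^] n' = A [^] (\<alpha> ^ k)" unfolding n'_def using ord_gt_0_int_pow[OF A_closed assms(1)] by simp
  have n: "B [^] n = B [^] (\<beta> ^ k)" using assms(2) by (simp add: int_pow_eq flip: int_pow_int)
  show ?thesis using key_central(3)[OF key[OF n n']] by (simp add: int_pow_eq_id)
qed

text \<open>The case k = 2 of \<open>key\<close> is available before any torsion is known, since
  \<alpha>^2 and \<beta>^2 are natural numbers whatever the signs. The resulting exponent kills B,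
  and it is nonzero because its vanishing would make \<beta> divide 1.\<close>

lemma ord_B_gt_0:
  assumes "\<not> \<beta> dvd 1" "\<beta> \<noteq> 0"
  shows "ord B > 0"
proof -
  define n n' where "n = nat (\<beta>^2)" and "n' = nat (\<alpha>^2)"
  have n0: "n > 0" using assms by (simp add: n_def)
  have "B [^] n = B [^] \<beta>^2" "A [^] n' = A [^] \<alpha>^2"
    by (simp_all add: n_def n'_def flip: int_pow_int)
  from key_central(3)[OF key[OF this]]
  have d: "int (ord B) dvd (\<beta> - 1) * ((\<beta> - 1) * (\<beta> ^ (n + 2) - \<beta> * geo \<beta> n))"
    by (simp add: int_pow_eq_id)
  have "\<beta> ^ (n + 2) - \<beta> * geo \<beta> n \<noteq> 0"
  proof
    assume 0: "\<beta> ^ (n + 2) - \<beta> * geo \<beta> n = 0"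
    have "\<beta> * (\<beta> ^ (n + 1) - geo \<beta> n) = 0" using 0 by (simp add: algebra_simps)
    then have "geo \<beta> n = \<beta> ^ (n + 1)" using assms by simp
    then have "\<beta> ^ n - 1 = (\<beta> - 1) * \<beta> ^ (n + 1)" by (metis geo_mult_eq)
    then have "1 = \<beta> * (\<beta> ^ (n - 1) - (\<beta> - 1) * \<beta> ^ n)"
      using n0 by (cases n) (simp_all add: algebra_simps)
    then show False using assms(1) by (metis dvd_triv_left)
  qed
  moreover have "\<beta> \<noteq> 1" using assms by auto
  ultimately show ?thesis using d by (cases "ord B = 0") auto
qed

lemma C_pow_ord_B: "C [^] ord B = B [^] (\<beta> * geo \<beta> (ord B))"
proof -
  have "A \<otimes> (inv C [^] ord B \<otimes> B [^] (\<beta> * geo \<beta> (ord B))) = A" by (simp add: B_pow_A[symmetric])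
  then have "inv C [^] ord B \<otimes> B [^] (\<beta> * geo \<beta> (ord B)) = \<one>" by simp
  then show ?thesis by (simp add: nat_pow_inv inv_solve_left')
qed

lemma ord_C_gt_0:
  assumes "ord B > 0"
  shows "ord C > 0"
proof -
  have "C [^] (ord B * ord B) = (B [^] (\<beta> * geo \<beta> (ord B))) [^] ord B"
    by (simp add: C_pow_ord_B flip: nat_pow_pow)
  also have "\<dots> = (B [^] ord B) [^] (\<beta> * geo \<beta> (ord B))"
    by (simp add: int_pow_pow mult.commute flip: int_pow_int)
  finally have "ord C dvd ord B * ord B" by (simp add: pow_eq_id)
  then show ?thesis using assms by (auto intro: Nat.gr0I)
qed

text \<open>Conjugation by C is injective, but a prime p dividing both o(B) and \<beta> would make
  it send the nontrivial element B^(o(B)/p) to 1.\<close>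

lemma coprime_ord_B:
  assumes "ord B > 0" "prime p" "p dvd ord B" shows "\<not> int p dvd \<beta>"
proof
  assume pb: "int p dvd \<beta>"
  obtain j where j: "ord B = p * j" using assms by blast
  have "int (ord B) dvd int j * \<beta>" using pb j by (metis dvd_refl mult.commute mult_dvd_mono of_nat_mult)
  then have "B [^] (int j * \<beta> ^ 1) = \<one>" by (simp add: int_pow_eq_id)
  then have "C \<otimes> B [^] int j = C" using C_pow_B[of 1 "int j"] by simp
  then have "B [^] int j = \<one>" by simp
  then have "int (ord B) dvd int j" by (simp only: int_pow_eq_id[OF B_closed])
  then have "p * j dvd j" using j by simp
  then show False using assms j by (auto dest: dvd_imp_le prime_gt_1_nat)
qed

text \<open>The key exponent is read modulo p for two kinds of k. With k = 0 it shows that the order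
  of \<beta> modulo p divides o(B), which is coprime to \<beta>; with arbitrary k it feeds
  \<open>prime_dvd_minus_one_of_key\<close>.\<close>

lemma prime_dvd_ord_B:
  assumes oA: "ord A > 0" and oB: "ord B > 0" and p: "prime p" "p dvd ord B"
  shows "int p dvd \<beta> - 1"
proof (rule ccontr)
  assume nd: "\<not> int p dvd \<beta> - 1"
  define b where "b = nat (\<beta> mod int (ord B))"
  have bm: "int (ord B) dvd \<beta> - int b" using oB by (simp add: b_def mod_eq_dvd_iff[symmetric])
  interpret b: macd G A B C \<alpha> "int b" by (rule macd_cong) (use bm in auto)
  have pp: "prime (int p)" "int p dvd int (ord B)" using p by simp_all
  have "int p dvd \<beta> - int b" using pp bm dvd_trans by blast
  then have nb: "\<not> int p dvd int b - 1"
    using nd dvd_add[of "int p" "\<beta> - int b" "int b - 1"] by auto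
  have npb: "\<not> p dvd b" using b.coprime_ord_B[OF oB p] by simp
  have F: "int p dvd int b ^ (n + k) - int b * geo (int b) n" if "int (ord B) dvd int b ^ k - int n" for n k
    using dvd_trans[OF pp(2) b.key_exponent[OF oA that]] nb pp(1) by (simp add: prime_dvd_mult_iff)
  have "int p dvd int b - 1"
  proof (rule prime_dvd_minus_one_of_key[OF p(1) npb])
    show "coprime b (ord B)"
    proof (rule ccontr)
      assume "\<not> coprime b (ord B)"
      then have "gcd b (ord B) \<noteq> 1" by (simp only: coprime_iff_gcd_eq_1 not_False_eq_True)
      then obtain r where r: "prime r" "r dvd gcd b (ord B)" using prime_factor_nat by blast
      then have "r dvd b" "r dvd ord B" by (simp_all only: gcd_greatest_iff)
      then show False using b.coprime_ord_B[OF oB r(1)] by simp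
    qed
    show "int p dvd int b ^ (b ^ k + k) - int b * geo (int b) (b ^ k)" for k
      by (rule F) simp
    \<comment> \<open>For k = 0 the representative n = 1 would only give the exponent b - b = 0;
      shifting it by o(B) makes the statement nontrivial.\<close>
    have "int p dvd (int b - 1) * (int b ^ (1 + ord B) - int b * geo (int b) (1 + ord B))"
      using F[of 0 "1 + ord B"] by simp
    also have "\<dots> = int b ^ (1 + ord B) * (int b - 1) - int b * ((int b - 1) * geo (int b) (1 + ord B))"
      by (simp add: algebra_simps)
    also have "\<dots> = int b * (1 - int b ^ ord B)"
      unfolding geo_mult_eq by (simp add: algebra_simps)
    finally have "int p dvd int b ^ ord B - 1" using npb pp(1)
      by (simp add: prime_dvd_mult_iff dvd_diff_commute)
    then have "[int (b ^ ord B) = int 1] (mod int p)" by (simp add: cong_iff_dvd_diff)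
    then show "[b ^ ord B = 1] (mod p)" using cong_int_iff by blast
  qed
  then show False using nb by blast
qed

lemma ord_C_dvd_ord_B:
  assumes "ord A > 0" "ord B > 0"
  shows "ord C dvd ord B"
proof -
  have "int (ord B) dvd geo \<beta> (ord B)"
    by (rule geo_dvd) (use assms prime_dvd_ord_B in auto)
  then have "C [^] ord B = \<one>" by (simp add: C_pow_ord_B int_pow_eq_id)
  then show ?thesis by (simp add: pow_eq_id)
qed

text \<open>Torsion turns the inverse of B into a positive power, so closure of W under right
  multiplication by powers of A and by B suffices. The exponent of C stays natural, since moving A
  past the inverse of C would require inverting \<alpha>.\<close>

lemma normal_form:
  assumes oA: "ord A > 0" and oB: "ord B > 0" and g: "g \<in> generate G {A, B}"
  shows "\<exists>(j::nat) (k::nat) (i::nat). g = B [^] j \<otimes> (C [^] k \<otimes> A [^] i)"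
proof -
  define W where "W = {B [^] (j::int) \<otimes> (C [^] (k::nat) \<otimes> A [^] (i::int)) | j k i. True}"
  have WA: "x \<otimes> A [^] (l::int) \<in> W" if "x \<in> W" for x l
  proof -
    obtain j k i where x: "x = B [^] (j::int) \<otimes> (C [^] (k::nat) \<otimes> A [^] (i::int))"
      using \<open>x \<in> W\<close> by (auto simp: W_def)
    have "x \<otimes> A [^] l = B [^] j \<otimes> (C [^] k \<otimes> A [^] (i + l))"
      by (simp add: x m_assoc int_pow_mult)
    then show ?thesis by (auto simp: W_def)
  qed
  have WB: "x \<otimes> B \<in> W" if "x \<in> W" for x
  proof -
    obtain j k i where x: "x = B [^] (j::int) \<otimes> (C [^] (k::nat) \<otimes> A [^] (i::int))"
      using \<open>x \<in> W\<close> by (auto simp: W_def)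
    obtain n :: nat where n: "A [^] i = A [^] n" using ord_gt_0_int_pow oA by blast
    have "x \<otimes> B = B [^] j \<otimes> (C [^] k \<otimes> (A [^] n \<otimes> B))" by (simp add: x n m_assoc)
    also have "\<dots> = B [^] j \<otimes> ((C [^] k \<otimes> B [^] (1::int)) \<otimes> (C [^] n \<otimes> A [^] (\<alpha> * geo \<alpha> n)))"
      by (simp add: A_pow_B m_assoc)
    also have "\<dots> = B [^] (j + \<beta> ^ k) \<otimes> (C [^] (k + n) \<otimes> A [^] (\<alpha> * geo \<alpha> n))"
      unfolding C_pow_B by (simp add: int_pow_mult nat_pow_mult[symmetric] m_assoc)
    finally show ?thesis by (auto simp: W_def)
  qed
  have WBn: "x \<otimes> B [^] (n::nat) \<in> W" if "x \<in> W" for x n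
  proof (induction n)
    case 0
    have "x \<in> carrier G" using that by (auto simp: W_def)
    then show ?case using that by simp
  next
    case (Suc n)
    moreover have "x \<in> carrier G" using that by (auto simp: W_def)
    ultimately show ?case using WB by (simp add: m_assoc[symmetric])
  qed
  have W1: "\<one> \<in> W" unfolding W_def by (rule CollectI, intro exI[of _ 0]) simp
  have "\<forall>x\<in>W. x \<otimes> g \<in> W"
    using g
  proof (induction rule: generate.induct)
    case one
    have "W \<subseteq> carrier G" by (auto simp: W_def)
    then show ?case by auto
  next
    case (incl h)
    then show ?case using WA[of _ 1] WB by auto
  next
    case (inv h)
    have "inv B = B [^] (-1::int)" by (simp add: int_pow_neg)
    then obtain n :: nat where n: "inv B = B [^] n" using ord_gt_0_int_pow[OF B_closed oB] by metis
    show ?case using inv WA[of _ "-1"] WBn by (auto simp: int_pow_neg n)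
  next
    case (eng g h)
    have "g \<in> carrier G" "h \<in> carrier G" using eng generate_in_carrier[of "{A, B}"] by auto
    moreover have "x \<in> carrier G" if "x \<in> W" for x using that by (auto simp: W_def)
    ultimately show ?case using eng by (simp add: m_assoc[symmetric])
  qed
  moreover have "g \<in> carrier G" using g generate_in_carrier[of "{A, B}"] by auto
  ultimately have "g \<in> W" using W1 by force
  then obtain j k i where "g = B [^] (j::int) \<otimes> (C [^] (k::nat) \<otimes> A [^] (i::int))"
    by (auto simp: W_def)
  then show ?thesis using ord_gt_0_int_pow oA oB by (metis A_closed B_closed)
qed

section \<open>Order of the generated group and its centre\<close>

lemma C_in_generate: "C \<in> generate G {A, B}"
  unfolding C_eq gcomm_def by (intro generate.eng generate.inv generate.incl) auto

text \<open>Divisibility rather than an inequality matters: it shows later that the 2-parts of the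
  generators generate a 2-group and the odd parts a group of odd order. <C><A> is a subgroup because
  A^i C^k lies in C^k <A>; multiplying by <B> reaches everything by
  \<open>normal_form\<close>.\<close>

lemma card_generate_dvd:
  assumes oA: "ord A > 0" and oB: "ord B > 0"
  shows "finite (generate G {A, B})" "card (generate G {A, B}) dvd ord A * ord B * ord C"
proof -
  have oC: "ord C > 0" using ord_C_gt_0 oB by blast
  let ?H = "\<lambda>x. generate G {x}"
  have sub: "subgroup (?H A) G" "subgroup (?H B) G" "subgroup (?H C) G"
    by (simp_all add: generate_is_subgroup)
  have fin: "finite (?H A)" "finite (?H B)" "finite (?H C)"
    using oA oB oC by (simp_all add: generate_pow_card card_ge_0_finite)
  have gen: "?H A = {A [^] n | n. n \<in> (UNIV::nat set)}" "?H B = {B [^] n | n. n \<in> (UNIV::nat set)}"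
    "?H C = {C [^] n | n. n \<in> (UNIV::nat set)}"
    using oA oB oC by (simp_all add: generate_pow_nat)
  define K where "K = ?H C <#> ?H A"
  have K: "K = {C [^] (k::nat) \<otimes> A [^] (i::int) | k i. True}"
    unfolding K_def set_mult_def gen(3) generate_pow[OF A_closed] by auto
  have Kcl: "C [^] (k::nat) \<otimes> A [^] (i::int) \<in> K" for k i using K by blast
  have AC_K: "A [^] (i::int) \<otimes> C [^] (k::nat) \<in> K" for i k using K A_pow_C by blast
  have "subgroup K G"
  proof
    show "K \<subseteq> carrier G" using K by auto
    show "\<one> \<in> K" using Kcl[of 0 0] by simp
  next
    fix x y assume "x \<in> K" "y \<in> K"
    then obtain k i l j where xy: "x = C [^] (k::nat) \<otimes> A [^] (i::int)" "y = C [^] (l::nat) \<otimes> A [^] (j::int)"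
      using K by blast
    have "x \<otimes> y = C [^] k \<otimes> (A [^] i \<otimes> C [^] l) \<otimes> A [^] j" by (simp add: xy m_assoc)
    also have "\<dots> = C [^] (k + l) \<otimes> A [^] (i * \<alpha> ^ l + j)"
      unfolding A_pow_C by (simp add: m_assoc nat_pow_mult[symmetric] int_pow_mult)
    finally show "x \<otimes> y \<in> K" using Kcl by simp
  next
    fix x assume "x \<in> K"
    then obtain k i where x: "x = C [^] (k::nat) \<otimes> A [^] (i::int)" using K by blast
    have "inv x = A [^] (- i) \<otimes> C [^] (- int k)" by (simp add: x inv_mult_group int_pow_neg int_pow_int)
    then show "inv x \<in> K" using ord_gt_0_int_pow[OF C_closed oC] AC_K by simp
  qed
  moreover have finK: "finite K" using fin by (auto simp: K_def set_mult_def)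
  ultimately have d: "card (?H B <#> K) dvd card (?H B) * card K"
    using card_set_mult_dvd sub fin by blast
  have "card K dvd card (?H C) * card (?H A)" unfolding K_def using card_set_mult_dvd sub fin by blast
  then have "card (?H B) * card K dvd ord A * ord B * ord C"
    using mult_dvd_mono[OF dvd_refl[of "ord B"]] by (simp add: generate_pow_card[symmetric] ac_simps)
  moreover have "generate G {A, B} = ?H B <#> K"
  proof
    show "generate G {A, B} \<subseteq> ?H B <#> K"
    proof
      fix g assume "g \<in> generate G {A, B}"
      then obtain j k i where "g = B [^] (j::nat) \<otimes> (C [^] (k::nat) \<otimes> A [^] (i::nat))"
        using normal_form oA oB by blast
      moreover have "C [^] k \<otimes> A [^] i \<in> K" using Kcl[of k "int i"] by (simp add: int_pow_int)
      ultimately show "g \<in> ?H B <#> K" unfolding set_mult_def gen(2) by blast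
    qed
    have "subgroup (generate G {A, B}) G" by (simp add: generate_is_subgroup)
    moreover have "?H A \<subseteq> generate G {A, B}" "?H B \<subseteq> generate G {A, B}" by (auto intro!: mono_generate)
    moreover have "?H C \<subseteq> generate G {A, B}"
      by (rule generate_subgroup_incl) (use C_in_generate calculation in auto)
    ultimately show "?H B <#> K \<subseteq> generate G {A, B}"
      unfolding K_def set_mult_def by (auto dest!: subsetD intro!: subgroup.m_closed)
  qed
  moreover have "finite (?H B <#> K)" using fin finK by (auto simp: set_mult_def)
  ultimately show "finite (generate G {A, B})" "card (generate G {A, B}) dvd ord A * ord B * ord C"
    using d dvd_trans by auto
qed

text \<open>With n = o(A)/p a multiple of o(C), the factor C^n disappears from
  \<open>A_pow_B\<close>, and \<open>geo_cong_strong\<close> makes the remaining exponent of A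
  congruent to n modulo o(A) = p n.\<close>

lemma A_pow_central_or_ord_C_eq:
  assumes oA: "ord A > 0" and oB: "ord B > 0" and nt: "A \<noteq> \<one>" and four: "4 dvd \<alpha> - 1"
    and neq: "ord C \<noteq> ord A"
  shows "\<exists>n::nat. A [^] n \<noteq> \<one> \<and> A [^] n \<otimes> B = B \<otimes> A [^] n"
proof -
  have "ord (inv C) dvd ord A" by (rule macd.ord_C_dvd_ord_B[OF swap oB oA])
  then obtain t where t: "ord A = ord C * t" by auto
  then have "t \<noteq> 1" "t \<noteq> 0" using neq oA by auto
  then obtain p where p: "prime p" "p dvd t" using prime_factor_nat by blast
  then obtain u where u: "t = p * u" by blast
  define n where "n = ord C * u"
  have oAn: "ord A = p * n" by (simp add: t u n_def ac_simps)
  have n0: "n > 0" using oA oAn by (cases n) auto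
  have pr: "int r dvd \<alpha> - 1" if "prime r" "r dvd ord A" for r
    using macd.prime_dvd_ord_B[OF swap oB oA that] .
  have "int (p * n) dvd geo \<alpha> n - int n"
    by (rule geo_cong_strong) (use p n0 oAn pr four in auto)
  moreover have "int (p * n) dvd (\<alpha> - 1) * geo \<alpha> n"
  proof -
    have "int n dvd geo \<alpha> n" by (rule geo_dvd) (use n0 oAn pr in auto)
    moreover have "int p dvd \<alpha> - 1" using pr p oAn by simp
    ultimately show ?thesis by (simp add: mult_dvd_mono)
  qed
  ultimately have "int (ord A) dvd (\<alpha> - 1) * geo \<alpha> n + (geo \<alpha> n - int n)"
    unfolding oAn by (rule dvd_add[rotated])
  then have "int (ord A) dvd \<alpha> * geo \<alpha> n - int n" by (simp add: algebra_simps)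
  then have "A [^] (\<alpha> * geo \<alpha> n) = A [^] n"
    by (simp add: int_pow_eq dvd_diff_commute flip: int_pow_int)
  moreover have "C [^] n = \<one>" by (simp add: pow_eq_id n_def)
  ultimately have "A [^] n \<otimes> B = B \<otimes> A [^] n" by (simp add: A_pow_B)
  moreover have "n < p * n" using n0 prime_gt_1_nat[OF p(1)] by simp
  then have "A [^] n \<noteq> \<one>" using n0 nat_dvd_not_less by (simp add: pow_eq_id oAn)
  ultimately show ?thesis by blast
qed

text \<open>\<alpha>^n - 1 is (\<alpha> - 1) times a geometric sum; the first factor contributes p
  and the second n, together all of o(A).\<close>

lemma C_pow_commutes_A:
  assumes oA: "ord A > 0" and oB: "ord B > 0" and p: "prime p" "ord A = p * n"
  shows "A \<otimes> C [^] n = C [^] n \<otimes> A"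
proof -
  have pr: "int r dvd \<alpha> - 1" if "prime r" "r dvd ord A" for r
    using macd.prime_dvd_ord_B[OF swap oB oA that] .
  have "n > 0" using oA p by (cases n) auto
  then have "int n dvd geo \<alpha> n" by (intro geo_dvd) (use p pr in auto)
  moreover have "int p dvd \<alpha> - 1" using pr p by simp
  ultimately have "int (ord A) dvd (\<alpha> - 1) * geo \<alpha> n" by (simp add: p mult_dvd_mono)
  then have "A [^] (1 * \<alpha> ^ n) = A"
    using int_pow_eq[of A 1 "\<alpha> ^ n"] by (simp add: geo_mult_eq)
  then show ?thesis using A_pow_C[of 1 n] by simp
qed

text \<open>Both $o(A)$ and $o(B)$ are multiples of $o(C)$. If $p$ divides $o(A)/o(C)$ then $A^{o(A)/p}$ is central;
  if all three orders agree then $C^{o(C)/p}$ is central.\<close>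
lemma centre_nontrivial:
  assumes gen: "generate G {A, B} = carrier G" and fin: "finite (carrier G)"
    and four: "4 dvd \<alpha> - 1" "4 dvd \<beta> - 1" and nt: "carrier G \<noteq> {\<one>}"
  shows "\<exists>z\<in>carrier G. z \<noteq> \<one> \<and> (\<forall>g\<in>carrier G. g \<otimes> z = z \<otimes> g)"
proof -
  have oA: "ord A > 0" and oB: "ord B > 0" using fin finite_ord_gt_0 by auto
  have cent: ?thesis if "z \<in> carrier G" "z \<noteq> \<one>" "A \<otimes> z = z \<otimes> A" "B \<otimes> z = z \<otimes> B" for z
    using generate_centralizes[of "{A, B}" z] that gen by (intro bexI[of _ z]) auto
  consider "A = \<one>" | "B = \<one>" | "A \<noteq> \<one>" "B \<noteq> \<one>" "ord C \<noteq> ord A" | "A \<noteq> \<one>" "B \<noteq> \<one>" "ord C \<noteq> ord B"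
    | "A \<noteq> \<one>" "ord C = ord A" "ord C = ord B" by blast
  then show ?thesis
  proof cases
    case 1
    have "B \<noteq> \<one>"
    proof
      assume "B = \<one>"
      then have "carrier G = generate G {\<one>}" using gen 1 by simp
      then show False using nt generate_one by simp
    qed
    then show ?thesis using 1 by (intro cent[of B]) auto
  next
    case 2
    have "A \<noteq> \<one>"
    proof
      assume "A = \<one>"
      then have "carrier G = generate G {\<one>}" using gen 2 by simp
      then show False using nt generate_one by simp
    qed
    then show ?thesis using 2 by (intro cent[of A]) auto
  next
    case 3
    then obtain n :: nat where "A [^] n \<noteq> \<one>" "A [^] n \<otimes> B = B \<otimes> A [^] n"
      using A_pow_central_or_ord_C_eq oA oB four by blast
    then show ?thesis using nat_pow_comm[of A 1 n] by (intro cent[of "A [^] n"]) auto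
  next
    case 4
    then have "ord (inv C) \<noteq> ord B" by simp
    then obtain n :: nat where "B [^] n \<noteq> \<one>" "B [^] n \<otimes> A = A \<otimes> B [^] n"
      using macd.A_pow_central_or_ord_C_eq[OF swap oB oA] four 4 by blast
    then show ?thesis using nat_pow_comm[of B 1 n] by (intro cent[of "B [^] n"]) auto
  next
    case 5
    then have "ord A \<noteq> 1" using ord_eq_1[OF A_closed] by blast
    then obtain p n where p: "prime p" "ord A = p * n" using prime_factor_nat by blast
    have "n > 0" using oA p by (cases n) auto
    have A: "A \<otimes> C [^] n = C [^] n \<otimes> A" by (rule C_pow_commutes_A[OF oA oB p])
    have "B \<otimes> (inv C) [^] n = (inv C) [^] n \<otimes> B"
      by (rule macd.C_pow_commutes_A[OF swap oB oA p(1)]) (use 5 p in simp)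
    then have "inv (C [^] n) [^] (-1::int) \<otimes> B = B \<otimes> inv (C [^] n) [^] (-1::int)"
      by (intro commute_pow) (simp_all add: nat_pow_inv)
    then have B: "B \<otimes> C [^] n = C [^] n \<otimes> B" by (simp add: int_pow_neg)
    have "n < p * n" using \<open>n > 0\<close> prime_gt_1_nat[OF p(1)] by simp
    then have "\<not> ord C dvd n" using \<open>n > 0\<close> p(2) 5 nat_dvd_not_less by simp
    then have "C [^] n \<noteq> \<one>" by (simp add: pow_eq_id)
    then show ?thesis using A B by (intro cent[of "C [^] n"]) auto
  qed
qed

end

section \<open>Nilpotency\<close>

text \<open>The upper central series. The commutator form replaces the usual centre of G modulo the
  previous term and so avoids iterated quotients.\<close>

fun ucs :: "('a, 'b) monoid_scheme \<Rightarrow> nat \<Rightarrow> 'a set" where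
  "ucs G 0 = {\<one>\<^bsub>G\<^esub>}"
| "ucs G (Suc i) = {x \<in> carrier G. \<forall>g\<in>carrier G. gcomm G x g \<in> ucs G i}"

context group
begin

lemma gcomm_closed [simp, intro]: "x \<in> carrier G \<Longrightarrow> y \<in> carrier G \<Longrightarrow> gcomm G x y \<in> carrier G"
  by (simp add: gcomm_def)

lemma mult_swap_gcomm: "x \<in> carrier G \<Longrightarrow> y \<in> carrier G \<Longrightarrow> x \<otimes> y = y \<otimes> x \<otimes> gcomm G x y"
  by (simp add: gcomm_def m_assoc[symmetric]) (simp add: m_assoc)

lemma gcomm_eq_one_iff:
  assumes "x \<in> carrier G" "y \<in> carrier G" shows "gcomm G x y = \<one> \<longleftrightarrow> x \<otimes> y = y \<otimes> x"
  using mult_swap_gcomm[OF assms] assms by (metis gcomm_closed l_cancel_one' m_closed r_cancel_one')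

lemma inv_mult_cancel_left [simp]:
  assumes "x \<in> carrier G" "y \<in> carrier G"
  shows "inv x \<otimes> (x \<otimes> y) = y" "x \<otimes> (inv x \<otimes> y) = y"
  using assms by (simp_all add: m_assoc[symmetric])

lemma normal_centre_mod:
  assumes N: "N \<lhd> G"
  shows "{x \<in> carrier G. \<forall>g\<in>carrier G. gcomm G x g \<in> N} \<lhd> G"
proof -
  interpret N: normal N G by (rule N)
  have conj: "g \<otimes> n \<otimes> inv g \<in> N" "inv g \<otimes> n \<otimes> g \<in> N" if "g \<in> carrier G" "n \<in> N" for g n
    using N.inv_op_closed1 N.inv_op_closed2 that by auto
  let ?Z = "{x \<in> carrier G. \<forall>g\<in>carrier G. gcomm G x g \<in> N}"
  have "subgroup ?Z G"
  proof
    show "?Z \<subseteq> carrier G" by auto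
    show "\<one> \<in> ?Z" by (auto simp: gcomm_def)
  next
    fix x y assume xy: "x \<in> ?Z" "y \<in> ?Z"
    have "gcomm G (x \<otimes> y) g \<in> N" if g: "g \<in> carrier G" for g
    proof -
      have "gcomm G (x \<otimes> y) g = (inv y \<otimes> gcomm G x g \<otimes> y) \<otimes> gcomm G y g"
        using xy g by (simp add: gcomm_def inv_mult_group m_assoc)
      then show ?thesis using xy g conj by auto
    qed
    then show "x \<otimes> y \<in> ?Z" using xy by auto
  next
    fix x assume x: "x \<in> ?Z"
    have "gcomm G (inv x) g \<in> N" if g: "g \<in> carrier G" for g
    proof -
      have "gcomm G (inv x) g = x \<otimes> inv (gcomm G x g) \<otimes> inv x"
        using x g by (simp add: gcomm_def inv_mult_group m_assoc)
      then show ?thesis using x g conj by auto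
    qed
    then show "inv x \<in> ?Z" using x by auto
  qed
  moreover have "h \<otimes> x \<otimes> inv h \<in> ?Z" if h: "h \<in> carrier G" and x: "x \<in> ?Z" for h x
  proof -
    have "gcomm G (h \<otimes> x \<otimes> inv h) g \<in> N" if g: "g \<in> carrier G" for g
    proof -
      have "gcomm G (h \<otimes> x \<otimes> inv h) g = h \<otimes> gcomm G x (inv h \<otimes> g \<otimes> h) \<otimes> inv h"
        using x h g by (simp add: gcomm_def inv_mult_group m_assoc)
      then show ?thesis using x g h conj by auto
    qed
    then show ?thesis using x h by auto
  qed
  ultimately show ?thesis by (auto intro!: normal_invI)
qed

lemma ucs_normal: "ucs G i \<lhd> G"
proof (induction i)
  case 0
  then show ?case using one_is_normal by simp
next
  case (Suc i)
  then show ?case using normal_centre_mod by simp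
qed

lemma ucs_carrier: "ucs G i \<subseteq> carrier G"
  using ucs_normal normal_imp_subgroup subgroup.subset by blast

lemma ucs_Suc: "ucs G i \<subseteq> ucs G (Suc i)"
proof
  interpret N: normal "ucs G i" G by (rule ucs_normal)
  fix x assume x: "x \<in> ucs G i"
  then have xc: "x \<in> carrier G" using ucs_carrier by blast
  have "gcomm G x g \<in> ucs G i" if g: "g \<in> carrier G" for g
  proof -
    have "gcomm G x g = inv x \<otimes> (inv g \<otimes> x \<otimes> g)" using xc g by (simp add: gcomm_def m_assoc)
    then show ?thesis using x g N.inv_op_closed1 by simp
  qed
  then show "x \<in> ucs G (Suc i)" using xc by simp
qed

lemma ucs_mono: "i \<le> j \<Longrightarrow> ucs G i \<subseteq> ucs G j"
  by (rule lift_Suc_mono_le[of "ucs G"]) (rule ucs_Suc)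

lemma lcs_ucs:
  assumes "ucs G c = carrier G" "i \<le> c"
  shows "lcs G i \<subseteq> ucs G (c - i)"
  using assms(2)
proof (induction i)
  case 0
  then show ?case using assms by simp
next
  case (Suc i)
  then obtain d where d: "c - i = Suc d" "c - Suc i = d" by (metis Suc_diff_Suc Suc_le_eq)
  have "{gcomm G x y | x y. x \<in> lcs G i \<and> y \<in> carrier G} \<subseteq> ucs G d"
    using Suc d by auto
  then show ?case using d by (simp add: generate_subgroup_incl ucs_normal normal_imp_subgroup)
qed

text \<open>A central commutator is multiplicative in each argument, so its order divides both m and
  n.\<close>

lemma central_gcomm_coprime:
  fixes m n :: nat
  assumes c: "x \<in> carrier G" "y \<in> carrier G"
    and cent: "\<And>g. g \<in> carrier G \<Longrightarrow> g \<otimes> gcomm G x y = gcomm G x y \<otimes> g"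
    and pw: "x [^] m = \<one>" "y [^] n = \<one>" "coprime m n"
  shows "gcomm G x y = \<one>"
proof -
  let ?c = "gcomm G x y"
  have cc: "?c \<in> carrier G" using c by simp
  have "x \<otimes> y = y \<otimes> (x \<otimes> ?c)" using mult_swap_gcomm[of x y] c by (simp add: m_assoc)
  then have "x [^] int m \<otimes> y = y \<otimes> (x \<otimes> ?c) [^] int m" by (intro pow_intertwine) (use c in auto)
  also have "(x \<otimes> ?c) [^] int m = x [^] int m \<otimes> ?c [^] int m"
    by (rule int_pow_mult_distrib) (use c cent in auto)
  finally have m: "?c [^] m = \<one>" using c cc pw by (simp add: int_pow_int)
  have "y \<otimes> (x \<otimes> ?c) = x \<otimes> y" using mult_swap_gcomm[of x y] c by (simp add: m_assoc)
  then have "y [^] int n \<otimes> (x \<otimes> ?c) = x \<otimes> ?c \<otimes> (inv ?c \<otimes> y) [^] int n"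
  proof (intro pow_intertwine)
    assume *: "y \<otimes> (x \<otimes> ?c) = x \<otimes> y"
    show "y \<otimes> (x \<otimes> ?c) = x \<otimes> ?c \<otimes> (inv ?c \<otimes> y)" using c cc * by (simp add: m_assoc)
  qed (use c in auto)
  also have "(inv ?c \<otimes> y) [^] int n = inv ?c [^] int n \<otimes> y [^] int n"
  proof (rule int_pow_mult_distrib)
    have "?c [^] (-1::int) \<otimes> y = y \<otimes> ?c [^] (-1::int)"
      by (rule commute_pow) (use c cc cent in auto)
    then show "inv ?c \<otimes> y = y \<otimes> inv ?c" using cc by (simp add: int_pow_neg)
  qed (use c in auto)
  finally have "x \<otimes> ?c \<otimes> inv ?c [^] int n = x \<otimes> ?c" using c cc pw by (simp add: int_pow_int)
  then have "inv ?c [^] int n = \<one>" using c cc l_cancel_one[of "x \<otimes> ?c" "inv ?c [^] int n"] by simp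
  then have n: "?c [^] n = \<one>" using cc by (simp add: int_pow_int nat_pow_inv)
  have "ord ?c dvd m" "ord ?c dvd n" using m n cc by (simp_all add: pow_eq_id)
  then have "ord ?c = 1" using pw(3) by (metis coprime_common_divisor_nat One_nat_def nat_dvd_1_iff_1)
  then show ?thesis using ord_eq_1[OF cc] by blast
qed

end

section \<open>Quotients by terms of the upper central series\<close>

locale quotient_map = normal N G for N and G (structure)
begin

definition \<pi> where "\<pi> x = N #> x"

sublocale q: group_hom G "G Mod N" \<pi>
  unfolding \<pi>_def
  by (intro group_hom.intro group_hom_axioms.intro factorgroup_is_group r_coset_hom_Mod is_group)

lemma pi_eq_one_iff: "x \<in> carrier G \<Longrightarrow> \<pi> x = \<one>\<^bsub>G Mod N\<^esub> \<longleftrightarrow> x \<in> N"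
  unfolding \<pi>_def using coset_join1 coset_join2 subgroup_axioms subset by (metis one_FactGroup)

lemma pi_surj: "\<pi> ` carrier G = carrier (G Mod N)"
  by (simp add: \<pi>_def carrier_FactGroup)

end

lemma (in group_hom) hom_gcomm:
  "x \<in> carrier G \<Longrightarrow> y \<in> carrier G \<Longrightarrow> h (gcomm G x y) = gcomm H (h x) (h y)"
  by (simp add: gcomm_def)

lemma (in macd) hom_image:
  assumes "group_hom G H h"
  shows "macd H (h A) (h B) (h C) \<alpha> \<beta>"
proof -
  interpret h: group_hom G H h by (rule assms)
  have "h (A \<otimes> C) = h (C \<otimes> A [^] \<alpha>)" "h (C \<otimes> B) = h (B [^] \<beta> \<otimes> C)" "h (A \<otimes> B) = h (B \<otimes> A \<otimes> C)"
    by (simp_all only: AC CB AB)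
  then show ?thesis by unfold_locales (simp_all add: h.hom_int_pow)
qed

text \<open>Descent along the upper central series: modulo Z_i a commutator lying in Z_(i+1) is
  central, so \<open>central_gcomm_coprime\<close> pushes it into Z_i.\<close>

lemma (in group) coprime_commute_of_ucs:
  fixes m n :: nat
  assumes u: "ucs G k = carrier G" and c: "x \<in> carrier G" "y \<in> carrier G"
    and pw: "x [^] m = \<one>" "y [^] n = \<one>" "coprime m n"
  shows "x \<otimes> y = y \<otimes> x"
proof -
  have step: "gcomm G x y \<in> ucs G i" if i: "gcomm G x y \<in> ucs G (Suc i)" for i
  proof -
    let ?Q = "G Mod ucs G i"
    interpret quotient_map "ucs G i" G unfolding quotient_map_def by (rule ucs_normal)
    have "gcomm ?Q (\<pi> x) (\<pi> y) = \<one>\<^bsub>?Q\<^esub>"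
    proof (rule group.central_gcomm_coprime[OF q.H.is_group _ _ _ _ _ pw(3)])
      show "\<pi> x [^]\<^bsub>?Q\<^esub> m = \<one>\<^bsub>?Q\<^esub>" "\<pi> y [^]\<^bsub>?Q\<^esub> n = \<one>\<^bsub>?Q\<^esub>"
        using c pw by (simp_all flip: q.hom_nat_pow)
      fix g assume "g \<in> carrier ?Q"
      then obtain h where h: "h \<in> carrier G" "g = \<pi> h" using pi_surj by blast
      have "gcomm G (gcomm G x y) h \<in> ucs G i" using i h by simp
      then have "gcomm ?Q (\<pi> (gcomm G x y)) g = \<one>\<^bsub>?Q\<^esub>"
        using h c pi_eq_one_iff by (simp flip: q.hom_gcomm)
      then show "g \<otimes>\<^bsub>?Q\<^esub> gcomm ?Q (\<pi> x) (\<pi> y)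
          = gcomm ?Q (\<pi> x) (\<pi> y) \<otimes>\<^bsub>?Q\<^esub> g"
        using h c q.H.gcomm_eq_one_iff by (simp add: q.hom_gcomm)
    qed (use c in auto)
    then show ?thesis using c pi_eq_one_iff by (simp flip: q.hom_gcomm)
  qed
  have "gcomm G x y \<in> ucs G (k - i)" for i
  proof (induction i)
    case 0
    then show ?case using u c by simp
  next
    case (Suc i)
    then show ?case using step[of "k - Suc i"] by (cases "i < k") (simp_all add: Suc_diff_Suc)
  qed
  from this[of k] show ?thesis using c gcomm_eq_one_iff by simp
qed

text \<open>By finiteness the upper central series becomes stationary at some Z_k. The quotient by
  Z_k satisfies the same relations, so if it were nontrivial, \<open>centre_nontrivial\<close> would
  produce an element of Z_(k+1) outside Z_k.\<close>

lemma (in macd) nilpotent: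
  assumes gen: "generate G {A, B} = carrier G" and fin: "finite (carrier G)"
    and four: "4 dvd \<alpha> - 1" "4 dvd \<beta> - 1"
  shows "\<exists>k. ucs G k = carrier G"
proof -
  have "\<exists>k. ucs G (Suc k) = ucs G k"
  proof (rule ccontr)
    assume "\<nexists>k. ucs G (Suc k) = ucs G k"
    then have lt: "ucs G k \<subset> ucs G (Suc k)" for k using ucs_Suc by blast
    have "k \<le> card (ucs G k)" for k
    proof (induction k)
      case (Suc k)
      have "card (ucs G k) < card (ucs G (Suc k))"
        using lt fin ucs_carrier finite_subset by (metis psubset_card_mono)
      then show ?case using Suc by linarith
    qed simp
    moreover have "card (ucs G k) \<le> card (carrier G)" for k
      using fin ucs_carrier card_mono by blast
    ultimately show False using not_less_eq_eq le_trans by blast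
  qed
  then obtain k where k: "ucs G (Suc k) = ucs G k" by blast
  let ?Q = "G Mod ucs G k"
  interpret quotient_map "ucs G k" G unfolding quotient_map_def by (rule ucs_normal)
  interpret Q: macd ?Q "\<pi> A" "\<pi> B" "\<pi> C" \<alpha> \<beta>
    by (rule hom_image) (rule q.group_hom_axioms)
  have "ucs G k = carrier G"
  proof (rule ccontr)
    assume ne: "ucs G k \<noteq> carrier G"
    have "\<exists>z\<in>carrier ?Q. z \<noteq> \<one>\<^bsub>?Q\<^esub> \<and>
      (\<forall>g\<in>carrier ?Q. g \<otimes>\<^bsub>?Q\<^esub> z = z \<otimes>\<^bsub>?Q\<^esub> g)"
    proof -
      have 1: "generate ?Q {\<pi> A, \<pi> B} = carrier ?Q"
        using q.generate_img[of "{A, B}"] gen pi_surj by simp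
      have 2: "finite (carrier ?Q)" using fin pi_surj by (metis finite_imageI)
      have 3: "carrier ?Q \<noteq> {\<one>\<^bsub>?Q\<^esub>}"
      proof
        assume *: "carrier ?Q = {\<one>\<^bsub>?Q\<^esub>}"
        obtain x where x: "x \<in> carrier G" "x \<notin> ucs G k" using ne ucs_carrier by blast
        then have "\<pi> x \<in> carrier ?Q" by auto
        then show False using x pi_eq_one_iff * by blast
      qed
      show ?thesis by (rule Q.centre_nontrivial[OF 1 2 four 3])
    qed
    then obtain z where z: "z \<in> carrier ?Q" "z \<noteq> \<one>\<^bsub>?Q\<^esub>"
      "\<forall>g\<in>carrier ?Q. g \<otimes>\<^bsub>?Q\<^esub> z = z \<otimes>\<^bsub>?Q\<^esub> g"
      by (elim bexE conjE)
    obtain x where x: "x \<in> carrier G" "z = \<pi> x" using z pi_surj by blast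
    have "gcomm G x g \<in> ucs G k" if g: "g \<in> carrier G" for g
    proof -
      have "gcomm ?Q (\<pi> x) (\<pi> g) = \<one>\<^bsub>?Q\<^esub>"
        using bspec[OF z(3), of "\<pi> g"] x g q.H.gcomm_eq_one_iff by simp
      then show ?thesis using x g pi_eq_one_iff by (simp flip: q.hom_gcomm)
    qed
    then have "x \<in> ucs G (Suc k)" using x by simp
    then have "x \<in> ucs G k" by (simp only: k)
    then show False using z x pi_eq_one_iff by simp
  qed
  then show ?thesis by blast
qed

section \<open>The 2-part: upper bounds\<close>

declare ucs.simps(2) [simp del] lcs.simps(2) [simp del]

text \<open>With y = \<beta> - 1 the quantity is \<beta> (1 + (y - 1) geo \<beta> n). As n is 1 + y
  modulo 4P^2, the part 1 + (y - 1) n vanishes modulo 4P^2. What survives is -y (n choose 2), where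
  y = 2Pv and (n choose 2) is P times an odd number.\<close>

lemma key_exponent_valuation:
  fixes P v \<beta> :: int and n :: nat
  assumes P: "even P" and v: "odd v" and b: "\<beta> = 1 + 2 * P * v" and n: "4 * P^2 dvd \<beta> - int n"
  shows "\<exists>r. odd r \<and> \<beta> ^ (n + 1) - \<beta> * geo \<beta> n = 2 * P^2 * r"
proof -
  let ?y = "2 * P * v"
  obtain r where r: "geo (1 + ?y) n = int n + int (n choose 2) * ?y + int (n choose 3) * ?y^2 + ?y^3 * r"
    using geo_expand by blast
  obtain l where l: "int n = 1 + ?y + 4 * P^2 * l"
  proof -
    obtain t where "\<beta> = int n + 4 * P^2 * t" using n dvd_diff_imp by blast
    then have "int n = 1 + ?y + 4 * P^2 * (- t)" by (simp add: b)
    then show ?thesis using that by blast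
  qed
  have C2: "int (n choose 2) = int n * P * (v + 2 * P * l)"
  proof -
    have "int n - 1 = 2 * P * (v + 2 * P * l)" by (simp add: l algebra_simps power2_eq_square)
    then have "2 * int (n choose 2) = 2 * (int n * P * (v + 2 * P * l))"
      using two_choose_two[of n] by (simp add: mult.assoc mult.left_commute)
    then show ?thesis by simp
  qed
  have "odd (int n)" by (simp add: l)
  then have "odd (v * int n * (v + 2 * P * l))" using v by simp
  define Z where "Z = (?y - 1) * (int (n choose 3) * v^2 + 2 * P * v^3 * r) + 2 * P * v * l - l + v * v
      + P * v * v * int n * (v + 2 * P * l)"
  have "\<beta> ^ (n + 1) - \<beta> * geo \<beta> n = \<beta> * (1 + (\<beta> - 1) * geo \<beta> n - geo \<beta> n)"
    unfolding geo_mult_eq by (simp add: algebra_simps)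
  also have "1 + (\<beta> - 1) * geo \<beta> n - geo \<beta> n = 1 + (?y - 1) * geo (1 + ?y) n"
    by (simp add: b algebra_simps)
  also have "\<dots> = 1 + (?y - 1) * int n + (?y - 1) * (?y * (int n * P * (v + 2 * P * l)))
       + 4 * P^2 * ((?y - 1) * (int (n choose 3) * v^2 + 2 * P * v^3 * r))"
    unfolding r C2 by (simp add: poly_simps)
  also have "1 + (?y - 1) * int n = 4 * P^2 * (v * v + 2 * P * v * l - l)"
    unfolding l by (simp add: algebra_simps power2_eq_square)
  also have "(?y - 1) * (?y * (int n * P * (v + 2 * P * l)))
      = 4 * P^2 * (P * v * v * int n * (v + 2 * P * l)) - 2 * P^2 * (v * int n * (v + 2 * P * l))"
    by (simp add: algebra_simps power2_eq_square)
  finally have "\<beta> ^ (n + 1) - \<beta> * geo \<beta> n = 2 * P^2 * (\<beta> * (2 * Z - v * int n * (v + 2 * P * l)))"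
    unfolding Z_def by (simp add: algebra_simps)
  moreover have "odd (\<beta> * (2 * Z - v * int n * (v + 2 * P * l)))"
    using \<open>odd (v * int n * (v + 2 * P * l))\<close> by (simp add: b)
  ultimately show ?thesis by blast
qed

lemma odd_inverse_mod_two_power:
  assumes "odd (r::int)"
  shows "\<exists>s. odd s \<and> 2 ^ E dvd r * s - 1"
proof -
  \<comment> \<open>The additional factor 2 in the modulus forces s to be odd even when E =
    0.\<close>
  have "coprime r (2 ^ Suc E)" using assms by simp
  then obtain s where "[r * s = 1] (mod 2 ^ Suc E)" using cong_solve_coprime_int by blast
  then have d: "2 * 2 ^ E dvd r * s - 1" by (simp add: cong_iff_dvd_diff)
  then have "2 dvd r * s - 1" by (rule dvd_trans[rotated]) simp
  then have "odd s" by auto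
  moreover have "2 ^ E dvd r * s - 1" using d dvd_mult_right by blast
  ultimately show ?thesis by blast
qed

text \<open>The elements commuting with x modulo the normal subgroup Z_i form a subgroup, so it is
  enough to test generators.\<close>

lemma (in group) ucs_SucI:
  assumes S: "S \<subseteq> carrier G" and gen: "generate G S = carrier G" and x: "x \<in> carrier G"
    and c: "\<And>s. s \<in> S \<Longrightarrow> gcomm G x s \<in> ucs G i"
  shows "x \<in> ucs G (Suc i)"
proof -
  interpret N: normal "ucs G i" G by (rule ucs_normal)
  have "gcomm G x g \<in> ucs G i" if "g \<in> generate G S" for g
    using that
  proof (induction rule: generate.induct)
    case one
    show ?case using x by (simp add: gcomm_def)
  next
    case (incl h)
    then show ?case by (rule c)
  next
    case (inv h)
    then have h: "h \<in> carrier G" using S by blast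
    have "gcomm G x (inv h) = h \<otimes> inv (gcomm G x h) \<otimes> inv h"
      using x h by (simp add: gcomm_def inv_mult_group m_assoc)
    then show ?case using c[OF inv] h N.inv_op_closed2 by simp
  next
    case (eng g h)
    then have gh: "g \<in> carrier G" "h \<in> carrier G" using S generate_in_carrier by blast+
    have "gcomm G x (g \<otimes> h) = gcomm G x h \<otimes> (inv h \<otimes> gcomm G x g \<otimes> h)"
      using x gh by (simp add: gcomm_def inv_mult_group m_assoc)
    then show ?case using eng gh N.inv_op_closed1 by simp
  qed
  then show ?thesis using gen x by (auto simp: ucs.simps(2))
qed

text \<open>r is invertible modulo the order of x, a power of 2; in this way the odd cofactors f and
  e' of \<open>key_relation\<close> are removed from exponents.\<close>

lemma (in group) pow_odd_root:
  assumes x: "x \<in> carrier G" "x [^] (2 ^ E :: nat) = \<one>" and r: "odd (r::int)"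
  shows "\<exists>s::int. odd s \<and> x [^] (a::int) = (x [^] (a * r)) [^] s"
proof -
  obtain s where s: "odd s" "2 ^ E dvd r * s - 1" using odd_inverse_mod_two_power r by blast
  have "ord x dvd 2 ^ E" using x by (simp add: pow_eq_id)
  then have "int (ord x) dvd 2 ^ E" by (metis of_nat_dvd_iff of_nat_numeral of_nat_power)
  then have "int (ord x) dvd r * s - 1" using s(2) by (rule dvd_trans)
  then have "int (ord x) dvd a * (r * s - 1)" by (rule dvd_mult)
  moreover have "a * (r * s - 1) = a * r * s - a" by (simp add: algebra_simps)
  ultimately have "x [^] a = x [^] (a * r * s)" using x by (simp only: int_pow_eq)
  then show ?thesis using s x by (intro exI[of _ s]) (simp add: int_pow_pow)
qed

lemma (in group) involution_odd_pow:
  assumes "z \<in> carrier G" "z \<otimes> z = \<one>" "odd (r::int)" shows "z [^] r = z"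
proof -
  have "z [^] (2::nat) = \<one>" using assms by (simp add: numeral_2_eq_2)
  then have "int (ord z) dvd int 2" using assms(1) by (simp only: pow_eq_id of_nat_dvd_iff)
  moreover have "int 2 dvd 1 - r" using assms(3) by simp
  ultimately have "int (ord z) dvd 1 - r" by (rule dvd_trans)
  then show ?thesis using assms int_pow_eq[of z r 1] by simp
qed

text \<open>E merely records that A and B are 2-elements; the sharp orders are conclusions. The odd
  cofactors u, v, w turn statements on valuations into polynomial identities.\<close>

locale macd2 = macd +
  fixes m E :: nat and u v w :: int
  assumes m: "m > 1" and u: "odd u" and v: "odd v" and w: "odd w"
    and al: "\<alpha> = 1 + 2 ^ m * u" and be: "\<beta> = 1 + 2 ^ m * v" and uv: "\<alpha> - \<beta> = 2 ^ (2 * m - 1) * w"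
    and A_2: "A [^] (2 ^ E :: nat) = \<one>" and B_2: "B [^] (2 ^ E :: nat) = \<one>"
begin

lemma swap2: "macd2 G B A (inv C) \<beta> \<alpha> m E v u (- w)"
  using swap m u v w al be uv A_2 B_2 unfolding macd2_def macd2_axioms_def by simp

text \<open>Half of 2^m, so that the exponents 2m-1, 3m-2 and 3m-1 become monomials in P and no
  truncated subtraction enters the algebra.\<close>

definition P :: int where "P = 2 ^ (m - 1)"

lemma pows: "(2::int) ^ m = 2 * P" "(2::int) ^ (2 * m - 1) = 2 * P^2" "(2::int) ^ (2 * m) = 4 * P^2"
  "(2::int) ^ (3 * m - 1) = 4 * P^3" "(2::int) ^ (3 * m - 2) = 2 * P^3"
proof -
  obtain k where k: "m = Suc k" using m by (cases m) auto
  have Pk: "P = 2 ^ k" unfolding P_def by (simp add: k)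
  show "(2::int) ^ m = 2 * P" "(2::int) ^ (2 * m - 1) = 2 * P^2" "(2::int) ^ (2 * m) = 4 * P^2"
    "(2::int) ^ (3 * m - 1) = 4 * P^3" "(2::int) ^ (3 * m - 2) = 2 * P^3"
    unfolding Pk by (simp_all add: k power_add power_mult[symmetric] mult.commute numeral_eq_Suc)
qed

lemma pow_nat_eq: "x [^] (2 ^ (3 * m - 1) :: nat) = x [^] (4 * P^3)"
  unfolding pows(4)[symmetric] by (metis int_pow_int of_nat_numeral of_nat_power)

lemma P_even: "even P" using m by (simp add: P_def)

lemma four_dvd: "4 dvd \<alpha> - 1" "4 dvd \<beta> - 1"
proof -
  have "(2::int)^2 dvd 2 ^ m" using m by (intro le_imp_power_dvd) simp
  then show "4 dvd \<alpha> - 1" "4 dvd \<beta> - 1" by (simp_all add: al be)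
qed

lemma ords: "ord A > 0" "ord B > 0" "int (ord A) dvd 2 ^ E" "int (ord B) dvd 2 ^ E"
proof -
  have d: "ord A dvd 2 ^ E" "ord B dvd 2 ^ E" using A_2 B_2 by (simp_all add: pow_eq_id)
  then show "ord A > 0" "ord B > 0" by (auto intro: Nat.gr0I)
  show "int (ord A) dvd 2 ^ E" "int (ord B) dvd 2 ^ E"
    using d by (metis of_nat_dvd_iff of_nat_numeral of_nat_power)+
qed

lemma C_2: "C [^] (2 ^ E :: nat) = \<one>"
  using dvd_trans[OF ord_C_dvd_ord_B] ords B_2 by (simp add: pow_eq_id)

text \<open>The case k = 1 of \<open>key\<close> after cancelling a power of C. The valuations of F
  and e come from \<open>key_exponent_valuation\<close>, that of d from \<alpha> - \<beta>.\<close>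

lemma key_relation:
  obtains F :: int and d e :: nat and f d' e' :: int
  where "B [^] F = C [^] d \<otimes> A [^] e" "F = 2 * P^2 * f" "int d = 2 * P^2 * d'" "int e = 2 * P^2 * e'"
    "odd f" "odd d'" "odd e'" "A \<otimes> B [^] ((\<beta> - 1) * F) = B [^] ((\<beta> - 1) * F) \<otimes> A"
    "C \<otimes> B [^] ((\<beta> - 1) * F) = B [^] ((\<beta> - 1) * F) \<otimes> C"
    "\<exists>i. B [^] ((\<beta> - 1) * F) = A [^] (i::int)"
proof -
  \<comment> \<open>N is a multiple of both orders and of 4P^2, so reduction modulo N changes
    neither the powers of A and B nor the valuations in question.\<close>
  define N where "N = (2::int) ^ (E + 2 * m)"
  have NE: "2 ^ E dvd N" and NP: "4 * P^2 dvd N" by (simp_all add: N_def power_add pows)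
  have N0: "N > 0" by (simp add: N_def)
  have oN: "int (ord A) dvd N" "int (ord B) dvd N" using ords NE dvd_trans by blast+
  \<comment> \<open>The extra N makes n' at least n, so that d = n' - n is a natural number; it is
    still congruent to \<alpha> - \<beta>.\<close>
  define n n' where "n = nat (\<beta> mod N)" and "n' = nat (\<alpha> mod N) + nat N"
  have nm: "N dvd \<beta> - int n" using N0 by (simp add: n_def mod_eq_dvd_iff[symmetric])
  have nm': "N dvd \<alpha> - int n'" using N0 by (simp add: n'_def mod_eq_dvd_iff[symmetric])
  have "int n < N" "int n' \<ge> N" using N0 by (simp_all add: n_def n'_def)
  then have "n \<le> n'" by linarith
  then obtain d where d: "n' = n + d" using le_Suc_ex by blast
  have Bn: "B [^] n = B [^] (\<beta> ^ 1)" and An: "A [^] n' = A [^] (\<alpha> ^ 1)"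
    using dvd_trans[OF oN(2) nm] dvd_trans[OF oN(1) nm'] by (simp_all add: int_pow_eq flip: int_pow_int)
  define F where "F = \<beta> ^ (n + 1) - \<beta> * geo \<beta> n"
  define e0 where "e0 = \<alpha> * geo \<alpha> n' - \<alpha> ^ (n' + 1)"
  have k: "B [^] F \<otimes> C [^] (n + 1) = C [^] (n' + 1) \<otimes> A [^] e0"
    unfolding F_def e0_def by (rule key[OF Bn An])
  obtain f where f: "odd f" "F = 2 * P^2 * f"
    using key_exponent_valuation[OF P_even v _ dvd_trans[OF NP nm]] be pows(1) unfolding F_def by auto
  obtain g where g: "odd g" "\<alpha> ^ (n' + 1) - \<alpha> * geo \<alpha> n' = 2 * P^2 * g"
    using key_exponent_valuation[OF P_even u _ dvd_trans[OF NP nm']] al pows(1) by auto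
  have e0: "e0 = 2 * P^2 * (- g)" using g(2) by (simp add: e0_def)
  \<comment> \<open>Moving a power of A to the left of C^(n+1) divides its exponent by
    \<alpha>^(n+1), hence the inverse a of that power modulo N.\<close>
  have "odd (\<alpha> ^ (n + 1))" using al m by simp
  then obtain a where a: "odd a" "2 ^ (E + 2 * m) dvd \<alpha> ^ (n + 1) * a - 1"
    using odd_inverse_mod_two_power by blast
  define e where "e = nat (e0 * a mod N)"
  have em: "N dvd e0 * a - int e" using N0 by (simp add: e_def mod_eq_dvd_iff[symmetric])
  have "N dvd e0 * (\<alpha> ^ (n + 1) * a - 1) - \<alpha> ^ (n + 1) * (e0 * a - int e)"
    by (rule dvd_diff[OF dvd_mult dvd_mult]) (use a(2) em in \<open>simp_all only: N_def\<close>)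
  then have "N dvd int e * \<alpha> ^ (n + 1) - e0" by (simp add: algebra_simps)
  then have "int (ord A) dvd int e * \<alpha> ^ (n + 1) - e0" using oN dvd_trans by blast
  then have "A [^] e0 = A [^] (int e * \<alpha> ^ (n + 1))" by (simp add: int_pow_eq)
  then have "C [^] (n + 1) \<otimes> A [^] e0 = A [^] e \<otimes> C [^] (n + 1)"
    by (simp only: A_pow_C[symmetric] int_pow_int)
  moreover have "C [^] (n' + 1) = C [^] d \<otimes> C [^] (n + 1)" by (simp only: nat_pow_mult C_closed d ac_simps)
  ultimately have "B [^] F \<otimes> C [^] (n + 1) = C [^] d \<otimes> A [^] e \<otimes> C [^] (n + 1)"
    using k m_assoc by (metis C_closed A_closed nat_pow_closed int_pow_closed)
  then have 1: "B [^] F = C [^] d \<otimes> A [^] e" by (simp only: right_cancel nat_pow_closed int_pow_closed m_closed A_closed B_closed C_closed)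
  have "4 * P^2 dvd (\<alpha> - \<beta> - int d)"
  proof -
    have "N dvd (\<alpha> - int n') - (\<beta> - int n)" using nm nm' by (rule dvd_diff[rotated])
    also have "(\<alpha> - int n') - (\<beta> - int n) = \<alpha> - \<beta> - int d" by (simp add: d)
    finally show ?thesis using NP dvd_trans by blast
  qed
  then obtain t where "\<alpha> - \<beta> = int d + 4 * P^2 * t" using dvd_diff_imp by blast
  then have 2: "int d = 2 * P^2 * (w - 2 * t)" using uv pows by (simp add: algebra_simps)
  obtain t' where "e0 * a = int e + 4 * P^2 * t'" using dvd_trans[OF NP em] dvd_diff_imp by blast
  then have 3: "int e = 2 * P^2 * (- g * a - 2 * t')" by (simp add: e0 algebra_simps)
  show ?thesis
    by (rule that[OF 1 f(2) 2 3 f(1)])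
      (use w g a key_central[OF k] in simp_all)
qed

text \<open>The last two claims presuppose the bound for o(B), which is the first claim for the
  swapped group. The three are proved together because all rest on the relation
  \<open>Ce\<close>.\<close>

lemma A_order_and_C_pow:
  shows "A [^] (2 ^ (3 * m - 1) :: nat) = \<one>"
    and "B [^] (2 ^ (3 * m - 1) :: nat) = \<one> \<Longrightarrow> C [^] (2 * P^2) = A [^] (2 * P^3)"
    and "B [^] (2 ^ (3 * m - 1) :: nat) = \<one> \<Longrightarrow> \<exists>t. B [^] (2 * P^2) = A [^] (2 * P^2 * t)"
proof -
  obtain F :: int and d e :: nat and f d' e' :: int
    where k: "B [^] F = C [^] d \<otimes> A [^] e" and F: "F = 2 * P^2 * f" and d: "int d = 2 * P^2 * d'"
      and e: "int e = 2 * P^2 * e'" and odd: "odd f" "odd d'" "odd e'"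
      and cen: "A \<otimes> B [^] ((\<beta> - 1) * F) = B [^] ((\<beta> - 1) * F) \<otimes> A"
        "C \<otimes> B [^] ((\<beta> - 1) * F) = B [^] ((\<beta> - 1) * F) \<otimes> C"
        "\<exists>i. B [^] ((\<beta> - 1) * F) = A [^] (i::int)"
    by (rule key_relation)
  have bF: "(\<beta> - 1) * F = 4 * P^3 * (v * f)"
    by (simp add: F be pows poly_simps)
  have "odd (v * f)" using v odd by simp
  \<comment> \<open>B^(4P^3) is a power of the element that \<open>key_relation\<close> shows to
    commute with C and to lie in <A>; it therefore has both properties itself.\<close>
  then obtain s :: int where s: "B [^] (4 * P^3) = (B [^] ((\<beta> - 1) * F)) [^] s"
    unfolding bF using pow_odd_root[OF B_closed B_2, of "v * f" "4 * P^3"] by blast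
  obtain i where i: "B [^] ((\<beta> - 1) * F) = A [^] (i::int)" using cen by blast
  define z where "z = B [^] (4 * P^3)"
  have zA: "z = A [^] (i * s)" by (simp add: z_def s i int_pow_pow)
  have zC: "z \<otimes> C = C \<otimes> z" unfolding z_def s by (rule commute_pow) (use cen in simp_all)
  obtain g where g: "geo \<beta> d = 2 * P^2 * g"
  proof -
    have "(2::nat) ^ (2 * m - 1) dvd d"
    proof -
      have "int (2 ^ (2 * m - 1)) dvd int d" using d pows by simp
      then show ?thesis by (simp only: of_nat_dvd_iff)
    qed
    then have "2 ^ (2 * m - 1) dvd geo \<beta> d" using two_power_dvd_geo_iff four_dvd by blast
    then show ?thesis using that pows by auto
  qed
  have bd: "\<beta> ^ d - 1 = 4 * P^3 * (v * g)"
    unfolding geo_mult_eq[symmetric] g by (simp add: be pows poly_simps)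
  let ?h = "\<alpha> * geo \<alpha> e"
  \<comment> \<open>B commutes with B^F = C^d A^e. Moving B through C^d A^e from right to left and
    cancelling leaves a relation between C^e and powers of A.\<close>
  have "B \<otimes> (B [^] (\<beta> ^ d - 1) \<otimes> C [^] d \<otimes> (C [^] e \<otimes> A [^] ?h)) = C [^] d \<otimes> B \<otimes> (C [^] e \<otimes> A [^] ?h)"
    by (simp add: C_pow_conj_B m_assoc)
  also have "\<dots> = C [^] d \<otimes> A [^] e \<otimes> B" by (simp add: A_pow_B m_assoc)
  also have "\<dots> = B \<otimes> (C [^] d \<otimes> A [^] e)"
    unfolding k[symmetric] by (rule commute_pow) simp_all
  finally have "B [^] (\<beta> ^ d - 1) \<otimes> C [^] d \<otimes> (C [^] e \<otimes> A [^] ?h) = C [^] d \<otimes> A [^] e" by simp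
  moreover have zg: "B [^] (\<beta> ^ d - 1) = z [^] (v * g)" by (simp add: bd z_def int_pow_pow)
  moreover have "z [^] (v * g) \<otimes> C [^] d = C [^] d \<otimes> z [^] (v * g)"
  proof -
    have zc: "z \<in> carrier G" by (simp add: z_def)
    then have "z [^] (v * g) \<otimes> C = C \<otimes> z [^] (v * g)" using zC by (intro commute_pow) auto
    then have "C [^] int d \<otimes> z [^] (v * g) = z [^] (v * g) \<otimes> C [^] int d"
      using zc by (intro commute_pow) auto
    then show ?thesis by (simp add: int_pow_int)
  qed
  ultimately have "C [^] d \<otimes> (z [^] (v * g) \<otimes> (C [^] e \<otimes> A [^] ?h)) = C [^] d \<otimes> A [^] e"
    by (simp add: m_assoc[symmetric] zA)
  then have "z [^] (v * g) \<otimes> (C [^] e \<otimes> A [^] ?h) = A [^] int e" by (simp add: zA int_pow_int)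
  then have "z [^] (v * g) \<otimes> C [^] e \<otimes> A [^] ?h = A [^] (int e - ?h) \<otimes> A [^] ?h"
    by (simp add: zA m_assoc int_pow_mult[symmetric])
  then have Ce: "z [^] (v * g) \<otimes> C [^] e = A [^] (int e - ?h)" by (simp add: zA)
  then have "C [^] e = inv (z [^] (v * g)) \<otimes> A [^] (int e - ?h)"
    by (subst inv_solve_left) (simp_all add: zA)
  then have "C [^] e = A [^] (- (i * s * (v * g))) \<otimes> A [^] (int e - ?h)"
    by (simp add: zA int_pow_neg int_pow_pow)
  then have "C [^] e = A [^] (- (i * s * (v * g)) + (int e - ?h))" by (simp only: int_pow_mult A_closed)
  then have "A \<otimes> C [^] e = C [^] e \<otimes> A" using commute_pow[of A A] by simp
  moreover have "A \<otimes> C [^] e = C [^] e \<otimes> A [^] (\<alpha> ^ e)" using A_pow_C[of 1 e] by simp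
  ultimately have "A [^] (1::int) = A [^] (\<alpha> ^ e)" by simp
  then have "int (ord A) dvd (\<alpha> - 1) * geo \<alpha> e"
    by (simp only: int_pow_eq A_closed geo_mult_eq)
  then have oA: "int (ord A) dvd 2 ^ m * (u * geo \<alpha> e)" by (simp add: al mult.assoc)
  obtain q where q: "ord A = 2 ^ q"
    using A_2 divides_primepow_nat[of 2 "ord A" E] by (auto simp: pow_eq_id)
  \<comment> \<open>The valuation of \<alpha>^e - 1 is m, from \<alpha> - 1, plus exactly 2m-1, from
    e.\<close>
  have "q \<le> 3 * m - 1"
  proof (rule ccontr)
    assume "\<not> q \<le> 3 * m - 1"
    then have "(2::int) ^ (m + 2 * m) dvd 2 ^ q" by (intro le_imp_power_dvd) simp
    moreover have "(2::int) ^ q dvd 2 ^ m * (u * geo \<alpha> e)" using oA q by simp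
    ultimately have "(2::int) ^ (m + 2 * m) dvd 2 ^ m * (u * geo \<alpha> e)" by (rule dvd_trans)
    then have "(2::int) ^ m * 2 ^ (2 * m) dvd 2 ^ m * (u * geo \<alpha> e)" by (simp only: power_add)
    then have "2 ^ (2 * m) dvd u * geo \<alpha> e" by simp
    then have "2 ^ (2 * m) dvd geo \<alpha> e" using u by (simp add: coprime_dvd_mult_right_iff)
    then have "2 ^ (2 * m) dvd e" using two_power_dvd_geo_iff four_dvd by blast
    then have "int (2 ^ (2 * m)) dvd int e" by (simp only: of_nat_dvd_iff)
    then have "2 * P^2 * 2 dvd 2 * P^2 * e'" using e pows by simp
    moreover have "P \<noteq> 0" by (simp add: P_def)
    ultimately have "4 dvd 2 * e'" by simp
    then have "2 dvd e'" by presburger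
    then show False using odd by simp
  qed
  then show A1: "A [^] (2 ^ (3 * m - 1) :: nat) = \<one>" by (simp add: pow_eq_id q le_imp_power_dvd)
  have A4: "A [^] (4 * P^3) = \<one>" using A1 by (simp only: pow_nat_eq)
  assume B1: "B [^] (2 ^ (3 * m - 1) :: nat) = \<one>"
  then have "z = \<one>" by (simp only: z_def pow_nat_eq)
  then have Ce': "C [^] e = A [^] (int e - ?h)" using Ce by simp
  \<comment> \<open>In powers of x = 2Pu: the linear term is -P u e (e + 1), an odd multiple of
    2P^3; the quadratic one carries 4P^2 and (e choose 2) + (e choose 3), which P divides; the rest
    is a multiple of 4P^3.\<close>
  have "\<exists>c. int e - ?h = 2 * P^3 + 4 * P^3 * c"
  proof -
    let ?x = "2 * P * u"
    obtain r where r: "geo (1 + ?x) e = int e + int (e choose 2) * ?x + int (e choose 3) * ?x^2 + ?x^3 * r"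
      using geo_expand by blast
    have c2: "2 * (int e + int (e choose 2)) = int e * (int e + 1)"
      using two_choose_two[of e] by (simp add: algebra_simps)
    have "6 * (int (e choose 2) + int (e choose 3)) = int e * ((int e + 1) * (int e - 1))"
      using two_choose_two[of e] six_choose_three[of e] by (simp add: algebra_simps)
    also have "\<dots> = 2 * (P * (P * e' * ((int e + 1) * (int e - 1))))"
      by (simp add: e power2_eq_square)
    finally have "3 * (int (e choose 2) + int (e choose 3)) = P * (P * e' * ((int e + 1) * (int e - 1)))"
      by simp
    then have "P dvd 3 * (int (e choose 2) + int (e choose 3))" by simp
    moreover have "coprime P 3" unfolding P_def coprime_power_left_iff by simp
    ultimately have "P dvd int (e choose 2) + int (e choose 3)"
      by (simp only: coprime_dvd_mult_right_iff)
    then obtain l where l: "int (e choose 2) + int (e choose 3) = P * l" by blast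
    have "odd (- u * e' * (int e + 1))" using u odd e by simp
    then obtain o1 where o1: "- u * e' * (int e + 1) = 2 * o1 + 1" by (elim oddE)
    have "int e - ?h = - (P * u * (2 * (int e + int (e choose 2)))) - 4 * P^2 * u^2 * (int (e choose 2) + int (e choose 3))
        - 4 * P^3 * (2 * u^3 * (int (e choose 3) + (1 + ?x) * r))"
      unfolding al pows r by (simp add: poly_simps)
    also have "P * u * (2 * (int e + int (e choose 2))) = - (2 * P^3 * (- u * e' * (int e + 1)))"
      unfolding c2 by (simp add: e poly_simps)
    finally have "int e - ?h = 2 * P^3 + 4 * P^3 * (o1 - u^2 * l - 2 * u^3 * (int (e choose 3) + (1 + ?x) * r))"
      unfolding o1 l by (simp add: poly_simps)
    then show ?thesis by blast
  qed
  then obtain c where "int e - ?h = 2 * P^3 + 4 * P^3 * c" by blast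
  then have CeW: "C [^] e = A [^] (2 * P^3)"
    using Ce' A4 by (simp add: int_pow_mult flip: int_pow_pow)
  define W where "W = A [^] (2 * P^3)"
  have W: "W \<in> carrier G" "W \<otimes> W = \<one>" using A4 by (simp_all add: W_def int_pow_mult[symmetric])
  obtain s' :: int where s': "odd s'" "C [^] (2 * P^2) = (C [^] (2 * P^2 * e')) [^] s'"
    using pow_odd_root[OF C_closed C_2 odd(3)] by blast
  have "C [^] (2 * P^2) = W [^] s'" using s' CeW unfolding W_def e[symmetric] by (simp add: int_pow_int)
  also have "\<dots> = W" using involution_odd_pow W s' by blast
  finally show CW: "C [^] (2 * P^2) = A [^] (2 * P^3)" by (simp add: W_def)
  have "C [^] d = C [^] (2 * P^2 * d')" unfolding d[symmetric] by (simp add: int_pow_int)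
  also have "\<dots> = W [^] d'" by (simp add: CW W_def flip: int_pow_pow)
  also have "\<dots> = W" using involution_odd_pow W odd by blast
  finally have "B [^] (2 * P^2 * f) = W \<otimes> A [^] int e" using k by (simp add: F int_pow_int)
  also have "\<dots> = A [^] (2 * P^2 * (P + e'))"
    unfolding W_def e by (simp add: int_pow_mult[symmetric] poly_simps)
  finally have Bf: "B [^] (2 * P^2 * f) = A [^] (2 * P^2 * (P + e'))" .
  obtain t :: int where "B [^] (2 * P^2) = (B [^] (2 * P^2 * f)) [^] t"
    using pow_odd_root[OF B_closed B_2 odd(1)] by blast
  then have "B [^] (2 * P^2) = A [^] (2 * P^2 * ((P + e') * t))" unfolding Bf by (simp add: int_pow_pow mult.assoc)
  then show "\<exists>t. B [^] (2 * P^2) = A [^] (2 * P^2 * t)" by blast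
qed

lemma structure_relations:
  shows "A [^] (4 * P^3) = \<one>" "B [^] (4 * P^3) = \<one>"
    "C [^] (2 * P^2) = A [^] (2 * P^3)" "\<exists>t. B [^] (2 * P^2) = A [^] (2 * P^2 * t)"
    "\<exists>t. A [^] (2 * P^2) = B [^] (2 * P^2 * t)"
proof -
  have A: "A [^] (2 ^ (3 * m - 1) :: nat) = \<one>" by (rule A_order_and_C_pow)
  have B: "B [^] (2 ^ (3 * m - 1) :: nat) = \<one>" by (rule macd2.A_order_and_C_pow(1)[OF swap2])
  show "A [^] (4 * P^3) = \<one>" "B [^] (4 * P^3) = \<one>"
    using A B by (simp_all only: pow_nat_eq)
  show "C [^] (2 * P^2) = A [^] (2 * P^3)" "\<exists>t. B [^] (2 * P^2) = A [^] (2 * P^2 * t)"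
    using A_order_and_C_pow B by blast+
  show "\<exists>t. A [^] (2 * P^2) = B [^] (2 * P^2 * t)"
    by (rule macd2.A_order_and_C_pow(3)[OF swap2 A])
qed


text \<open>Full blocks of 2P^2 in the exponents of B and C turn into powers of A, leaving 2m-1,
  2m-1 and 3m-1 binary digits for the exponents of B, C and A.\<close>

lemma card_generate_le: "card (generate G {A, B}) \<le> 2 ^ (7 * m - 3)"
proof -
  define M R where "M = nat (2 * P^2)" and "R = nat (4 * P^3)"
  have P0: "P > 0" by (simp add: P_def)
  have M: "int M = 2 * P^2" and R: "int R = 4 * P^3" using P0 by (simp_all add: M_def R_def)
  obtain t where t: "B [^] (2 * P^2) = A [^] (2 * P^2 * t)" using structure_relations by blast
  let ?f = "\<lambda>(j, k, i). B [^] (j::nat) \<otimes> (C [^] (k::nat) \<otimes> A [^] (i::nat))"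
  have "generate G {A, B} \<subseteq> ?f ` ({..<M} \<times> {..<M} \<times> {..<R})"
  proof
    fix g assume "g \<in> generate G {A, B}"
    then obtain j k i where g: "g = B [^] (j::nat) \<otimes> (C [^] (k::nat) \<otimes> A [^] (i::nat))"
      using normal_form ords by blast
    have Bj: "B [^] j = B [^] (j mod M) \<otimes> A [^] (2 * P^2 * t * int (j div M))"
    proof -
      have "int j = int (j mod M) + 2 * P^2 * int (j div M)" unfolding M[symmetric]
        by (metis mod_mult_div_eq of_nat_add of_nat_mult)
      then have "B [^] int j = B [^] (int (j mod M)) \<otimes> (B [^] (2 * P^2)) [^] int (j div M)"
        by (simp only: int_pow_mult int_pow_pow B_closed)
      then show ?thesis unfolding t int_pow_int by (simp only: int_pow_pow A_closed flip: int_pow_int)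
    qed
    have Ck: "C [^] k = C [^] (k mod M) \<otimes> A [^] (2 * P^3 * int (k div M))"
    proof -
      have "int k = int (k mod M) + 2 * P^2 * int (k div M)" unfolding M[symmetric]
        by (metis mod_mult_div_eq of_nat_add of_nat_mult)
      then have "C [^] int k = C [^] (int (k mod M)) \<otimes> (C [^] (2 * P^2)) [^] int (k div M)"
        by (simp only: int_pow_mult int_pow_pow C_closed)
      then show ?thesis unfolding structure_relations(3) int_pow_int by (simp only: int_pow_pow A_closed flip: int_pow_int)
    qed
    define e where "e = 2 * P^2 * t * int (j div M) * \<alpha> ^ (k mod M) + (2 * P^3 * int (k div M) + int i)"
    have "g = B [^] (j mod M) \<otimes> ((A [^] (2 * P^2 * t * int (j div M)) \<otimes> C [^] (k mod M))
        \<otimes> (A [^] (2 * P^3 * int (k div M)) \<otimes> A [^] int i))"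
      unfolding g Bj Ck by (simp add: m_assoc int_pow_int)
    also have "\<dots> = B [^] (j mod M) \<otimes> (C [^] (k mod M) \<otimes> A [^] e)"
      unfolding A_pow_C e_def by (simp add: m_assoc int_pow_mult)
    also have "A [^] e = A [^] nat (e mod int R)"
    proof -
      have "int (ord A) dvd int R" unfolding R using structure_relations(1) by (simp only: int_pow_eq_id A_closed)
      then have "int (ord A) dvd e mod int R - e"
        by (meson dvd_trans mod_eq_dvd_iff mod_mod_trivial)
      then have "A [^] e = A [^] (e mod int R)" by (simp only: int_pow_eq A_closed)
      moreover have "e mod int R = int (nat (e mod int R))" using P0 R by simp
      ultimately show ?thesis by (metis int_pow_int)
    qed
    finally have "g = ?f (j mod M, k mod M, nat (e mod int R))" by simp
    moreover have "M > 0" "R > 0" using P0 by (simp_all add: M_def R_def)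
    then have "(j mod M, k mod M, nat (e mod int R)) \<in> {..<M} \<times> {..<M} \<times> {..<R}"
      by (simp add: nat_less_iff)
    ultimately show "g \<in> ?f ` ({..<M} \<times> {..<M} \<times> {..<R})" by blast
  qed
  then have "card (generate G {A, B}) \<le> card ({..<M} \<times> {..<M} \<times> {..<R})"
    by (rule surj_card_le[rotated]) simp
  also have "\<dots> = M * (M * R)" by (simp add: card_cartesian_product)
  also have "\<dots> = 2 ^ (7 * m - 3)"
  proof -
    have "int (M * (M * R)) = 2 ^ (2 * m - 1) * (2 ^ (2 * m - 1) * 2 ^ (3 * m - 1))"
      unfolding pows of_nat_mult M R ..
    also have "\<dots> = 2 ^ ((2 * m - 1) + ((2 * m - 1) + (3 * m - 1)))" by (simp only: power_add)
    also have "(2 * m - 1) + ((2 * m - 1) + (3 * m - 1)) = 7 * m - 3" using m by simp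
    finally have "int (M * (M * R)) = int (2 ^ (7 * m - 3))" by simp
    then show ?thesis by (simp only: of_nat_eq_iff)
  qed
  finally show ?thesis .
qed

section \<open>Commutator formulas and the two central series\<close>

lemma gcomm_C_pow_A: "gcomm G (C [^] (n::nat)) A = A [^] (1 - \<alpha> ^ n)"
proof -
  have "inv A \<otimes> C [^] n = C [^] n \<otimes> A [^] (- (\<alpha> ^ n))" using A_pow_C[of "-1" n] by (simp add: int_pow_neg)
  then have "gcomm G (C [^] n) A = inv (C [^] n) \<otimes> (C [^] n \<otimes> A [^] (- (\<alpha> ^ n))) \<otimes> A"
    by (simp add: gcomm_def m_assoc)
  also have "\<dots> = A [^] (- (\<alpha> ^ n)) \<otimes> A [^] (1::int)" by (simp add: m_assoc)
  also have "\<dots> = A [^] (- (\<alpha> ^ n) + 1)" by (simp only: int_pow_mult A_closed)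
  finally show ?thesis by simp
qed

lemma gcomm_C_pow_B: "gcomm G (C [^] (n::nat)) B = inv (C [^] n) \<otimes> B [^] (\<beta> ^ n - 1) \<otimes> C [^] n"
proof -
  have "gcomm G (C [^] n) B = inv (C [^] n) \<otimes> (inv B \<otimes> (C [^] n \<otimes> B))" by (simp add: gcomm_def m_assoc)
  then show ?thesis unfolding C_pow_conj_B by (simp add: m_assoc)
qed

lemma gcomm_A_pow_B: "gcomm G (A [^] (n::nat)) B = C [^] n \<otimes> A [^] (\<alpha> * geo \<alpha> n - int n * \<alpha> ^ n)"
proof -
  have "gcomm G (A [^] n) B = A [^] (- int n) \<otimes> (inv B \<otimes> (A [^] n \<otimes> B))"
    by (simp add: gcomm_def m_assoc int_pow_neg int_pow_int)
  also have "\<dots> = (A [^] (- int n) \<otimes> C [^] n) \<otimes> A [^] (\<alpha> * geo \<alpha> n)"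
    unfolding A_pow_B by (simp add: m_assoc)
  also have "\<dots> = C [^] n \<otimes> A [^] (- int n * \<alpha> ^ n + \<alpha> * geo \<alpha> n)"
    unfolding A_pow_C by (simp only: m_assoc int_pow_mult A_closed C_closed nat_pow_closed int_pow_closed)
  finally show ?thesis by simp
qed

lemma power_minus_one_dvd: "2 * P^2 dvd \<alpha> ^ (2 ^ (m - 1)) - 1" "2 * P^2 dvd \<beta> ^ (2 ^ (m - 1)) - 1"
proof -
  have g: "P dvd geo q (2 ^ (m - 1))" if "4 dvd q - 1" for q
    unfolding P_def using two_power_dvd_geo_iff[OF that] by simp
  obtain g1 g2 where "geo \<alpha> (2 ^ (m - 1)) = P * g1" "geo \<beta> (2 ^ (m - 1)) = P * g2" using g four_dvd by blast
  then have "\<alpha> ^ (2 ^ (m - 1)) - 1 = 2 * P^2 * (u * g1)" "\<beta> ^ (2 ^ (m - 1)) - 1 = 2 * P^2 * (v * g2)"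
    unfolding geo_mult_eq[symmetric] by (simp_all add: al be pows power2_eq_square)
  then show "2 * P^2 dvd \<alpha> ^ (2 ^ (m - 1)) - 1" "2 * P^2 dvd \<beta> ^ (2 ^ (m - 1)) - 1"
    by (metis dvd_triv_left)+
qed

text \<open>For n = 2^m the commutator [A^n, B] is C^n, in Z_2, times a power of A with exponent
  divisible by 2P^2, in Z_1. These memberships are hypotheses so that \<open>swap2\<close> also
  yields the statement for B.\<close>

lemma A_pow_ucs3:
  assumes gen: "generate G {A, B} = carrier G"
    and z1: "\<And>i::int. A [^] (2 * P^2 * i) \<in> ucs G 1" and z2: "C [^] (2 ^ (m - 1) :: nat) \<in> ucs G 2"
  shows "A [^] (2 ^ m :: nat) \<in> ucs G 3"
proof -
  let ?n = "2 ^ m :: nat"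
  have sub: "subgroup (ucs G i) G" for i using ucs_normal normal_imp_subgroup by blast
  have n: "int ?n = 2 * P" using pows by simp
  have "2 ^ m dvd geo \<alpha> ?n" by (simp add: two_power_dvd_geo_iff[OF four_dvd(1)])
  then obtain g where g: "geo \<alpha> ?n = 2 * P * g" unfolding pows by blast
  obtain r where r: "geo (1 + 2 * P * u) ?n = int ?n + int (?n choose 2) * (2 * P * u) + int (?n choose 3) * (2 * P * u)^2 + (2 * P * u)^3 * r"
    using geo_expand by blast
  have c2: "int (?n choose 2) = P * (2 * P - 1)" using two_choose_two[of ?n] unfolding n by simp
  have an: "\<alpha> ^ ?n = 1 + 4 * P^2 * (u * g)"
  proof -
    have "\<alpha> ^ ?n - 1 = (\<alpha> - 1) * (2 * P * g)" by (simp only: geo_mult_eq g[symmetric])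
    also have "\<alpha> - 1 = 2 * P * u" by (simp add: al pows)
    finally show ?thesis by (simp add: power2_eq_square algebra_simps)
  qed
  have "\<alpha> * geo \<alpha> ?n - int ?n * \<alpha> ^ ?n = (\<alpha> - 1) * geo \<alpha> ?n + (geo \<alpha> ?n - int ?n) - int ?n * (\<alpha> ^ ?n - 1)"
    by (simp add: algebra_simps)
  also have "(\<alpha> - 1) * geo \<alpha> ?n = 2 * P^2 * (2 * u * g)" unfolding g by (simp add: al pows power2_eq_square)
  also have "int ?n * (\<alpha> ^ ?n - 1) = 2 * P^2 * (4 * P * u * g)" unfolding n an by simp
  also have "geo \<alpha> ?n - int ?n = 2 * P^2 * ((2 * P - 1) * u + 2 * int (?n choose 3) * u^2 + 4 * P * u^3 * r)"
    unfolding al pows r c2 by (simp add: poly_simps)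
  finally have "\<exists>k. \<alpha> * geo \<alpha> ?n - int ?n * \<alpha> ^ ?n = 2 * P^2 * k" unfolding distrib_left[symmetric] right_diff_distrib[symmetric] by (rule exI)
  then obtain k where k: "\<alpha> * geo \<alpha> ?n - int ?n * \<alpha> ^ ?n = 2 * P^2 * k" by blast
  have "C [^] ?n = C [^] (2 ^ (m - 1) :: nat) \<otimes> C [^] (2 ^ (m - 1) :: nat)"
  proof -
    have "?n = 2 ^ (m - 1) + 2 ^ (m - 1)" using m by (cases m) simp_all
    then show ?thesis by (simp add: nat_pow_mult)
  qed
  then have Cn: "C [^] ?n \<in> ucs G 2" using z2 sub subgroup.m_closed by metis
  have "A [^] (2 * P^2 * k) \<in> ucs G 2" using z1 ucs_mono[of 1 2] by auto
  then have "gcomm G (A [^] ?n) B \<in> ucs G 2"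
    unfolding gcomm_A_pow_B k using Cn sub subgroup.m_closed by metis
  moreover have "gcomm G (A [^] ?n) A \<in> ucs G 2"
  proof -
    have "A [^] ?n \<otimes> A = A \<otimes> A [^] ?n" using nat_pow_comm[of A ?n 1] by simp
    then have "gcomm G (A [^] ?n) A = \<one>" by (simp only: gcomm_eq_one_iff A_closed nat_pow_closed)
    then show ?thesis using sub subgroup.one_closed by metis
  qed
  ultimately have "A [^] ?n \<in> ucs G (Suc 2)" by (intro ucs_SucI[of "{A, B}"]) (use gen in auto)
  then show ?thesis by (simp only: Suc_numeral semiring_norm)
qed

text \<open>The climb starts from A^(2P^2), which is central because it is also a power of B. Next
  come C^(2^(m-1)) in Z_2, the 2^m-th powers of A and B in Z_3, C in Z_4, and finally A and
  B.\<close>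

lemma ucs5:
  assumes gen: "generate G {A, B} = carrier G"
  shows "ucs G 5 = carrier G"
proof -
  have sub: "subgroup (ucs G i) G" for i using ucs_normal normal_imp_subgroup by blast
  have genB: "generate G {B, A} = carrier G" using gen by (simp add: insert_commute)
  obtain t where t: "B [^] (2 * P^2) = A [^] (2 * P^2 * t)" using structure_relations by blast
  obtain t' where t': "A [^] (2 * P^2) = B [^] (2 * P^2 * t')" using structure_relations by blast
  have cA: "A [^] (2 * P^2) \<in> ucs G (Suc 0)"
  proof (rule ucs_SucI[OF _ gen])
    fix s assume "s \<in> {A, B}"
    moreover have "A [^] (2 * P^2) \<otimes> A = A \<otimes> A [^] (2 * P^2)" by (rule commute_pow) simp_all
    moreover have "A [^] (2 * P^2) \<otimes> B = B \<otimes> A [^] (2 * P^2)" unfolding t' by (rule commute_pow) simp_all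
    ultimately have "s \<in> carrier G" "A [^] (2 * P^2) \<otimes> s = s \<otimes> A [^] (2 * P^2)" by auto
    then show "gcomm G (A [^] (2 * P^2)) s \<in> ucs G 0" by (simp add: gcomm_eq_one_iff)
  qed simp_all
  have z1: "A [^] (2 * P^2 * i) \<in> ucs G 1" for i :: int
  proof -
    have "(A [^] (2 * P^2)) [^] i \<in> ucs G (Suc 0)" by (rule subgroup_int_pow_closed[OF sub cA])
    then show ?thesis by (simp add: int_pow_pow)
  qed
  have z1': "B [^] (2 * P^2 * i) \<in> ucs G 1" for i :: int
  proof -
    have "B [^] (2 * P^2 * i) = A [^] (2 * P^2 * (t * i))"
      using t by (metis A_closed B_closed int_pow_pow mult.assoc)
    then show ?thesis using z1 by simp
  qed
  let ?h = "2 ^ (m - 1) :: nat"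
  have z2: "C [^] ?h \<in> ucs G 2"
  proof -
    obtain k1 k2 where k: "\<alpha> ^ ?h - 1 = 2 * P^2 * k1" "\<beta> ^ ?h - 1 = 2 * P^2 * k2"
      using power_minus_one_dvd by blast
    have "1 - \<alpha> ^ ?h = 2 * P^2 * (- k1)" using k(1) by simp
    then have "gcomm G (C [^] ?h) A \<in> ucs G 1" unfolding gcomm_C_pow_A using z1 by presburger
    moreover have "gcomm G (C [^] ?h) B \<in> ucs G 1"
      unfolding gcomm_C_pow_B k using z1' normal.inv_op_closed1[OF ucs_normal] by simp
    ultimately have "C [^] ?h \<in> ucs G (Suc 1)" by (intro ucs_SucI[OF _ gen]) auto
    then show ?thesis by (simp only: Suc_1)
  qed
  have z2': "inv C [^] ?h \<in> ucs G 2"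
    using subgroup.m_inv_closed[OF sub z2] by (simp add: nat_pow_inv)
  have z3: "A [^] (2 ^ m :: nat) \<in> ucs G 3" by (rule A_pow_ucs3[OF gen z1 z2])
  have z3': "B [^] (2 ^ m :: nat) \<in> ucs G 3" by (rule macd2.A_pow_ucs3[OF swap2 genB z1' z2'])
  have "A [^] (2 ^ m * i) \<in> ucs G 3" "B [^] (2 ^ m * i) \<in> ucs G 3" for i :: int
  proof -
    have "(A [^] int (2 ^ m)) [^] i \<in> ucs G 3" "(B [^] int (2 ^ m)) [^] i \<in> ucs G 3"
      unfolding int_pow_int by (rule subgroup_int_pow_closed[OF sub] z3 z3')+
    then show "A [^] (2 ^ m * i) \<in> ucs G 3" "B [^] (2 ^ m * i) \<in> ucs G 3" by (simp_all add: int_pow_pow)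
  qed
  note z3s = this
  have z4: "C \<in> ucs G 4"
  proof -
    have "gcomm G C A = A [^] (2 ^ m * (- u))" using gcomm_C_pow_A[of 1] by (simp add: al)
    then have "gcomm G C A \<in> ucs G 3" by (simp only: z3s)
    moreover have "gcomm G C B = inv C \<otimes> B [^] (2 ^ m * v) \<otimes> C" using gcomm_C_pow_B[of 1] by (simp add: be)
    then have "gcomm G C B \<in> ucs G 3" using z3s normal.inv_op_closed1[OF ucs_normal] by simp
    ultimately have "C \<in> ucs G (Suc 3)" by (intro ucs_SucI[OF _ gen]) auto
    then show ?thesis by (simp only: Suc_numeral semiring_norm)
  qed
  have z0: "gcomm G x x \<in> ucs G 4" if "x \<in> carrier G" for x
  proof -
    have "gcomm G x x = \<one>" using that by (simp add: gcomm_eq_one_iff)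
    then show ?thesis using subgroup.one_closed[OF sub] by simp
  qed
  have "A \<in> ucs G (Suc 4)"
    by (rule ucs_SucI[OF _ gen]) (use z4 z0 in \<open>auto simp flip: C_eq\<close>)
  moreover have "B \<in> ucs G (Suc 4)"
    by (rule ucs_SucI[OF _ gen]) (use subgroup.m_inv_closed[OF sub z4] z0 in \<open>auto simp flip: invC_eq\<close>)
  ultimately have "carrier G \<subseteq> ucs G (Suc 4)"
    unfolding gen[symmetric] by (intro generate_subgroup_incl[OF _ sub]) simp
  then have "carrier G \<subseteq> ucs G 5" by (simp only: Suc_numeral semiring_norm)
  then show ?thesis using ucs_carrier by blast
qed

text \<open>The witness is [[[C,A],B],A]. Here [C,A] = A^(1-\<alpha>) = A^n with v_2(n) = m, and up
  to a power of A the next commutator is C^n. If that commuted with A, then o(A) = 2^(3m-1) would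
  divide \<alpha>^n - 1, whose valuation is only 2m.\<close>

lemma lcs4_nontrivial:
  assumes ne: "ord A = 2 ^ (3 * m - 1)"
  shows "lcs G 4 \<noteq> {\<one>}"
proof
  assume triv: "lcs G 4 = {\<one>}"
  have Suc: "gcomm G x y \<in> lcs G (Suc i)" if "x \<in> lcs G i" "y \<in> carrier G" for x y i
    using that by (auto simp: lcs.simps(2) intro!: generate.incl)
  have "C \<in> lcs G (Suc 0)" unfolding C_eq by (rule Suc) auto
  then have "gcomm G C A \<in> lcs G (Suc (Suc 0))" by (intro Suc) auto
  then have 2: "A [^] (1 - \<alpha>) \<in> lcs G (Suc (Suc 0))" using gcomm_C_pow_A[of 1] by simp
  define n where "n = nat ((1 - \<alpha>) mod int (ord A))"
  have n: "A [^] (1 - \<alpha>) = A [^] n" unfolding n_def by (rule ord_gt_0_int_pow) (use ords in auto)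
  let ?g = "gcomm G (A [^] n) B"
  have "?g \<in> lcs G (Suc (Suc (Suc 0)))" using 2 unfolding n by (intro Suc) auto
  then have "gcomm G ?g A \<in> lcs G (Suc (Suc (Suc (Suc 0))))" by (rule Suc) simp
  then have "gcomm G ?g A = \<one>" using triv by (simp add: numeral_eq_Suc)
  then have gA: "?g \<otimes> A = A \<otimes> ?g" by (simp add: gcomm_eq_one_iff)
  define k where "k = \<alpha> * geo \<alpha> n - int n * \<alpha> ^ n"
  have g: "?g = C [^] n \<otimes> A [^] k" by (simp add: gcomm_A_pow_B k_def)
  have "C [^] n \<otimes> A \<otimes> A [^] k = C [^] n \<otimes> A [^] k \<otimes> A"
    using commute_pow[of A A k] by (simp add: m_assoc)
  also have "\<dots> = A \<otimes> C [^] n \<otimes> A [^] k" using gA unfolding g by (simp add: m_assoc)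
  finally have "C [^] n \<otimes> A = A \<otimes> C [^] n" by simp
  also have "\<dots> = C [^] n \<otimes> A [^] (\<alpha> ^ n)" using A_pow_C[of 1 n] by simp
  finally have "A [^] (1::int) = A [^] (\<alpha> ^ n)" by simp
  then have "int (ord A) dvd (\<alpha> - 1) * geo \<alpha> n" by (simp only: int_pow_eq A_closed geo_mult_eq)
  then have "(2::int) ^ (3 * m - 1) dvd 2 ^ m * (u * geo \<alpha> n)" by (simp add: ne al mult.assoc)
  moreover have "(2::int) ^ (3 * m - 1) = 2 ^ m * 2 ^ (2 * m - 1)"
  proof -
    have "3 * m - 1 = m + (2 * m - 1)" using m by simp
    then show ?thesis by (simp only: power_add)
  qed
  ultimately have "2 ^ (2 * m - 1) dvd u * geo \<alpha> n" by simp
  then have "2 ^ (2 * m - 1) dvd geo \<alpha> n" using u by (simp add: coprime_dvd_mult_right_iff)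
  then have "2 ^ (2 * m - 1) dvd n" using two_power_dvd_geo_iff four_dvd by blast
  \<comment> \<open>m > 1 gives m + 1 \<le> 2m - 1; the weaker bound already contradicts v_2(1 -
    \<alpha>) = m.\<close>
  then have "2 ^ (m + 1) dvd n"
    using m dvd_trans[OF le_imp_power_dvd[of "m + 1" "2 * m - 1" "2::nat"]] by auto
  then have "int (2 ^ (m + 1)) dvd int n" by (simp only: of_nat_dvd_iff)
  moreover have "int (2 ^ (m + 1)) dvd int (ord A)"
    using m le_imp_power_dvd[of "m + 1" "3 * m - 1" "2::int"] by (simp add: ne)
  moreover have "int (ord A) dvd (1 - \<alpha>) - int n"
  proof -
    have "int n = (1 - \<alpha>) mod int (ord A)" using ords by (simp add: n_def)
    then show ?thesis by (metis mod_eq_dvd_iff mod_mod_trivial)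
  qed
  ultimately have "int (2 ^ (m + 1)) dvd ((1 - \<alpha>) - int n) + int n" by (meson dvd_add dvd_trans)
  then have "2 ^ m * 2 dvd 2 ^ m * (- u)" by (simp add: al mult.commute)
  then have "2 dvd - u" by (simp only: dvd_mult_cancel_left) simp
  then show False using u by simp
qed

end

section \<open>A transitive action realising the upper bound\<close>

text \<open>The triple $(j,k,i)$ stands for $B^jC^kA^i$, and $P$ for $2^{m-1}$. The fibres of theta encode
  $A^{4P^3} = 1$, $C^{2P^2} = A^{2P^3}$ and $B^{2P^2} = A^{2P^2(P-1)}$.\<close>
type_synonym point = "nat \<times> nat \<times> nat"

definition theta :: "int \<Rightarrow> point \<Rightarrow> int \<times> int \<times> int" where
  "theta P = (\<lambda>(j, k, i). (int j mod (2 * P^2), int k mod (2 * P^2),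
     (int i + (P - 1) * int j + P * int k) mod (4 * P^3)))"

lemma theta_eq_iff:
  "theta P (j, k, i) = theta P (j', k', i') \<longleftrightarrow> 2 * P^2 dvd int j - int j' \<and> 2 * P^2 dvd int k - int k' \<and>
     4 * P^3 dvd (int i - int i') + (P - 1) * (int j - int j') + P * (int k - int k')"
proof -
  have "(int i + (P - 1) * int j + P * int k) - (int i' + (P - 1) * int j' + P * int k')
      = (int i - int i') + (P - 1) * (int j - int j') + P * (int k - int k')" by (simp add: algebra_simps)
  then show ?thesis unfolding theta_def prod.case prod.inject mod_eq_dvd_iff by (simp only:)
qed

text \<open>For prescribed j and k a suitable i reaches every third coordinate. With P = 2^(m-1) the
  box has 2^(7m-3) points, the size of the upper bound.\<close>

lemma range_theta:
  fixes P :: int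
  assumes P: "P > 0"
  shows "range (theta P) = {0..<2 * P^2} \<times> {0..<2 * P^2} \<times> {0..<4 * P^3}"
proof (intro equalityI subsetI)
  fix x assume "x \<in> range (theta P)"
  then show "x \<in> {0..<2 * P^2} \<times> {0..<2 * P^2} \<times> {0..<4 * P^3}"
    using P by (auto simp: theta_def)
next
  fix x assume "x \<in> {0..<2 * P^2} \<times> {0..<2 * P^2} \<times> {0..<4 * P^3}"
  then obtain a b c where x: "x = (a, b, c)" "0 \<le> a" "a < 2 * P^2" "0 \<le> b" "b < 2 * P^2" "0 \<le> c" "c < 4 * P^3"
    by auto
  let ?i = "(c - (P - 1) * a - P * b) mod (4 * P^3)"
  have "?i \<ge> 0" using P by simp
  moreover have "(?i + (P - 1) * a + P * b) mod (4 * P^3) = c"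
  proof -
    have "(?i + ((P - 1) * a + P * b)) mod (4 * P^3) = ((c - (P - 1) * a - P * b) + ((P - 1) * a + P * b)) mod (4 * P^3)"
      by (rule mod_add_left_eq)
    then show ?thesis using x by (simp add: add.assoc)
  qed
  ultimately have "theta P (nat a, nat b, nat ?i) = x" using x by (simp add: theta_def)
  then show "x \<in> range (theta P)" by (metis rangeI)
qed

text \<open>The exponents are natural numbers here because maps will be iterated \<open>be\<close>
  times; the integers \<alpha> and \<beta> are reached afterwards by reduction modulo a common
  period.\<close>

locale macd_model =
  fixes P u v w :: int and al be :: nat
  assumes P: "P > 0" "even P" "coprime P 3" and odd: "odd u" "odd v" "odd w"
    and al: "int al = 1 + 2 * P * u" and be: "int be = 1 + 2 * P * v"
    and uv: "v = u - P * w"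
begin

text \<open>Right multiplication by $B^t$ maps $B^jC^kA^i$ to $B^{j + \beta^k J}C^{k+q}A^{i'}$, where $J$, $q$ and $i'$ are
  jj, qq and it at $t$ and $i$.\<close>
definition phi :: "nat \<Rightarrow> nat" where "phi i = nat (int al * geo (int al) i)"
definition it :: "nat \<Rightarrow> nat \<Rightarrow> nat" where "it t = phi ^^ t"
definition qq :: "nat \<Rightarrow> nat \<Rightarrow> nat" where "qq t i = (\<Sum>s<t. it s i)"
definition jj :: "nat \<Rightarrow> nat \<Rightarrow> nat" where "jj t i = (\<Sum>s<t. be ^ qq s i)"

abbreviation xi :: int where "xi \<equiv> P * u"
text \<open>With x = 2 \<open>xi\<close>, \<open>hp i\<close> and \<open>ka i\<close> are the
  coefficients of x and x^2 in (1 + x) geo (1 + x) i = geo (1 + x) (i + 1) - 1, that is, in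
  \<open>phi i\<close>.\<close>

definition hp :: "nat \<Rightarrow> int" where "hp i = int (Suc i choose 2)"
definition ka :: "nat \<Rightarrow> int" where "ka i = int (Suc i choose 3)"

lemma hp: "int i * (int i + 1) = 2 * hp i"
  unfolding hp_def using two_choose_two[of "Suc i"] by (simp add: algebra_simps)

lemma ka: "6 * ka i = (int i)^3 - int i"
  unfolding ka_def using six_choose_three[of "Suc i"] by (simp add: algebra_simps power3_eq_cube)

lemma phi_int: "int (phi i) = int al * geo (int al) i"
  unfolding phi_def geo_def by (simp add: sum_nonneg)

lemma phi_cong: "4 * P^3 dvd int (phi i) - (int i + xi * (2 * hp i) + 4 * xi^2 * ka i)"
proof -
  let ?x = "2 * P * u"
  obtain r where r: "geo (1 + ?x) i = int i + int (i choose 2) * ?x + int (i choose 3) * ?x^2 + ?x^3 * r"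
    using geo_expand by blast
  have c: "hp i = int i + int (i choose 2)" "ka i = int (i choose 2) + int (i choose 3)"
    by (simp_all add: hp_def ka_def numeral_2_eq_2 numeral_3_eq_3)
  have "int (phi i) = (1 + ?x) * geo (1 + ?x) i" by (simp add: phi_int al)
  then have "int (phi i) - (int i + xi * (2 * hp i) + 4 * xi^2 * ka i)
      = 4 * P^3 * (2 * u^3 * (int (i choose 3) + (1 + ?x) * r))"
    unfolding r c by (simp add: poly_simps)
  then show ?thesis by (metis dvd_triv_left)
qed

lemma dvd_of_three: "P dvd 3 * a \<Longrightarrow> P dvd a"
  using P(3) by (simp add: coprime_dvd_mult_right_iff)

text \<open>\<open>ka\<close> always occurs with the factor 4 \<open>xi\<close>^2, so modulo 4P^3
  only its residue modulo P matters.\<close>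

lemma ka_cong:
  assumes "2 * P dvd int n - int i"
  shows "P dvd ka n - ka i"
proof -
  have "6 * (ka n - ka i) = (int n - int i) * ((int n)^2 + int n * int i + (int i)^2 - 1)"
    using ka[of n] ka[of i] by (simp add: poly_simps)
  then have "2 * P dvd 2 * (3 * (ka n - ka i))" using assms by simp
  then have "P dvd 3 * (ka n - ka i)" by (metis dvd_mult_cancel_left zero_neq_numeral)
  then show ?thesis by (rule dvd_of_three)
qed

text \<open>The displacement of i under t steps of \<open>phi\<close>, divided by 2
  \<open>xi\<close> and taken to the precision of \<open>it_cong\<close>. Increments constant in t,
  linear in t and proportional to (t choose 2) sum to t, (t choose 2) and (t choose 3).\<close>

definition it_form :: "nat \<Rightarrow> nat \<Rightarrow> int" where
  "it_form t i = int t * hp i + 2 * int t * xi * ka i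
     + int (t choose 2) * xi * hp i * (2 * int i + 1) + int (t choose 3) * xi^2 * hp i"

lemma choose_Suc: "Suc t choose 2 = t + (t choose 2)" "Suc t choose 3 = (t choose 2) + (t choose 3)"
  by (simp_all add: numeral_2_eq_2 numeral_3_eq_3)

lemma it_cong: "4 * P^3 dvd int (it t i) - (int i + 2 * xi * it_form t i)"
proof (induction t)
  case 0
  then show ?case by (simp add: it_def it_form_def binomial_eq_0)
next
  case (Suc t)
  let ?n = "it t i" and ?h = "it_form t i" and ?s = "2 * int i + 1"
  obtain c where c: "int ?n = int i + 2 * xi * ?h + 4 * P^3 * c" using Suc dvd_diff_imp by blast
  have "int ?n - int i = 2 * P * (u * ?h + 2 * P^2 * c)"
    unfolding c by (simp add: poly_simps)
  then have "P dvd ka ?n - ka i" by (intro ka_cong) (metis dvd_triv_left)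
  then obtain k where k: "ka ?n = ka i + P * k" using dvd_diff_imp by blast
  obtain r where r: "int (phi ?n) = int ?n + xi * (2 * hp ?n) + 4 * xi^2 * ka ?n + 4 * P^3 * r"
    using phi_cong[of ?n] dvd_diff_imp by blast
  obtain P' where P': "P = 2 * P'" using P by blast
  let ?I = "int i + 2 * xi * ?h"
  have 1: "2 * hp ?n = ?I * (?I + 1) + 4 * P^3 * (c * (2 * ?I + 1 + 4 * P^3 * c))"
    unfolding hp[symmetric] c by (simp add: algebra_simps)
  have 2: "?I * (?I + 1) = 2 * hp i + 2 * xi * ?h * ?s + 4 * xi^2 * ?h^2"
    using hp[of i] by (simp add: algebra_simps power2_eq_square)
  \<comment> \<open>Since this square is 1 modulo 8, the term 2 (t choose 2) \<open>xi\<close>^3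
    \<open>hp i\<close> survives modulo 4P^3; it is the source of the (t choose 3) term of
    \<open>it_form\<close>.\<close>
  have ss: "?s * ?s = 1 + 8 * hp i" using hp[of i] by (simp add: algebra_simps)
  have 3: "2 * xi^2 * ?h * ?s = 2 * int t * xi^2 * hp i * ?s + 2 * int (t choose 2) * xi^3 * hp i
     + 4 * xi^3 * (int t * ka i * ?s + 4 * int (t choose 2) * (hp i)^2)
     + 2 * int (t choose 3) * xi^4 * hp i * ?s"
  proof -
    have "2 * xi^2 * ?h * ?s = 2 * int t * xi^2 * hp i * ?s + 4 * int t * xi^3 * ka i * ?s
       + 2 * int (t choose 2) * xi^3 * hp i * (?s * ?s) + 2 * int (t choose 3) * xi^4 * hp i * ?s"
      unfolding it_form_def by (simp add: poly_simps)
    then show ?thesis unfolding ss by (simp add: algebra_simps power2_eq_square)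
  qed
  have 4: "it_form (Suc t) i = ?h + hp i + 2 * xi * ka i + int t * xi * hp i * ?s + int (t choose 2) * xi^2 * hp i"
    unfolding it_form_def choose_Suc by (simp add: algebra_simps)
  have "int (it (Suc t) i) = int (phi ?n)" by (simp add: it_def)
  also have "\<dots> = ?I + 4 * P^3 * c + xi * (2 * hp i + 2 * xi * ?h * ?s + 4 * xi^2 * ?h^2)
      + 4 * P^3 * (xi * c * (2 * ?I + 1 + 4 * P^3 * c)) + 4 * xi^2 * ka i + 4 * P^3 * (u^2 * k) + 4 * P^3 * r"
    unfolding r 1 2 k unfolding c by (simp add: poly_simps)
  also have "\<dots> = (?I + 2 * xi * hp i + 4 * xi^2 * ka i + 2 * xi^2 * ?h * ?s)
      + 4 * P^3 * (c + u^3 * ?h^2 + xi * c * (2 * ?I + 1 + 4 * P^3 * c) + u^2 * k + r)"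
    by (simp add: poly_simps)
  also have "\<dots> = (int i + 2 * xi * it_form (Suc t) i)
      + 4 * P^3 * (u^3 * (int t * ka i * ?s + 4 * int (t choose 2) * (hp i)^2) + int (t choose 3) * P' * u^4 * hp i * ?s
         + c + u^3 * ?h^2 + xi * c * (2 * ?I + 1 + 4 * P^3 * c) + u^2 * k + r)"
    unfolding 3 4 by (simp add: poly_simps P')
  finally show ?case by (metis add_diff_cancel_left' dvd_triv_left)
qed

text \<open>Precision 4P^2 is enough, because k enters the third coordinate of \<open>theta\<close>
  with the factor P.\<close>

lemma qq_cong:
  "4 * P^2 dvd int (qq t i) - (int t * int i + 2 * int (t choose 2) * xi * hp i + 2 * int (t choose 3) * xi^2 * hp i)"
proof (induction t)
  case 0
  then show ?case by (simp add: qq_def binomial_eq_0)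
next
  case (Suc t)
  obtain c where c: "int (qq t i) = (int t * int i + 2 * int (t choose 2) * xi * hp i + 2 * int (t choose 3) * xi^2 * hp i) + 4 * P^2 * c"
    using Suc dvd_diff_imp by blast
  obtain d where d: "int (it t i) = int i + 2 * xi * it_form t i + 4 * P^3 * d"
    using it_cong dvd_diff_imp by blast
  obtain P' where P': "P = 2 * P'" using P by blast
  have "int (qq (Suc t) i) = int (qq t i) + int (it t i)" by (simp add: qq_def)
  also have "\<dots> = (int (Suc t) * int i + 2 * int (Suc t choose 2) * xi * hp i + 2 * int (Suc t choose 3) * xi^2 * hp i)
     + 4 * P^2 * (c + P * d + int t * u^2 * ka i + int (t choose 2) * u^2 * hp i * int i + int (t choose 3) * P' * u^3 * hp i)"
    unfolding c d it_form_def choose_Suc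
    by (simp add: poly_simps P')
  finally show ?case by (metis add_diff_cancel_left' dvd_triv_left)
qed

lemma choose_mult: "int ((s * i) choose 2) = int s * int (i choose 2) + int (s choose 2) * (int i)^2"
proof -
  have "2 * (int s * int (i choose 2) + int (s choose 2) * (int i)^2)
      = int s * (2 * int (i choose 2)) + (2 * int (s choose 2)) * (int i)^2" by (simp add: algebra_simps)
  also have "\<dots> = 2 * int ((s * i) choose 2)"
    unfolding two_choose_two by (simp add: algebra_simps power2_eq_square)
  finally have "2 * int ((s * i) choose 2) = 2 * (int s * int (i choose 2) + int (s choose 2) * (int i)^2)" ..
  then show ?thesis by simp
qed

abbreviation yy :: int where "yy \<equiv> 2 * P * v"

text \<open>Expansion of the sum of the powers (1 + \<open>yy\<close>)^q with q =
  \<open>qq s i\<close>. The cubic terms are multiples of 8P^3, and in the quadratic ones (q choose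
  2) is needed only modulo P, which allows q to be replaced by s i.\<close>

lemma jj_cong:
  "4 * P^3 dvd int (jj t i) - (int t + yy * (int (t choose 2) * int i + 2 * int (t choose 3) * xi * hp i)
     + yy^2 * (int (t choose 2) * int (i choose 2) + int (t choose 3) * (int i)^2))"
proof (induction t)
  case 0
  then show ?case by (simp add: jj_def binomial_eq_0)
next
  case (Suc t)
  let ?q = "qq t i" and ?n = "t * i"
  obtain c where c: "int (jj t i) = (int t + yy * (int (t choose 2) * int i + 2 * int (t choose 3) * xi * hp i)
     + yy^2 * (int (t choose 2) * int (i choose 2) + int (t choose 3) * (int i)^2)) + 4 * P^3 * c"
    using Suc dvd_diff_imp by blast
  obtain d where d: "int ?q = (int t * int i + 2 * int (t choose 2) * xi * hp i + 2 * int (t choose 3) * xi^2 * hp i) + 4 * P^2 * d"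
    using qq_cong dvd_diff_imp by blast
  obtain r where r: "(1 + yy) ^ ?q = 1 + int ?q * yy + int (?q choose 2) * yy^2 + yy^3 * r"
    using power_expand by blast
  have "int ?q - int ?n = 2 * P * (int (t choose 2) * u * hp i + int (t choose 3) * P * u^2 * hp i + 2 * P * d)"
    unfolding d by (simp add: algebra_simps power2_eq_square)
  moreover have "2 * (int (?q choose 2) - int (?n choose 2)) = (int ?q - int ?n) * (int ?q + int ?n - 1)"
    using two_choose_two[of ?q] two_choose_two[of ?n] by (simp add: algebra_simps)
  ultimately have "P dvd int (?q choose 2) - int (?n choose 2)"
  proof -
    assume "int ?q - int ?n = 2 * P * (int (t choose 2) * u * hp i + int (t choose 3) * P * u^2 * hp i + 2 * P * d)"
      and "2 * (int (?q choose 2) - int (?n choose 2)) = (int ?q - int ?n) * (int ?q + int ?n - 1)"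
    then have "2 * (int (?q choose 2) - int (?n choose 2))
        = 2 * (P * ((int (t choose 2) * u * hp i + int (t choose 3) * P * u^2 * hp i + 2 * P * d) * (int ?q + int ?n - 1)))"
      by (simp only: mult.assoc)
    then show ?thesis by (simp only: mult_cancel_left) simp
  qed
  then obtain e where e: "int (?q choose 2) = int (?n choose 2) + P * e" using dvd_diff_imp by blast
  have "int (jj (Suc t) i) = int (jj t i) + (1 + yy) ^ ?q" by (simp add: jj_def be)
  also have "\<dots> = (int (Suc t) + yy * (int (Suc t choose 2) * int i + 2 * int (Suc t choose 3) * xi * hp i)
     + yy^2 * (int (Suc t choose 2) * int (i choose 2) + int (Suc t choose 3) * (int i)^2))
     + 4 * P^3 * (c + v * int (t choose 3) * u^2 * hp i + 2 * v * d + v^2 * e + 2 * v^3 * r)"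
    unfolding c r e d choose_mult choose_Suc
    by (simp add: poly_simps)
  finally show ?case by (metis add_diff_cancel_left' dvd_triv_left)
qed

lemma choose_be:
  "int (be choose 2) = int be * P * v" "P dvd int (be choose 3)"
proof -
  show "int (be choose 2) = int be * P * v" using two_choose_two[of be] be by simp
  have "2 * (3 * int (be choose 3)) = 2 * (P * (int be * v * (int be - 2)))"
    using six_choose_three[of be] be by (simp add: algebra_simps)
  then have "3 * int (be choose 3) = P * (int be * v * (int be - 2))" by simp
  then show "P dvd int (be choose 3)" by (metis dvd_of_three dvd_triv_left)
qed

lemma jj_be: "4 * P^3 dvd int (jj be i) - (int be + 2 * P^2 * v^2 * int i)"
proof -
  obtain c where c: "int (jj be i) = (int be + yy * (int (be choose 2) * int i + 2 * int (be choose 3) * xi * hp i)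
     + yy^2 * (int (be choose 2) * int (i choose 2) + int (be choose 3) * (int i)^2)) + 4 * P^3 * c"
    using jj_cong dvd_diff_imp by blast
  obtain d where d: "int (be choose 3) = P * d" using choose_be(2) by blast
  have "int (jj be i) - (int be + 2 * P^2 * v^2 * int i) = 4 * P^3 * (c + v^3 * int i + v * d * u * hp i
      + v^3 * int be * int (i choose 2) + v^2 * d * (int i)^2)"
    unfolding c choose_be(1) d by (simp add: be poly_simps)
  then show ?thesis by (metis dvd_triv_left)
qed

text \<open>The exact valuation of \<alpha> - \<beta> enters here: \<beta> i = \<alpha> i - 2P^2 w i
  with w odd gives the summand 2P^2 i, while the odd product \<beta> v u gives 2P^2
  \<open>hp i\<close>.\<close>

lemma qq_be: "4 * P^2 dvd int (qq be i) - (int al * int i + 2 * P^2 * (int i + hp i))"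
proof -
  obtain c where c: "int (qq be i) = (int be * int i + 2 * int (be choose 2) * xi * hp i + 2 * int (be choose 3) * xi^2 * hp i) + 4 * P^2 * c"
    using qq_cong dvd_diff_imp by blast
  obtain d where d: "int (be choose 3) = P * d" using choose_be(2) by blast
  obtain P' where P': "P = 2 * P'" using P by blast
  have "odd (int be * v * u)" using odd by (simp add: be)
  then obtain o1 where o1: "int be * v * u = 2 * o1 + 1" by (elim oddE)
  obtain o2 where o2: "w = 2 * o2 + 1" using odd by (elim oddE)
  have b: "int be = int al - 2 * P^2 * w" by (simp add: al be uv algebra_simps power2_eq_square)
  have "2 * int (be choose 2) * xi * hp i = 2 * P^2 * (int be * v * u) * hp i"
    unfolding choose_be(1) by (simp add: algebra_simps power2_eq_square)
  then have q1: "2 * int (be choose 2) * xi * hp i = 2 * P^2 * (2 * o1 + 1) * hp i" by (simp only: o1)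
  have q2: "int be * int i = (int al - 2 * P^2 * (2 * o2 + 1)) * int i" by (simp only: b o2)
  have q3: "2 * int (be choose 3) * xi^2 * hp i = 4 * P^2 * (P' * d * u^2 * hp i)"
    unfolding d by (simp add: P' algebra_simps power2_eq_square)
  have "int (qq be i) - (int al * int i + 2 * P^2 * (int i + hp i))
      = 4 * P^2 * (c + o1 * hp i - o2 * int i - int i + P' * d * u^2 * hp i)"
    unfolding c q1 q2 q3 by (simp add: algebra_simps)
  then show ?thesis by (metis dvd_triv_left)
qed

text \<open>The discrepancy of the A-exponents when both sides of C B = B^\<beta> C act on B^j C^k
  A^i. It does not vanish by itself; in \<open>stB_stC\<close> it cancels against those of the B-
  and C-exponents.\<close>

lemma it_be: "4 * P^3 dvd int al * int (it be i) - int (phi (al * i)) - (2 * P^2 * u^2 * int i + 2 * P^3 * hp i)"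
proof -
  obtain c where c: "int (it be i) = int i + 2 * xi * it_form be i + 4 * P^3 * c"
    using it_cong dvd_diff_imp by blast
  obtain d where d: "int (be choose 3) = P * d" using choose_be(2) by blast
  obtain P' where P': "P = 2 * P'" using P by blast
  obtain r where r: "int (phi (al * i)) = int (al * i) + xi * (2 * hp (al * i)) + 4 * xi^2 * ka (al * i) + 4 * P^3 * r"
    using phi_cong dvd_diff_imp by blast
  have n: "int (al * i) = int i + 2 * P * u * int i" by (simp add: al algebra_simps)
  have "P dvd ka (al * i) - ka i" by (rule ka_cong) (unfold n, simp)
  then obtain k where k: "ka (al * i) = ka i + P * k" using dvd_diff_imp by blast
  have h: "2 * hp (al * i) = 2 * hp i + 2 * P * u * int i * (2 * int i + 1) + 4 * P^2 * u^2 * (int i)^2"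
    using hp[of i] unfolding hp[symmetric, of "al * i"] n by (simp add: algebra_simps power2_eq_square)
  have "odd (int be * v * u^2 * (2 * int i + 1))" using odd by (simp add: be)
  then obtain o1 where o1: "int be * v * u^2 * (2 * int i + 1) = 2 * o1 + 1" by (elim oddE)
  have "2 * xi * it_form be i = 2 * int be * xi * hp i + 4 * int be * xi^2 * ka i
     + 2 * P^3 * (int be * v * u^2 * (2 * int i + 1)) * hp i + 2 * P^4 * d * u^3 * hp i"
    unfolding it_form_def choose_be(1) d
    by (simp add: poly_simps)
  also have "\<dots> = 2 * xi * hp i + 4 * P^2 * u * v * hp i + 4 * xi^2 * ka i + 2 * P^3 * hp i
     + 4 * P^3 * (2 * v * u^2 * ka i + o1 * hp i + P' * d * u^3 * hp i)"
    unfolding o1 by (simp add: be P' poly_simps)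
  also have "4 * P^2 * u * v * hp i = 4 * P^2 * u^2 * hp i - 4 * P^3 * (u * w * hp i)"
    by (simp add: uv poly_simps)
  finally have f: "2 * xi * it_form be i = 2 * xi * hp i + 4 * P^2 * u^2 * hp i + 4 * xi^2 * ka i + 2 * P^3 * hp i
     + 4 * P^3 * (2 * v * u^2 * ka i + o1 * hp i + P' * d * u^3 * hp i - u * w * hp i)" by (simp add: algebra_simps)
  define Y where "Y = 2 * v * u^2 * ka i + o1 * hp i + P' * d * u^3 * hp i - u * w * hp i"
  have h8: "8 * P^2 * u^2 * hp i = 4 * P^2 * u^2 * ((int i)^2 + int i)"
    using hp[of i] by (simp add: algebra_simps power2_eq_square)
  have "int al * int (it be i) - int (phi (al * i)) - (2 * P^2 * u^2 * int i + 2 * P^3 * hp i)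
     = (8 * P^2 * u^2 * hp i - 4 * P^2 * u^2 * ((int i)^2 + int i))
       + 4 * P^3 * ((1 + 2 * P * u) * (Y + c) - r - u^2 * k - u^3 * (int i)^2
           + 2 * u^3 * hp i + 2 * u^3 * ka i + P * u * hp i)"
    unfolding c f r h k al n Y_def[symmetric]
    by (simp add: poly_simps)
  then show ?thesis unfolding h8 by (metis diff_self add_0 dvd_triv_left)
qed


text \<open>Right multiplication of B^j C^k A^i by A, B and C, as prescribed by
  \<open>A_pow_B\<close>, \<open>C_pow_B\<close> and \<open>A_pow_C\<close>. The maps are not
  surjective on triples; they become permutations on the fibres of \<open>theta\<close>.\<close>

definition stA :: "point \<Rightarrow> point" where "stA = (\<lambda>(j, k, i). (j, k, Suc i))"
definition stB :: "point \<Rightarrow> point" where "stB = (\<lambda>(j, k, i). (j + be ^ k, k + i, phi i))"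
definition stC :: "point \<Rightarrow> point" where "stC = (\<lambda>(j, k, i). (j, Suc k, al * i))"

lemma st_simps [simp]:
  "stA (j, k, i) = (j, k, Suc i)" "stB (j, k, i) = (j + be ^ k, k + i, phi i)" "stC (j, k, i) = (j, Suc k, al * i)"
  by (simp_all add: stA_def stB_def stC_def)

section \<open>The relations for the three maps\<close>

abbreviation Theta :: "point \<Rightarrow> int \<times> int \<times> int" where "Theta \<equiv> theta P"
lemmas Theta_eq_iff = theta_eq_iff[of P]

lemma stB_funpow: "(stB ^^ t) (j, k, i) = (j + be ^ k * jj t i, k + qq t i, it t i)"
proof (induction t)
  case 0
  then show ?case by (simp add: jj_def qq_def it_def)
next
  case (Suc t)
  have "it (Suc t) i = phi (it t i)" by (simp add: it_def)
  then show ?case by (simp add: Suc jj_def qq_def power_add algebra_simps)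
qed

lemma stA_funpow: "(stA ^^ t) (j, k, i) = (j, k, i + t)"
  by (induction t) simp_all

lemma phi_0: "phi 0 = 0"
  by (simp add: phi_def)

lemma stB_funpow_0: "(stB ^^ t) (j, 0, 0) = (j + t, 0, 0)"
  by (induction t) (simp_all add: phi_0)

lemma stC_funpow_0: "(stC ^^ t) (j, k, 0) = (j, k + t, 0)"
  by (induction t) simp_all

lemma stB_stA: "stB (stA p) = stC (stA (stB p))"
proof -
  obtain j k i where p: "p = (j, k, i)" by (cases p)
  have "int (phi (Suc i)) = int (al * Suc (phi i))" by (simp add: phi_int geo_Suc' algebra_simps)
  then have "phi (Suc i) = al * Suc (phi i)" by (simp only: of_nat_eq_iff)
  then show ?thesis by (simp add: p)
qed

lemma stC_stA: "stC (stA p) = (stA ^^ al) (stC p)"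
proof -
  obtain j k i where p: "p = (j, k, i)" by (cases p)
  show ?thesis by (simp add: p stA_funpow)
qed

lemma be_power_cong: "2 * P dvd int (be ^ k) - 1"
  using dvd_trans[OF _ dvd_power_minus_one[of "int be" k], of "2 * P"] by (simp add: be)

text \<open>The discrepancies are 2P^2 u^2 i + 2P^3 \<open>hp i\<close> in A, 2P^2 v^2 i in B and
  2P^2 (i + \<open>hp i\<close>) in C, with weights 1, P - 1 and P in \<open>theta\<close>. As v^2
  is u^2 modulo 2P, the total is 2P^3 (u^2 + 1) i + 4P^3 \<open>hp i\<close> modulo 4P^3, which
  vanishes because u is odd. This sum dictates the weight P - 1.\<close>

lemma stB_stC: "Theta (stB (stC p)) = Theta (stC ((stB ^^ be) p))"
proof -
  obtain j k i where p: "p = (j, k, i)" by (cases p)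
  obtain c1 where c1: "int (jj be i) = int be + 2 * P^2 * v^2 * int i + 4 * P^3 * c1"
    using jj_be dvd_diff_imp by blast
  obtain c2 where c2: "int (qq be i) = int al * int i + 2 * P^2 * (int i + hp i) + 4 * P^2 * c2"
    using qq_be dvd_diff_imp by blast
  obtain c3 where c3: "int al * int (it be i) - int (phi (al * i)) = 2 * P^2 * u^2 * int i + 2 * P^3 * hp i + 4 * P^3 * c3"
    using it_be dvd_diff_imp by blast
  obtain b where b: "int (be ^ k) = 1 + 2 * P * b" using be_power_cong dvd_diff_imp by blast
  obtain u' where u': "u = 2 * u' + 1" using odd by (elim oddE)
  have L: "stB (stC p) = (j + be ^ Suc k, Suc k + al * i, phi (al * i))"
    by (simp add: p)
  have R: "stC ((stB ^^ be) p) = (j + be ^ k * jj be i, Suc (k + qq be i), al * it be i)"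
    by (simp add: p stB_funpow)
  have dj: "int (j + be ^ k * jj be i) - int (j + be ^ Suc k) = (1 + 2 * P * b) * (2 * P^2 * v^2 * int i + 4 * P^3 * c1)"
  proof -
    have "int (j + be ^ k * jj be i) - int (j + be ^ Suc k) = int (be ^ k) * (int (jj be i) - int be)"
      by (simp add: algebra_simps)
    then show ?thesis unfolding b c1 by simp
  qed
  have dk: "int (Suc (k + qq be i)) - int (Suc k + al * i) = 2 * P^2 * (int i + hp i) + 4 * P^2 * c2"
    by (simp add: c2)
  have di: "int (al * it be i) - int (phi (al * i)) = 2 * P^2 * u^2 * int i + 2 * P^3 * hp i + 4 * P^3 * c3"
    using c3 by simp
  have v2: "v^2 = u^2 + P * (P * w^2 - 2 * u * w)" by (simp add: uv algebra_simps power2_eq_square)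
  obtain P' where P': "P = 2 * P'" using P by blast
  have "Theta (stC ((stB ^^ be) p)) = Theta (stB (stC p))"
    unfolding L R Theta_eq_iff dj dk di
  proof (intro conjI)
    have "(1 + 2 * P * b) * (2 * P^2 * v^2 * int i + 4 * P^3 * c1) = 2 * P^2 * ((1 + 2 * P * b) * (v^2 * int i + 2 * P * c1))"
      by (simp add: poly_simps)
    then show "2 * P^2 dvd (1 + 2 * P * b) * (2 * P^2 * v^2 * int i + 4 * P^3 * c1)" by (metis dvd_triv_left)
    have "2 * P^2 * (int i + hp i) + 4 * P^2 * c2 = 2 * P^2 * (int i + hp i + 2 * c2)" by (simp add: algebra_simps)
    then show "2 * P^2 dvd 2 * P^2 * (int i + hp i) + 4 * P^2 * c2" by (metis dvd_triv_left)
    have "(P - 1) * ((1 + 2 * P * b) * (2 * P^2 * v^2 * int i + 4 * P^3 * c1))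
       = 2 * P^2 * (P - 1) * u^2 * int i + 4 * P^3 * ((P - 1) * (P' * w^2 - u * w) * int i + (P - 1) * (b * v^2 * int i + (1 + 2 * P * b) * c1))"
    proof -
      have "2 * P^2 * v^2 * int i = 2 * P^2 * u^2 * int i + 4 * P^3 * ((P' * w^2 - u * w) * int i)"
        unfolding v2 by (simp add: P' poly_simps)
      moreover have "(P - 1) * ((1 + 2 * P * b) * (2 * P^2 * v^2 * int i + 4 * P^3 * c1))
          = (P - 1) * (2 * P^2 * v^2 * int i) + 4 * P^3 * ((P - 1) * (b * v^2 * int i + (1 + 2 * P * b) * c1))"
        by (simp add: poly_simps)
      ultimately show ?thesis by (simp only: distrib_left mult.assoc mult.left_commute)
    qed
    then have "(2 * P^2 * u^2 * int i + 2 * P^3 * hp i + 4 * P^3 * c3)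
        + (P - 1) * ((1 + 2 * P * b) * (2 * P^2 * v^2 * int i + 4 * P^3 * c1))
        + P * (2 * P^2 * (int i + hp i) + 4 * P^2 * c2)
      = 4 * P^3 * (c3 + hp i + c2 + (2 * u'^2 + 2 * u' + 1) * int i
          + (P - 1) * (P' * w^2 - u * w) * int i + (P - 1) * (b * v^2 * int i + (1 + 2 * P * b) * c1))"
      by (simp add: u' poly_simps)
    then show "4 * P^3 dvd (2 * P^2 * u^2 * int i + 2 * P^3 * hp i + 4 * P^3 * c3)
        + (P - 1) * ((1 + 2 * P * b) * (2 * P^2 * v^2 * int i + 4 * P^3 * c1))
        + P * (2 * P^2 * (int i + hp i) + 4 * P^2 * c2)" by (metis dvd_triv_left)
  qed
  then show ?thesis by simp
qed

section \<open>Behaviour of the three maps on the fibres\<close>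

lemma al_minus_dvd:
  assumes "2 * P^2 dvd h"
  shows "4 * P^3 dvd int al * h - h"
proof -
  obtain t where "h = 2 * P^2 * t" using assms by blast
  then have "int al * h - h = 4 * P^3 * (u * t)" by (simp add: al poly_simps)
  then show ?thesis by (metis dvd_triv_left)
qed

lemma M_dvd_R: "2 * P^2 dvd 4 * P^3"
proof -
  have "4 * P^3 = 2 * P^2 * (2 * P)" by (simp add: power2_eq_square power3_eq_cube)
  then show ?thesis by (metis dvd_triv_left)
qed

lemma Theta_dvd_third:
  assumes "2 * P^2 dvd a" "2 * P^2 dvd b" "4 * P^3 dvd h + (P - 1) * a + P * b"
  shows "2 * P^2 dvd h"
proof -
  have "2 * P^2 dvd h + ((P - 1) * a + P * b)" using dvd_trans[OF M_dvd_R assms(3)] by (simp add: add.assoc)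
  moreover have "2 * P^2 dvd (P - 1) * a + P * b" using assms by simp
  ultimately show ?thesis by (simp only: dvd_add_left_iff)
qed

lemma stA_Theta_iff: "Theta (stA p) = Theta (stA q) \<longleftrightarrow> Theta p = Theta q"
  by (cases p; cases q) (simp add: Theta_eq_iff)

lemma coprime_al: "2 * P^2 dvd int al * h \<Longrightarrow> 2 * P^2 dvd h"
proof -
  have "coprime (2 * P^2) (int al)"
  proof -
    have "gcd (2 * P) (1 + 2 * P * u) = 1"
      using gcd_add_mult[of "2 * P" u 1] by (simp add: ac_simps)
    then have "coprime (2 * P) (int al)" by (simp add: al coprime_iff_gcd_eq_1)
    then have "coprime ((2 * P) * (2 * P)) (int al)" by (simp only: coprime_mult_left_iff)
    moreover have "(2 * P) * (2 * P) = (2 * P^2) * 2" by (simp add: power2_eq_square)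
    ultimately show ?thesis by (metis coprime_mult_left_iff)
  qed
  then show "2 * P^2 dvd int al * h \<Longrightarrow> 2 * P^2 dvd h" by (simp only: coprime_dvd_mult_right_iff)
qed

lemma stC_Theta_iff: "Theta (stC p) = Theta (stC q) \<longleftrightarrow> Theta p = Theta q"
proof -
  obtain j k i j' k' i' where p: "p = (j, k, i)" and q: "q = (j', k', i')" by (cases p; cases q)
  let ?a = "int j - int j'" and ?b = "int k - int k'" and ?h = "int i - int i'"
  have "4 * P^3 dvd int al * ?h + (P - 1) * ?a + P * ?b \<longleftrightarrow> 4 * P^3 dvd ?h + (P - 1) * ?a + P * ?b"
    if ab: "2 * P^2 dvd ?a" "2 * P^2 dvd ?b"
  proof -
    have *: ?thesis if "2 * P^2 dvd ?h"
    proof -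
      have "int al * ?h + (P - 1) * ?a + P * ?b = (int al * ?h - ?h) + (?h + (P - 1) * ?a + P * ?b)" by simp
      then show ?thesis using dvd_add_right_iff[OF al_minus_dvd[OF that]] by metis
    qed
    show ?thesis
      using * Theta_dvd_third[OF ab] coprime_al by blast
  qed
  then show ?thesis
    by (auto simp: p q Theta_eq_iff simp flip: right_diff_distrib)
qed

text \<open>The surplus P (i - i') meets an equal one in \<open>stB\<close>, where k + i shifts too
  and has weight P; together they are 2P (i - i'), a multiple of 4P^3.\<close>

lemma phi_shift:
  assumes "2 * P^2 dvd int i - int i'"
  shows "4 * P^3 dvd (int (phi i) - int (phi i')) - (1 + P) * (int i - int i')"
proof -
  obtain h where h: "int i = int i' + 2 * P^2 * h" using assms dvd_diff_imp by blast
  obtain r where r: "int (phi i) = int i + xi * (2 * hp i) + 4 * xi^2 * ka i + 4 * P^3 * r"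
    using phi_cong dvd_diff_imp by blast
  obtain r' where r': "int (phi i') = int i' + xi * (2 * hp i') + 4 * xi^2 * ka i' + 4 * P^3 * r'"
    using phi_cong dvd_diff_imp by blast
  have "2 * P dvd int i - int i'" by (simp add: h power2_eq_square)
  then obtain k where k: "ka i = ka i' + P * k" using ka_cong dvd_diff_imp by blast
  obtain u' where u': "u = 2 * u' + 1" using odd by (elim oddE)
  have hh: "2 * hp i = 2 * hp i' + 2 * P^2 * h * (2 * int i' + 1) + 4 * P^4 * h^2"
    unfolding hp[symmetric] h by (simp add: algebra_simps power2_eq_square power4_eq_xxxx)
  have "(int (phi i) - int (phi i')) - (1 + P) * (int i - int i')
     = 4 * P^3 * (u * h * int i' + u' * h + u * P^2 * h^2 + u^2 * k + r - r')"
    unfolding r r' k hh h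
    by (simp add: u' poly_simps)
  then show ?thesis by (metis dvd_triv_left)
qed

lemma four_dvd: "4 dvd int al - 1" "4 dvd int be - 1"
  using P by (auto simp: al be)

text \<open>The difference of two values is a power of \<alpha> times a geometric sum, so the
  valuation of the sum is that of its length.\<close>

lemma phi_dvd_iff:
  assumes P2: "P = 2 ^ l"
  shows "2 * P^2 dvd int (phi i) - int (phi i') \<longleftrightarrow> 2 * P^2 dvd int i - int i'"
proof -
  have le: "2 * P^2 dvd int (phi (n + d)) - int (phi n) \<longleftrightarrow> 2 * P^2 dvd int d" for n d
  proof -
    have M: "2 * P^2 = 2 ^ (2 * l + 1)" by (simp add: P2 power_add power_mult mult.commute)
    have "int (phi (n + d)) - int (phi n) = int al ^ Suc n * geo (int al) d"
      unfolding phi_int geo_add by (simp add: algebra_simps)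
    moreover have "coprime (2 ^ (2 * l + 1)) (int al ^ Suc n)" by (simp add: al)
    ultimately have "2 * P^2 dvd int (phi (n + d)) - int (phi n) \<longleftrightarrow> 2 ^ (2 * l + 1) dvd geo (int al) d"
      unfolding M by (simp only: coprime_dvd_mult_right_iff)
    also have "\<dots> \<longleftrightarrow> (2::nat) ^ (2 * l + 1) dvd d" using two_power_dvd_geo_iff four_dvd by blast
    also have "\<dots> \<longleftrightarrow> 2 * P^2 dvd int d" unfolding M by (metis of_nat_dvd_iff of_nat_numeral of_nat_power)
    finally show ?thesis .
  qed
  show ?thesis
  proof (cases "i' \<le> i")
    case True
    then show ?thesis using le[of i' "i - i'"] by (simp add: of_nat_diff)
  next
    case False
    then show ?thesis using le[of i "i' - i"] by (simp add: of_nat_diff dvd_diff_commute)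
  qed
qed

lemma be_pow_cong:
  assumes "P = 2 ^ l" "2 * P^2 dvd int k - int k'"
  shows "4 * P^3 dvd int (be ^ k) - int (be ^ k')"
proof -
  have le: "4 * P^3 dvd int (be ^ (n + d)) - int (be ^ n)" if d: "2 * P^2 dvd int d" for n d
  proof -
    have M: "2 * P^2 = 2 ^ (2 * l + 1)" by (simp add: assms power_add power_mult mult.commute)
    have "(2::nat) ^ (2 * l + 1) dvd d" using d unfolding M by (metis of_nat_dvd_iff of_nat_numeral of_nat_power)
    then have "2 ^ (2 * l + 1) dvd geo (int be) d" using two_power_dvd_geo_iff four_dvd by blast
    then obtain g where g: "geo (int be) d = 2 * P^2 * g" unfolding M by blast
    have "int (be ^ (n + d)) - int (be ^ n) = int be ^ n * ((int be - 1) * geo (int be) d)"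
      unfolding geo_mult_eq by (simp add: power_add algebra_simps)
    also have "\<dots> = 4 * P^3 * (int be ^ n * v * g)"
      unfolding g by (simp add: be power2_eq_square power3_eq_cube)
    finally show ?thesis by (metis dvd_triv_left)
  qed
  show ?thesis
  proof (cases "k' \<le> k")
    case True
    then show ?thesis using le[of "k - k'" k'] assms by (simp add: of_nat_diff)
  next
    case False
    then show ?thesis using le[of "k' - k" k] assms by (simp add: of_nat_diff dvd_diff_commute)
  qed
qed

lemma stB_Theta_iff:
  assumes P2: "P = 2 ^ l"
  shows "Theta (stB p) = Theta (stB q) \<longleftrightarrow> Theta p = Theta q"
proof -
  obtain j k i j' k' i' where p: "p = (j, k, i)" and q: "q = (j', k', i')" by (cases p; cases q)
  let ?a = "int j - int j'" and ?b = "int k - int k'" and ?h = "int i - int i'"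
  let ?c = "int (be ^ k) - int (be ^ k')" and ?f = "int (phi i) - int (phi i')"
  have main: "(2 * P^2 dvd ?a + ?c \<and> 2 * P^2 dvd ?b + ?h \<and> 4 * P^3 dvd ?f + (P - 1) * (?a + ?c) + P * (?b + ?h))
      \<longleftrightarrow> (2 * P^2 dvd ?a \<and> 2 * P^2 dvd ?b \<and> 4 * P^3 dvd ?h + (P - 1) * ?a + P * ?b)"
    (is "?L \<longleftrightarrow> ?R")
  proof -
    have hb: "?L \<longleftrightarrow> ?R" if h: "2 * P^2 dvd ?h" and b: "2 * P^2 dvd ?b"
    proof -
      obtain c where c: "?c = 4 * P^3 * c" using be_pow_cong[OF P2 b] by blast
      have cM: "2 * P^2 dvd ?c" using be_pow_cong[OF P2 b] M_dvd_R dvd_trans by blast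
      obtain f where f: "?f = (1 + P) * ?h + 4 * P^3 * f" using phi_shift[OF h] dvd_diff_imp by blast
      obtain g where g: "?h = 2 * P^2 * g" using h by blast
      have e: "?f + (P - 1) * (?a + ?c) + P * (?b + ?h)
          = 4 * P^3 * (f + (P - 1) * c + g) + (?h + (P - 1) * ?a + P * ?b)"
      proof -
        have "2 * P * ?h = 4 * P^3 * g" unfolding g by (simp add: power2_eq_square power3_eq_cube)
        then show ?thesis unfolding f c by (simp add: algebra_simps)
      qed
      have "4 * P^3 dvd ?f + (P - 1) * (?a + ?c) + P * (?b + ?h) \<longleftrightarrow> 4 * P^3 dvd ?h + (P - 1) * ?a + P * ?b"
        unfolding e by (rule dvd_add_right_iff) simp
      moreover have "2 * P^2 dvd ?a + ?c \<longleftrightarrow> 2 * P^2 dvd ?a" using cM by (rule dvd_add_left_iff)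
      moreover have "2 * P^2 dvd ?b + ?h \<longleftrightarrow> 2 * P^2 dvd ?b" using h by (rule dvd_add_left_iff)
      ultimately show ?thesis by blast
    qed
    show ?thesis
    proof
      assume L: ?L
      then have "2 * P^2 dvd ?f" using Theta_dvd_third by blast
      then have h: "2 * P^2 dvd ?h" by (simp only: phi_dvd_iff[OF P2])
      moreover have "2 * P^2 dvd ?b" using L h dvd_add_left_iff by blast
      ultimately show ?R using hb L by blast
    next
      assume R: ?R
      then have "2 * P^2 dvd ?h" using Theta_dvd_third by blast
      then show ?L using hb R by blast
    qed
  qed
  have "int (j + be ^ k) - int (j' + be ^ k') = ?a + ?c" "int (k + i) - int (k' + i') = ?b + ?h" by simp_all
  then show ?thesis using main by (simp only: p q st_simps Theta_eq_iff)
qed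


text \<open>T need not be the exact period. The spare factor 4 over 4P^3 absorbs the denominators 2
  and 6, so that (T choose 2) and (T choose 3) are still multiples of 4P^3.\<close>

lemma stB_period:
  assumes P2: "P = 2 ^ l" and T: "int T = 16 * P^3"
  shows "Theta ((stB ^^ T) p) = Theta p"
proof -
  obtain j k i where p: "p = (j, k, i)" by (cases p)
  have c2: "int (T choose 2) = 4 * P^3 * (2 * (int T - 1))"
    using two_choose_two[of T] by (simp add: T)
  have "2 * (3 * int (T choose 3)) = 2 * (4 * P^3 * (2 * ((int T - 1) * (int T - 2))))"
    using six_choose_three[of T] by (simp add: T)
  then have "4 * P^3 dvd 3 * int (T choose 3)" by simp
  moreover have "coprime (4 * P^3) 3"
  proof -
    have "coprime ((2::int) ^ (3 * l + 2)) 3" unfolding coprime_power_left_iff by simp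
    moreover have "4 * P^3 = 2 ^ (3 * l + 2)" by (simp add: P2 power_add power_mult mult.commute)
    ultimately show ?thesis by simp
  qed
  ultimately have "4 * P^3 dvd int (T choose 3)" by (simp only: coprime_dvd_mult_right_iff)
  then obtain c3 where c3: "int (T choose 3) = 4 * P^3 * c3" by blast
  define c2' where "c2' = 2 * (int T - 1)"
  have c2: "int (T choose 2) = 4 * P^3 * c2'" using c2 by (simp add: c2'_def)
  have J: "4 * P^3 dvd int (jj T i)"
  proof -
    obtain c where c: "int (jj T i) = (int T + yy * (int (T choose 2) * int i + 2 * int (T choose 3) * xi * hp i)
     + yy^2 * (int (T choose 2) * int (i choose 2) + int (T choose 3) * (int i)^2)) + 4 * P^3 * c"
      using jj_cong dvd_diff_imp by blast
    have "int (jj T i) = 4 * P^3 * (4 + yy * (c2' * int i + 2 * c3 * xi * hp i)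
     + yy^2 * (c2' * int (i choose 2) + c3 * (int i)^2) + c)"
      unfolding c c2 c3 T by (simp add: algebra_simps)
    then show ?thesis by (metis dvd_triv_left)
  qed
  have Q: "4 * P^2 dvd int (qq T i)"
  proof -
    obtain c where c: "int (qq T i) = (int T * int i + 2 * int (T choose 2) * xi * hp i + 2 * int (T choose 3) * xi^2 * hp i) + 4 * P^2 * c"
      using qq_cong dvd_diff_imp by blast
    have "int (qq T i) = 4 * P^2 * (P * (4 * int i + 2 * c2' * xi * hp i + 2 * c3 * xi^2 * hp i) + c)"
      unfolding c c2 c3 T by (simp add: poly_simps)
    then show ?thesis by (metis dvd_triv_left)
  qed
  have I: "4 * P^3 dvd int (it T i) - int i"
  proof -
    obtain c where c: "int (it T i) = int i + 2 * xi * it_form T i + 4 * P^3 * c"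
      using it_cong dvd_diff_imp by blast
    have "it_form T i = 4 * P^3 * (4 * hp i + 8 * xi * ka i + c2' * xi * hp i * (2 * int i + 1) + c3 * xi^2 * hp i)"
      unfolding it_form_def c2 c3 T by (simp add: algebra_simps)
    then have "int (it T i) - int i = 4 * P^3 * (2 * xi * (4 * hp i + 8 * xi * ka i + c2' * xi * hp i * (2 * int i + 1) + c3 * xi^2 * hp i) + c)"
      unfolding c by (simp add: algebra_simps)
    then show ?thesis by (metis dvd_triv_left)
  qed
  have "4 * P^3 dvd P * int (qq T i)"
  proof -
    have "P * (4 * P^2) dvd P * int (qq T i)" using Q by (intro mult_dvd_mono) simp_all
    then show ?thesis by (simp add: power2_eq_square power3_eq_cube mult.left_commute)
  qed
  moreover have "2 * P^2 dvd int (jj T i)" using J M_dvd_R dvd_trans by blast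
  moreover have "2 * P^2 dvd int (qq T i)" using Q by (rule dvd_trans[rotated]) simp
  ultimately show ?thesis using J I by (simp add: p stB_funpow Theta_eq_iff)
qed

lemma stA_period:
  assumes "int T = 16 * P^3"
  shows "Theta ((stA ^^ T) p) = Theta p"
  by (cases p) (simp add: stA_funpow Theta_eq_iff assms)

end

text \<open>From right to left the equivalence makes the induced map on the values of \<Theta> well
  defined, from left to right it makes it injective; on a finite range it is then a
  permutation.\<close>

definition respects_fibres :: "('p \<Rightarrow> 'o) \<Rightarrow> ('p \<Rightarrow> 'p) \<Rightarrow> bool" where
  "respects_fibres \<Theta> f \<longleftrightarrow> (\<forall>p q. \<Theta> (f p) = \<Theta> (f q) \<longleftrightarrow> \<Theta> p = \<Theta> q)"

definition lift_map :: "('p \<Rightarrow> 'o) \<Rightarrow> ('p \<Rightarrow> 'p) \<Rightarrow> 'o \<Rightarrow> 'o" where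
  "lift_map \<Theta> f = (\<lambda>x\<in>range \<Theta>. \<Theta> (f (inv_into UNIV \<Theta> x)))"

lemma lift_map_apply:
  assumes "respects_fibres \<Theta> f"
  shows "lift_map \<Theta> f (\<Theta> p) = \<Theta> (f p)"
proof -
  have "\<Theta> (inv_into UNIV \<Theta> (\<Theta> p)) = \<Theta> p" by (simp add: f_inv_into_f)
  then show ?thesis using assms by (simp add: lift_map_def respects_fibres_def)
qed

lemma lift_map_Bij:
  assumes f: "respects_fibres \<Theta> f" and fin: "finite (range \<Theta>)"
  shows "lift_map \<Theta> f \<in> carrier (BijGroup (range \<Theta>))"
proof -
  have "inj_on (lift_map \<Theta> f) (range \<Theta>)"
    by (rule inj_onI) (use f in \<open>auto simp: lift_map_apply[OF f] respects_fibres_def\<close>)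
  moreover have "lift_map \<Theta> f ` range \<Theta> \<subseteq> range \<Theta>" by (auto simp: lift_map_apply[OF f])
  ultimately have "bij_betw (lift_map \<Theta> f) (range \<Theta>) (range \<Theta>)"
    using endo_inj_surj[OF fin] unfolding bij_betw_def by blast
  then show ?thesis by (simp add: BijGroup_def Bij_def lift_map_def)
qed

lemma BijGroup_eqI:
  assumes "f \<in> carrier (BijGroup (range \<Theta>))" "g \<in> carrier (BijGroup (range \<Theta>))" "\<And>p. f (\<Theta> p) = g (\<Theta> p)"
  shows "f = g"
  by (rule extensionalityI[of _ "range \<Theta>"]) (use assms in \<open>auto simp: BijGroup_def Bij_def\<close>)

lemma BijGroup_mult_apply:
  assumes "f \<in> carrier (BijGroup S)" "g \<in> carrier (BijGroup S)" "x \<in> S"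
  shows "(f \<otimes>\<^bsub>BijGroup S\<^esub> g) x = f (g x)"
  using assms by (simp add: BijGroup_def compose_def)

lemma lift_map_pow_apply:
  fixes n :: nat
  assumes f: "respects_fibres \<Theta> f" and fin: "finite (range \<Theta>)"
  shows "(lift_map \<Theta> f [^]\<^bsub>BijGroup (range \<Theta>)\<^esub> n) (\<Theta> p) = \<Theta> ((f ^^ n) p)"
proof (induction n arbitrary: p)
  case 0
  then show ?case by (simp add: BijGroup_def)
next
  case (Suc n)
  interpret group "BijGroup (range \<Theta>)" by (rule group_BijGroup)
  have c: "lift_map \<Theta> f \<in> carrier (BijGroup (range \<Theta>))" by (rule lift_map_Bij[OF f fin])
  have "(lift_map \<Theta> f [^]\<^bsub>BijGroup (range \<Theta>)\<^esub> Suc n) (\<Theta> p)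
      = (lift_map \<Theta> f [^]\<^bsub>BijGroup (range \<Theta>)\<^esub> n) (lift_map \<Theta> f (\<Theta> p))"
    using c by (simp add: BijGroup_mult_apply)
  then show ?case by (simp add: lift_map_apply[OF f] Suc funpow_swap1)
qed

context macd_model
begin

abbreviation perms :: "(int \<times> int \<times> int \<Rightarrow> int \<times> int \<times> int) monoid" where
  "perms \<equiv> BijGroup (range Theta)"

text \<open>The function f inverts a permutation and applies it to the base point
  \<open>Theta (0, 0, 0)\<close>. It recovers (j, k, i) up to fibres and so separates normal forms
  without any knowledge of the group that x and y generate.\<close>

lemma model_group:
  assumes P2: "P = 2 ^ l"
  shows "\<exists>x y c. macd perms x y c (int al) (int be)
     \<and> x [^]\<^bsub>perms\<^esub> nat (16 * P^3) = \<one>\<^bsub>perms\<^esub>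
     \<and> y [^]\<^bsub>perms\<^esub> nat (16 * P^3) = \<one>\<^bsub>perms\<^esub>
     \<and> (\<exists>f. \<forall>(j::nat) (k::nat) (i::nat). f (y [^]\<^bsub>perms\<^esub> j
           \<otimes>\<^bsub>perms\<^esub> (c [^]\<^bsub>perms\<^esub> k \<otimes>\<^bsub>perms\<^esub> x [^]\<^bsub>perms\<^esub> i))
         = Theta (j, k, i))"
proof -
  let ?G = perms
  interpret group ?G by (rule group_BijGroup)
  have fin: "finite (range Theta)" unfolding range_theta[OF P(1)] by simp
  let ?l = "lift_map Theta"
  have iff: "respects_fibres Theta stA" "respects_fibres Theta stB" "respects_fibres Theta stC"
    unfolding respects_fibres_def using stA_Theta_iff stB_Theta_iff[OF P2] stC_Theta_iff by blast+
  have cl [simp]: "?l stA \<in> carrier ?G" "?l stB \<in> carrier ?G" "?l stC \<in> carrier ?G"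
    by (rule lift_map_Bij[OF _ fin], rule iff)+
  have ap: "?l stA (Theta p) = Theta (stA p)" "?l stB (Theta p) = Theta (stB p)" "?l stC (Theta p) = Theta (stC p)" for p
    by (rule lift_map_apply, rule iff)+
  have pw: "(?l stA [^]\<^bsub>?G\<^esub> n) (Theta p) = Theta ((stA ^^ n) p)" "(?l stB [^]\<^bsub>?G\<^esub> n) (Theta p) = Theta ((stB ^^ n) p)"
    "(?l stC [^]\<^bsub>?G\<^esub> n) (Theta p) = Theta ((stC ^^ n) p)" for p and n :: nat
    by (rule lift_map_pow_apply[OF _ fin], rule iff)+
  \<comment> \<open>the maps act from the right, so products are reversed\<close>
  define x y c where "x = inv\<^bsub>?G\<^esub> ?l stA" and "y = inv\<^bsub>?G\<^esub> ?l stB" and "c = inv\<^bsub>?G\<^esub> ?l stC"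
  have xyc [simp]: "x \<in> carrier ?G" "y \<in> carrier ?G" "c \<in> carrier ?G" by (simp_all add: x_def y_def c_def)
  have 1: "?l stC \<otimes>\<^bsub>?G\<^esub> ?l stA = ?l stA [^]\<^bsub>?G\<^esub> al \<otimes>\<^bsub>?G\<^esub> ?l stC"
    by (rule BijGroup_eqI[of _ Theta]) (simp_all add: BijGroup_mult_apply ap pw stC_stA)
  have 2: "?l stB \<otimes>\<^bsub>?G\<^esub> ?l stC = ?l stC \<otimes>\<^bsub>?G\<^esub> ?l stB [^]\<^bsub>?G\<^esub> be"
    by (rule BijGroup_eqI[of _ Theta]) (simp_all add: BijGroup_mult_apply ap pw stB_stC)
  have 3: "?l stB \<otimes>\<^bsub>?G\<^esub> ?l stA = ?l stC \<otimes>\<^bsub>?G\<^esub> (?l stA \<otimes>\<^bsub>?G\<^esub> ?l stB)"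
    by (rule BijGroup_eqI[of _ Theta]) (simp_all add: BijGroup_mult_apply ap stB_stA)
  have "macd ?G x y c (int al) (int be)"
  proof
    have "x \<otimes>\<^bsub>?G\<^esub> c = inv\<^bsub>?G\<^esub> (?l stC \<otimes>\<^bsub>?G\<^esub> ?l stA)" by (simp add: x_def c_def inv_mult_group)
    also have "\<dots> = c \<otimes>\<^bsub>?G\<^esub> x [^]\<^bsub>?G\<^esub> int al"
      unfolding 1 by (simp add: x_def c_def inv_mult_group int_pow_int nat_pow_inv)
    finally show "x \<otimes>\<^bsub>?G\<^esub> c = c \<otimes>\<^bsub>?G\<^esub> x [^]\<^bsub>?G\<^esub> int al" .
    have "c \<otimes>\<^bsub>?G\<^esub> y = inv\<^bsub>?G\<^esub> (?l stB \<otimes>\<^bsub>?G\<^esub> ?l stC)" by (simp add: y_def c_def inv_mult_group)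
    also have "\<dots> = y [^]\<^bsub>?G\<^esub> int be \<otimes>\<^bsub>?G\<^esub> c"
      unfolding 2 by (simp add: y_def c_def inv_mult_group int_pow_int nat_pow_inv)
    finally show "c \<otimes>\<^bsub>?G\<^esub> y = y [^]\<^bsub>?G\<^esub> int be \<otimes>\<^bsub>?G\<^esub> c" .
    have "x \<otimes>\<^bsub>?G\<^esub> y = inv\<^bsub>?G\<^esub> (?l stB \<otimes>\<^bsub>?G\<^esub> ?l stA)" by (simp add: x_def y_def inv_mult_group)
    also have "\<dots> = y \<otimes>\<^bsub>?G\<^esub> x \<otimes>\<^bsub>?G\<^esub> c"
      unfolding 3 by (simp add: x_def y_def c_def inv_mult_group m_assoc)
    finally show "x \<otimes>\<^bsub>?G\<^esub> y = y \<otimes>\<^bsub>?G\<^esub> x \<otimes>\<^bsub>?G\<^esub> c" .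
  qed simp_all
  moreover have T: "int (nat (16 * P^3)) = 16 * P^3" using P by simp
  have "?l stA [^]\<^bsub>?G\<^esub> nat (16 * P^3) = \<one>\<^bsub>?G\<^esub>" "?l stB [^]\<^bsub>?G\<^esub> nat (16 * P^3) = \<one>\<^bsub>?G\<^esub>"
    by (rule BijGroup_eqI[of _ Theta]; simp add: pw stA_period[OF T] stB_period[OF P2 T]; simp add: BijGroup_def)+
  then have "x [^]\<^bsub>?G\<^esub> nat (16 * P^3) = \<one>\<^bsub>?G\<^esub>" "y [^]\<^bsub>?G\<^esub> nat (16 * P^3) = \<one>\<^bsub>?G\<^esub>"
    by (simp_all add: x_def y_def nat_pow_inv)
  moreover have "(inv\<^bsub>?G\<^esub> (y [^]\<^bsub>?G\<^esub> j \<otimes>\<^bsub>?G\<^esub> (c [^]\<^bsub>?G\<^esub> k \<otimes>\<^bsub>?G\<^esub> x [^]\<^bsub>?G\<^esub> i))) (Theta (0, 0, 0)) = Theta (j, k, i)"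
    for j k i :: nat
  proof -
    have "inv\<^bsub>?G\<^esub> (y [^]\<^bsub>?G\<^esub> j \<otimes>\<^bsub>?G\<^esub> (c [^]\<^bsub>?G\<^esub> k \<otimes>\<^bsub>?G\<^esub> x [^]\<^bsub>?G\<^esub> i))
        = ?l stA [^]\<^bsub>?G\<^esub> i \<otimes>\<^bsub>?G\<^esub> (?l stC [^]\<^bsub>?G\<^esub> k \<otimes>\<^bsub>?G\<^esub> ?l stB [^]\<^bsub>?G\<^esub> j)"
      by (simp add: x_def y_def c_def inv_mult_group nat_pow_inv m_assoc)
    then show ?thesis
      by (simp add: BijGroup_mult_apply pw stB_funpow_0 stC_funpow_0 stA_funpow)
  qed
  ultimately show ?thesis by (intro exI[of _ x] exI[of _ y] exI[of _ c] conjI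
        exI[of _ "\<lambda>g. (inv\<^bsub>?G\<^esub> g) (Theta (0, 0, 0))"]) auto
qed

end

section \<open>The model on the given element type\<close>

lemma finite_BijGroup: "finite S \<Longrightarrow> finite (carrier (BijGroup S))"
proof -
  assume "finite S"
  moreover have "carrier (BijGroup S) \<subseteq> (\<Pi>\<^sub>E x\<in>S. S)"
    by (auto simp: BijGroup_def Bij_def PiE_def bij_betw_def)
  ultimately show ?thesis by (meson finite_PiE finite_subset)
qed

text \<open>The universal property in \<open>presents_G\<close> tests only groups on one element
  type, whereas the permutations live on integer triples. An infinite type has room for a copy of
  any finite group.\<close>

lemma finite_group_copy:
  fixes K :: "'b monoid"
  assumes "infinite (UNIV :: 'a set)" "group K" "finite (carrier K)"
  shows "\<exists>(H :: 'a monoid) h. group_hom K H h \<and> inj_on h (carrier K)"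
proof -
  obtain S :: "'a set" where "finite S" "card S = card (carrier K)"
    using infinite_arbitrarily_large[OF assms(1)] by blast
  then obtain h :: "'b \<Rightarrow> 'a" where h: "bij_betw h (carrier K) S"
    using finite_same_card_bij[OF assms(3)] by metis
  then have inj: "inj_on h (carrier K)" by (simp add: bij_betw_def)
  interpret K: group K by (rule assms)
  have "group (image_group h K)" "h \<in> hom K (image_group h K)"
    using K.inj_imp_image_group_is_group[OF inj] inj_imp_image_group_iso[OF inj] by (auto simp: iso_def)
  then show ?thesis using inj assms(2) by (auto simp: group_hom_def group_hom_axioms_def)
qed

lemma model_exists:
  fixes \<alpha> \<beta> u v w :: int and m :: nat
  assumes inf: "infinite (UNIV :: 'a set)" and m: "m > 1" and odd: "odd u" "odd v" "odd w"
    and al: "\<alpha> = 1 + 2 ^ m * u" and be: "\<beta> = 1 + 2 ^ m * v" and uv: "\<alpha> - \<beta> = 2 ^ (2 * m - 1) * w"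
  shows "\<exists>(H :: 'a monoid) x y c f. macd H x y c \<alpha> \<beta>
     \<and> x [^]\<^bsub>H\<^esub> (2 ^ (3 * m + 1) :: nat) = \<one>\<^bsub>H\<^esub> \<and> y [^]\<^bsub>H\<^esub> (2 ^ (3 * m + 1) :: nat) = \<one>\<^bsub>H\<^esub>
     \<and> (\<forall>(j::nat) (k::nat) (i::nat). f (y [^]\<^bsub>H\<^esub> j \<otimes>\<^bsub>H\<^esub> (c [^]\<^bsub>H\<^esub> k \<otimes>\<^bsub>H\<^esub> x [^]\<^bsub>H\<^esub> i))
         = theta (2 ^ (m - 1)) (j, k, i))"
proof -
  obtain l where l: "m = Suc l" using m by (cases m) auto
  define P :: int where "P = 2 ^ (m - 1)"
  have Pl: "P = 2 ^ l" by (simp add: P_def l)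
  have m2: "(2::int) ^ m = 2 * P" by (simp add: Pl l)
  have m21: "(2::int) ^ (2 * m - 1) = 2 * P * P" by (simp add: Pl l power_add[symmetric])
  have T: "(2::int) ^ (3 * m + 1) = 16 * P^3" by (simp add: Pl l power_add power_mult[symmetric] mult.commute numeral_eq_Suc)
  have P0: "P > 0" by (simp add: Pl)
  \<comment> \<open>Modulo 16P^3, a common period of A and B in the model, \<alpha> and \<beta>
    become natural numbers; u', v', w' are the cofactors shifted accordingly, with parities
    unchanged.\<close>
  define al be where "al = nat (\<alpha> mod (16 * P^3))" and "be = nat (\<beta> mod (16 * P^3))"
  define u' v' w' where "u' = u - 8 * P^2 * (\<alpha> div (16 * P^3))" and "v' = v - 8 * P^2 * (\<beta> div (16 * P^3))"
    and "w' = w - 8 * P * (\<alpha> div (16 * P^3) - \<beta> div (16 * P^3))"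
  have T0: "16 * P^3 > 0" using P0 by simp
  have al': "int al = \<alpha> - 16 * P^3 * (\<alpha> div (16 * P^3))" and be': "int be = \<beta> - 16 * P^3 * (\<beta> div (16 * P^3))"
    using T0 by (simp_all add: al_def be_def minus_mult_div_eq_mod)
  have uvw: "u - v = P * w"
  proof -
    have "2 * P * (u - v) = 2 * P * (P * w)" using uv unfolding al be m2 m21 by (simp add: algebra_simps)
    then show ?thesis using P0 by simp
  qed
  interpret M: macd_model P u' v' w' al be
  proof
    show "0 < P" by (rule P0)
    show "even P" using m by (simp add: P_def)
    show "coprime P 3" unfolding Pl coprime_power_left_iff by simp
    show "odd u'" "odd v'" "odd w'" using odd by (simp_all add: u'_def v'_def w'_def)
    show "int al = 1 + 2 * P * u'" "int be = 1 + 2 * P * v'"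
      unfolding al' be' u'_def v'_def using al be by (simp_all add: m2 poly_simps)
    show "v' = u' - P * w'"
      using uvw by (simp add: u'_def v'_def w'_def algebra_simps power2_eq_square)
  qed
  let ?K = "BijGroup (range (theta P))"
  obtain x y c f where K: "macd ?K x y c (int al) (int be)"
    and xT: "x [^]\<^bsub>?K\<^esub> nat (16 * P^3) = \<one>\<^bsub>?K\<^esub>" and yT: "y [^]\<^bsub>?K\<^esub> nat (16 * P^3) = \<one>\<^bsub>?K\<^esub>"
    and f: "\<And>(j::nat) (k::nat) (i::nat). f (y [^]\<^bsub>?K\<^esub> j \<otimes>\<^bsub>?K\<^esub> (c [^]\<^bsub>?K\<^esub> k \<otimes>\<^bsub>?K\<^esub> x [^]\<^bsub>?K\<^esub> i)) = theta P (j, k, i)"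
    using M.model_group[OF Pl] by blast
  interpret K: macd ?K x y c "int al" "int be" by (rule K)
  have ox: "int (K.ord x) dvd 16 * P^3" "int (K.ord y) dvd 16 * P^3"
  proof -
    have "int (K.ord x) dvd int (nat (16 * P^3))" "int (K.ord y) dvd int (nat (16 * P^3))"
      using xT yT by (simp_all only: K.pow_eq_id K.A_closed K.B_closed of_nat_dvd_iff)
    then show "int (K.ord x) dvd 16 * P^3" "int (K.ord y) dvd 16 * P^3" using T0 by simp_all
  qed
  have K': "macd ?K x y c \<alpha> \<beta>"
    by (rule K.macd_cong) (use ox in \<open>auto simp: al' be' intro: dvd_mult2\<close>)
  have fin: "finite (carrier ?K)" by (intro finite_BijGroup) (simp add: range_theta[OF P0])
  obtain H :: "'a monoid" and h where h: "group_hom ?K H h" "inj_on h (carrier ?K)"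
    using finite_group_copy[OF inf K.is_group fin] by blast
  interpret h: group_hom ?K H h by (rule h)
  have nT: "nat (16 * P^3) = 2 ^ (3 * m + 1)"
  proof -
    have "int (nat (16 * P^3)) = int (2 ^ (3 * m + 1))" using T T0 by simp
    then show ?thesis by (simp only: of_nat_eq_iff)
  qed
  show ?thesis
  proof (intro exI conjI allI)
    show "macd H (h x) (h y) (h c) \<alpha> \<beta>" by (rule macd.hom_image[OF K' h(1)])
    have "h (x [^]\<^bsub>?K\<^esub> nat (16 * P^3)) = \<one>\<^bsub>H\<^esub>" "h (y [^]\<^bsub>?K\<^esub> nat (16 * P^3)) = \<one>\<^bsub>H\<^esub>"
      unfolding xT yT by simp_all
    then show "h x [^]\<^bsub>H\<^esub> (2 ^ (3 * m + 1) :: nat) = \<one>\<^bsub>H\<^esub>" "h y [^]\<^bsub>H\<^esub> (2 ^ (3 * m + 1) :: nat) = \<one>\<^bsub>H\<^esub>"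
      unfolding nT by (simp_all only: h.hom_nat_pow K.A_closed K.B_closed)
    fix j k i :: nat
    let ?g = "y [^]\<^bsub>?K\<^esub> j \<otimes>\<^bsub>?K\<^esub> (c [^]\<^bsub>?K\<^esub> k \<otimes>\<^bsub>?K\<^esub> x [^]\<^bsub>?K\<^esub> i)"
    have "h y [^]\<^bsub>H\<^esub> j \<otimes>\<^bsub>H\<^esub> (h c [^]\<^bsub>H\<^esub> k \<otimes>\<^bsub>H\<^esub> h x [^]\<^bsub>H\<^esub> i) = h ?g"
      by (simp add: h.hom_nat_pow)
    moreover have "inv_into (carrier ?K) h (h ?g) = ?g" by (rule inv_into_f_f[OF h(2)]) simp
    ultimately show "(f \<circ> inv_into (carrier ?K) h) (h y [^]\<^bsub>H\<^esub> j \<otimes>\<^bsub>H\<^esub> (h c [^]\<^bsub>H\<^esub> k \<otimes>\<^bsub>H\<^esub> h x [^]\<^bsub>H\<^esub> i))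
        = theta (2 ^ (m - 1)) (j, k, i)"
      using f by (simp add: P_def)
  qed
qed

section \<open>The 2-elements as a direct factor\<close>

context group
begin

lemma subgroup_pow_card:
  assumes "subgroup H G" "x \<in> H"
  shows "x [^] card H = \<one>"
proof -
  interpret H: group "G\<lparr>carrier := H\<rparr>" by (rule subgroup_imp_group) fact
  have "x [^]\<^bsub>G\<lparr>carrier := H\<rparr>\<^esub> Coset.order (G\<lparr>carrier := H\<rparr>) = \<one>\<^bsub>G\<lparr>carrier := H\<rparr>\<^esub>"
    by (rule H.pow_order_eq_1) (use assms in simp)
  then show ?thesis by (simp add: Coset.order_def flip: nat_pow_consistent)
qed

lemma ord_subgroup:
  assumes "subgroup H G" "x \<in> H"
  shows "group.ord (G\<lparr>carrier := H\<rparr>) x = ord x"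
proof -
  interpret H: group "G\<lparr>carrier := H\<rparr>" by (rule subgroup_imp_group) fact
  have x: "x \<in> carrier G" using assms subgroup.subset by blast
  have "\<forall>n. x [^]\<^bsub>G\<lparr>carrier := H\<rparr>\<^esub> n = \<one>\<^bsub>G\<lparr>carrier := H\<rparr>\<^esub> \<longleftrightarrow> ord x dvd n" for n :: nat
    using x by (simp add: pow_eq_id flip: nat_pow_consistent)
  then show ?thesis using assms H.ord_unique[of x "ord x"] by simp
qed

text \<open>An element of both S and R has order a power of 2 and odd, so it is trivial.
  Decompositions are therefore unique, as the definite description in \<open>proj2\<close>
  requires.\<close>

lemma two_decomposition:
  assumes S: "subgroup S G" and R: "subgroup R G"
    and comm: "\<And>s t. s \<in> S \<Longrightarrow> t \<in> R \<Longrightarrow> s \<otimes> t = t \<otimes> s"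
    and dec: "\<And>g. g \<in> carrier G \<Longrightarrow> \<exists>s\<in>S. \<exists>t\<in>R. g = s \<otimes> t"
    and two: "\<And>s. s \<in> S \<Longrightarrow> \<exists>n::nat. ord s = 2 ^ n" and odd: "\<And>t. t \<in> R \<Longrightarrow> odd (ord t)"
  shows "sylow2_set G = S" "\<And>s t. s \<in> S \<Longrightarrow> t \<in> R \<Longrightarrow> proj2 G (s \<otimes> t) = s"
proof -
  have Sc: "s \<in> carrier G" if "s \<in> S" for s using that S subgroup.subset by blast
  have Rc: "t \<in> carrier G" if "t \<in> R" for t using that R subgroup.subset by blast
  have int: "x = \<one>" if "x \<in> S" "x \<in> R" for x
  proof -
    obtain n :: nat where n: "ord x = 2 ^ n" using two \<open>x \<in> S\<close> by blast
    moreover have "odd (ord x)" using odd that by blast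
    ultimately have "ord x = 1" by (cases n) auto
    then show ?thesis using ord_eq_1 Sc that by blast
  qed
  have pw: "s [^] n = \<one> \<and> t [^] n = \<one>" if st: "s \<in> S" "t \<in> R" and eq: "(s \<otimes> t) [^] n = \<one>" for s t and n :: nat
  proof -
    have "s [^] n \<otimes> t [^] n = \<one>" using eq pow_mult_distrib[OF comm[OF st]] Sc Rc st by simp
    then have i: "inv (t [^] n) = s [^] n" using Sc Rc st by (simp add: inv_equality)
    have "t [^] n \<in> R" "s [^] n \<in> S"
      using st subgroup_int_pow_closed[OF R, of t "int n"] subgroup_int_pow_closed[OF S, of s "int n"]
      by (simp_all add: int_pow_int)
    then have "s [^] n = \<one>" using int i R subgroup.m_inv_closed by metis
    then show ?thesis using i Rc st by simp
  qed
  show syl: "sylow2_set G = S"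
  proof (intro equalityI subsetI)
    fix g assume "g \<in> sylow2_set G"
    then obtain n :: nat where g: "g \<in> carrier G" "ord g = 2 ^ n" by (auto simp: sylow2_set_def)
    obtain s t where st: "s \<in> S" "t \<in> R" "g = s \<otimes> t" using dec g by blast
    have "g [^] (2 ^ n :: nat) = \<one>" using g pow_ord_eq_1[of g] by simp
    then have "t [^] (2 ^ n :: nat) = \<one>" using pw st by blast
    then have "ord t dvd 2 ^ n" using st Rc by (simp add: pow_eq_id)
    then obtain k where "ord t = 2 ^ k" using divides_primepow_nat[of 2 "ord t" n] by auto
    then have "ord t = 1" using odd[OF st(2)] by (cases k) auto
    then have "t = \<one>" using ord_eq_1 Rc st by blast
    then show "g \<in> S" using st Sc by simp
  next
    fix g assume "g \<in> S"
    then show "g \<in> sylow2_set G" using two Sc by (auto simp: sylow2_set_def)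
  qed
  have oddR: "h \<in> R" if "h \<in> odd_set G" for h
  proof -
    have h: "h \<in> carrier G" "odd (ord h)" using that by (auto simp: odd_set_def)
    obtain s t where st: "s \<in> S" "t \<in> R" "h = s \<otimes> t" using dec h by blast
    have "s [^] ord h = \<one>" using pw[of s t "ord h"] st h by auto
    then have "ord s dvd ord h" using st Sc by (simp add: pow_eq_id)
    moreover obtain n :: nat where n: "ord s = 2 ^ n" using two st by blast
    ultimately have "ord s = 1" using h(2) by (cases n) auto
    then have "s = \<one>" using ord_eq_1 Sc st by blast
    then show ?thesis using st Rc by simp
  qed
  fix s t assume st: "s \<in> S" "t \<in> R"
  show "proj2 G (s \<otimes> t) = s"
    unfolding proj2_def syl
  proof (rule the_equality)
    show "s \<in> S \<and> (\<exists>h\<in>odd_set G. s \<otimes> t = s \<otimes> h)" using st odd Rc by (auto simp: odd_set_def)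
    fix p assume p: "p \<in> S \<and> (\<exists>h\<in>odd_set G. s \<otimes> t = p \<otimes> h)"
    then obtain h where h: "h \<in> R" "s \<otimes> t = p \<otimes> h" using oddR by blast
    have c: "s \<in> carrier G" "t \<in> carrier G" "p \<in> carrier G" "h \<in> carrier G" using st p h Sc Rc by auto
    have "inv p \<otimes> (s \<otimes> t) \<otimes> inv t = inv p \<otimes> (p \<otimes> h) \<otimes> inv t" by (simp only: h(2))
    then have e: "inv p \<otimes> s = h \<otimes> inv t" using c by (simp add: m_assoc)
    moreover have "inv p \<otimes> s \<in> S" using p st S by (simp add: subgroup.m_closed subgroup.m_inv_closed)
    moreover have "h \<otimes> inv t \<in> R" using h st R by (simp add: subgroup.m_closed subgroup.m_inv_closed)
    ultimately have "inv p \<otimes> s = \<one>" using int by simp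
    then show "p = s" using c by (metis inv_equality inv_inv inv_closed)
  qed
qed

text \<open>Chinese remainders: e is 1 modulo 2^a and 0 modulo the odd part r, and f the reverse, so
  g^e and g^f are the 2-part and the odd part of g. The freely prescribed L makes e act as 1 also on
  the 2-elements of another group.\<close>

lemma two_part_exponents:
  assumes fin: "finite (carrier G)"
  shows "\<exists>(a::nat) (r::nat) (e::nat) (f::nat). L \<le> a \<and> odd r \<and> [e = 1] (mod 2 ^ a) \<and>
    (\<forall>g\<in>carrier G. g = g [^] e \<otimes> g [^] f \<and> (g [^] e) [^] (2 ^ a :: nat) = \<one> \<and> (g [^] f) [^] r = \<one>)"
proof -
  have "Coset.order G \<noteq> 0" using fin order_gt_0_iff_finite by simp
  then obtain r where "Coset.order G = 2 ^ multiplicity 2 (Coset.order G) * r" "\<not> 2 dvd r"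
    using multiplicity_decompose'[of "Coset.order G" 2] by auto
  then obtain n where r: "Coset.order G = 2 ^ n * r" "\<not> 2 dvd r" by blast
  define a where "a = n + L"
  have N: "Coset.order G dvd 2 ^ a * r" unfolding r(1) a_def power_add by simp
  have cop: "coprime (2 ^ a) r" using r(2) by simp
  obtain e where e: "[e = 1] (mod 2 ^ a)" "[e = 0] (mod r)" using binary_chinese_remainder_nat[OF cop] by blast
  obtain f where f: "[f = 0] (mod 2 ^ a)" "[f = 1] (mod r)" using binary_chinese_remainder_nat[OF cop] by blast
  have "[e + f = 1 + 0] (mod 2 ^ a)" "[e + f = 0 + 1] (mod r)"
    by (rule cong_add[OF e(1) f(1)]) (rule cong_add[OF e(2) f(2)])
  then have ef: "[e + f = 1] (mod 2 ^ a * r)" using coprime_cong_mult_nat[OF _ _ cop] by simp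
  have re: "r dvd e" and af: "2 ^ a dvd f" using e f by (simp_all add: cong_0_iff)
  have "g = g [^] e \<otimes> g [^] f \<and> (g [^] e) [^] (2 ^ a :: nat) = \<one> \<and> (g [^] f) [^] r = \<one>" if g: "g \<in> carrier G" for g
  proof -
    have o: "ord g dvd 2 ^ a * r" using ord_dvd_group_order[OF g] N dvd_trans by blast
    have "[int (e + f) = int 1] (mod int (2 ^ a * r))" using ef by (simp only: cong_int_iff)
    then have "int (2 ^ a * r) dvd int (e + f) - int 1" by (simp only: cong_iff_dvd_diff)
    moreover have "int (ord g) dvd int (2 ^ a * r)" using o by (simp only: of_nat_dvd_iff)
    ultimately have "int (ord g) dvd int (e + f) - 1" using dvd_trans by fastforce
    then have "g [^] (1::int) = g [^] int (e + f)" using g by (simp only: int_pow_eq)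
    then have "g = g [^] (e + f)" using g by (simp only: int_pow_1 int_pow_int)
    then have 1: "g = g [^] e \<otimes> g [^] f" using g by (simp add: nat_pow_mult)
    have "2 ^ a * r dvd e * 2 ^ a" "2 ^ a * r dvd f * r" using re af by (simp_all add: mult.commute mult_dvd_mono)
    then have "ord g dvd e * 2 ^ a" "ord g dvd f * r" using o dvd_trans by blast+
    then show ?thesis using 1 g by (simp add: nat_pow_pow pow_eq_id)
  qed
  then show ?thesis using e(1) r(2) a_def by (intro exI[of _ a] exI[of _ r] exI[of _ e] exI[of _ f]) auto
qed

lemma lcs_trivial_mono:
  assumes "lcs G k = {\<one>}" "k \<le> l" shows "lcs G l = {\<one>}"
  using assms(2,1)
proof (induction rule: dec_induct)
  case (step n)
  have n: "lcs G n = {\<one>}" by (rule step.IH[OF step.prems])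
  have "{gcomm G x y | x y. x \<in> lcs G n \<and> y \<in> carrier G} \<subseteq> {\<one>}"
  proof
    fix z assume "z \<in> {gcomm G x y | x y. x \<in> lcs G n \<and> y \<in> carrier G}"
    then obtain y where "z = gcomm G \<one> y" "y \<in> carrier G" unfolding n by blast
    then show "z \<in> {\<one>}" by (simp add: gcomm_def)
  qed
  then have "lcs G (Suc n) \<subseteq> {\<one>}"
    unfolding lcs.simps by (rule generate_subgroup_incl[OF _ triv_subgroup])
  moreover have "\<one> \<in> lcs G (Suc n)" by (simp add: lcs.simps generate.one)
  ultimately show ?case by blast
qed simp

end

section \<open>Splitting off the 2-part\<close>

text \<open>C acts on A^e and B^e exactly as the smaller commutator does, because D commutes with
  both and cancels.\<close>

lemma (in macd) commuting_factor:
  fixes e :: nat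
  assumes D: "D \<in> carrier G" "C = gcomm G (A [^] e) (B [^] e) \<otimes> D"
    "A [^] e \<otimes> D = D \<otimes> A [^] e" "B [^] e \<otimes> D = D \<otimes> B [^] e"
  shows "macd G (A [^] e) (B [^] e) (gcomm G (A [^] e) (B [^] e)) \<alpha> \<beta>"
proof -
  let ?A = "A [^] e" and ?B = "B [^] e" and ?C = "gcomm G (A [^] e) (B [^] e)"
  have cl: "?A \<in> carrier G" "?B \<in> carrier G" "?C \<in> carrier G" by simp_all
  have pA: "?A [^] \<alpha> \<otimes> D = D \<otimes> ?A [^] \<alpha>" and pB: "?B [^] \<beta> \<otimes> D = D \<otimes> ?B [^] \<beta>"
    using commute_pow D cl by blast+
  have "?A \<otimes> C = C \<otimes> ?A [^] \<alpha>"
    using A_pow_C[of "int e" 1] by (simp add: int_pow_pow flip: int_pow_int)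
  then have "?A \<otimes> ?C \<otimes> D = ?C \<otimes> ?A [^] \<alpha> \<otimes> D"
    unfolding D(2) using D(1) cl by (simp add: m_assoc pA)
  then have 1: "?A \<otimes> ?C = ?C \<otimes> ?A [^] \<alpha>" using D(1) cl by simp
  have "C \<otimes> ?B = ?B [^] \<beta> \<otimes> C"
    using C_pow_B[of 1 "int e"] by (simp add: int_pow_pow flip: int_pow_int)
  then have "?C \<otimes> ?B \<otimes> D = ?B [^] \<beta> \<otimes> ?C \<otimes> D"
    unfolding D(2) using D(1) cl by (simp add: m_assoc D(4))
  then have 2: "?C \<otimes> ?B = ?B [^] \<beta> \<otimes> ?C" using D(1) cl by simp
  show ?thesis by unfold_locales (use 1 2 mult_swap_gcomm[of ?A ?B] in simp_all)
qed

text \<open>By nilpotency e-th powers commute with f-th powers, so G is the product of S and R and C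
  splits accordingly. Both pairs of generators satisfy the relations again, so
  \<open>card_generate_dvd\<close> makes |S| divide a power of 2 and |R| an odd number.\<close>

lemma (in macd) two_factor:
  assumes gen: "generate G {A, B} = carrier G" and oA: "ord A > 0" and oB: "ord B > 0"
    and four: "4 dvd \<alpha> - 1" "4 dvd \<beta> - 1"
  shows "\<exists>(a::nat) (e::nat). L \<le> a \<and> [e = 1] (mod 2 ^ a) \<and> (A [^] e) [^] (2 ^ a :: nat) = \<one> \<and> (B [^] e) [^] (2 ^ a :: nat) = \<one>
    \<and> macd G (A [^] e) (B [^] e) (gcomm G (A [^] e) (B [^] e)) \<alpha> \<beta>
    \<and> sylow2_set G = generate G {A [^] e, B [^] e} \<and> proj2 G A = A [^] e \<and> proj2 G B = B [^] e
    \<and> proj2 G C = gcomm G (A [^] e) (B [^] e)"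
proof -
  have fin: "finite (carrier G)" using card_generate_dvd(1)[OF oA oB] gen by simp
  obtain k where k: "ucs G k = carrier G" using nilpotent[OF gen fin four] by blast
  obtain a r e f :: nat where a: "L \<le> a" and r: "odd r" and e1: "[e = 1] (mod 2 ^ a)"
    and split: "\<And>g. g \<in> carrier G \<Longrightarrow> g = g [^] e \<otimes> g [^] f"
    and ge: "\<And>g. g \<in> carrier G \<Longrightarrow> (g [^] e) [^] (2 ^ a :: nat) = \<one>"
    and gf: "\<And>g. g \<in> carrier G \<Longrightarrow> (g [^] f) [^] r = \<one>"
    using two_part_exponents[OF fin, of L] by blast
  have comm: "g [^] e \<otimes> h [^] f = h [^] f \<otimes> g [^] e" if "g \<in> carrier G" "h \<in> carrier G" for g h
    by (rule coprime_commute_of_ucs[OF k _ _ ge gf]) (use that r in simp_all)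
  define A2 B2 A1 B1 where "A2 = A [^] e" and "B2 = B [^] e" and "A1 = A [^] f" and "B1 = B [^] f"
  have cl [simp]: "A2 \<in> carrier G" "B2 \<in> carrier G" "A1 \<in> carrier G" "B1 \<in> carrier G"
    by (simp_all add: A2_def B2_def A1_def B1_def)
  define S R where "S = generate G {A2, B2}" and "R = generate G {A1, B1}"
  have S: "subgroup S G" and R: "subgroup R G" unfolding S_def R_def by (simp_all add: generate_is_subgroup)
  have Sc: "s \<in> carrier G" if "s \<in> S" for s using that S subgroup.subset by blast
  have Rc: "t \<in> carrier G" if "t \<in> R" for t using that R subgroup.subset by blast
  have in_S: "A2 \<in> S" "B2 \<in> S" and in_R: "A1 \<in> R" "B1 \<in> R" unfolding S_def R_def by (auto intro: generate.incl)
  have gens: "x \<otimes> y = y \<otimes> x" if "x \<in> {A2, B2}" "y \<in> {A1, B1}" for x y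
    using that comm by (auto simp: A2_def B2_def A1_def B1_def)
  have SR: "s \<otimes> t = t \<otimes> s" if s: "s \<in> S" and t: "t \<in> R" for s t
  proof -
    have t1: "x \<otimes> t = t \<otimes> x" if x: "x \<in> {A2, B2}" for x
    proof -
      have "t \<otimes> x = x \<otimes> t"
      proof (rule generate_centralizes[OF _ _ _ t[unfolded R_def]])
        show "x \<in> carrier G" using x by auto
        show "y \<otimes> x = x \<otimes> y" if "y \<in> {A1, B1}" for y using gens[OF x that] by simp
      qed simp
      then show ?thesis by simp
    qed
    show ?thesis
      by (rule generate_centralizes[OF _ Rc[OF t] t1 s[unfolded S_def]]) simp_all
  qed
  have AA: "A = A2 \<otimes> A1" and BB: "B = B2 \<otimes> B1" using split by (auto simp: A2_def A1_def B2_def B1_def)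
  define C2 C1 where "C2 = gcomm G A2 B2" and "C1 = gcomm G A1 B1"
  have C2: "C2 \<in> S" unfolding C2_def gcomm_def using in_S S by (simp add: subgroup.m_closed subgroup.m_inv_closed)
  have C1: "C1 \<in> R" unfolding C1_def gcomm_def using in_R R by (simp add: subgroup.m_closed subgroup.m_inv_closed)
  note cl' = Sc[OF C2] Rc[OF C1]
  have quad: "s \<otimes> t \<otimes> (s' \<otimes> t') = (s \<otimes> s') \<otimes> (t \<otimes> t')" if "s \<in> S" "t \<in> R" "s' \<in> S" "t' \<in> R" for s t s' t'
    using that SR[of s' t] Sc Rc by (metis m_assoc m_closed)
  have CC: "C = C2 \<otimes> C1"
  proof -
    have "B \<otimes> A \<otimes> C = A \<otimes> B" by (simp add: AB)
    also have "\<dots> = (A2 \<otimes> B2) \<otimes> (A1 \<otimes> B1)" unfolding AA BB by (rule quad) (use in_S in_R in auto)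
    also have "\<dots> = (B2 \<otimes> A2 \<otimes> C2) \<otimes> (B1 \<otimes> A1 \<otimes> C1)"
      unfolding C2_def C1_def using mult_swap_gcomm[of A2 B2] mult_swap_gcomm[of A1 B1] by simp
    also have "\<dots> = (B2 \<otimes> A2) \<otimes> (B1 \<otimes> A1) \<otimes> (C2 \<otimes> C1)"
      by (rule quad[symmetric]) (use in_S in_R C1 C2 S R in \<open>auto intro: subgroup.m_closed\<close>)
    also have "(B2 \<otimes> A2) \<otimes> (B1 \<otimes> A1) = B \<otimes> A" unfolding AA BB by (rule quad[symmetric]) (use in_S in_R in auto)
    finally show ?thesis using cl' by simp
  qed
  have m2: "macd G A2 B2 C2 \<alpha> \<beta>"
    unfolding A2_def B2_def C2_def
    by (rule commuting_factor[of C1]) (use cl' CC SR[OF in_S(1) C1] SR[OF in_S(2) C1] in \<open>simp_all add: A2_def B2_def C2_def\<close>)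
  have m1: "macd G A1 B1 C1 \<alpha> \<beta>"
    unfolding A1_def B1_def C1_def
    by (rule commuting_factor[of C2]) (use cl' CC SR[OF C2 C1] SR[OF C2 in_R(1)] SR[OF C2 in_R(2)] in \<open>simp_all add: A1_def B1_def C1_def\<close>)
  have o2: "ord A2 dvd 2 ^ a" "ord B2 dvd 2 ^ a" and o1: "ord A1 dvd r" "ord B1 dvd r"
    using ge gf by (simp_all add: A2_def B2_def A1_def B1_def flip: pow_eq_id)
  have pos: "ord A2 > 0" "ord B2 > 0" "ord A1 > 0" "ord B1 > 0" using fin finite_ord_gt_0 by simp_all
  have "card S dvd 2 ^ a * 2 ^ a * 2 ^ a"
    using macd.card_generate_dvd(2)[OF m2 pos(1,2)] macd.ord_C_dvd_ord_B[OF m2 pos(1,2)] o2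
    unfolding S_def by (meson dvd_trans mult_dvd_mono)
  then have cS: "card S dvd 2 ^ (a + a + a)" by (simp only: power_add)
  have "card R dvd r * r * r"
    using macd.card_generate_dvd(2)[OF m1 pos(3,4)] macd.ord_C_dvd_ord_B[OF m1 pos(3,4)] o1
    unfolding R_def by (meson dvd_trans mult_dvd_mono)
  then have cR: "odd (card R)" using r by (metis dvd_trans even_mult_iff)
  have two: "\<exists>n::nat. ord s = 2 ^ n" if s: "s \<in> S" for s
  proof -
    have "ord s dvd card S" using subgroup_pow_card[OF S s] Sc[OF s] by (simp add: pow_eq_id)
    then have "ord s dvd 2 ^ (a + a + a)" using cS dvd_trans by blast
    then show ?thesis using divides_primepow_nat[of 2 "ord s"] by auto
  qed
  have odd: "odd (ord t)" if t: "t \<in> R" for t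
  proof -
    have "ord t dvd card R" using subgroup_pow_card[OF R t] Rc[OF t] by (simp add: pow_eq_id)
    then show ?thesis using cR dvd_trans by blast
  qed
  have dec: "\<exists>s\<in>S. \<exists>t\<in>R. g = s \<otimes> t" if g: "g \<in> carrier G" for g
  proof -
    let ?T = "{s \<otimes> t | s t. s \<in> S \<and> t \<in> R}"
    have "subgroup ?T G"
    proof
      show "?T \<subseteq> carrier G" using Sc Rc by auto
      show "\<one> \<in> ?T" using subgroup.one_closed[OF S] subgroup.one_closed[OF R] by force
    next
      fix x y assume "x \<in> ?T" "y \<in> ?T"
      then obtain s t s' t' where "s \<in> S" "t \<in> R" "s' \<in> S" "t' \<in> R" "x = s \<otimes> t" "y = s' \<otimes> t'" by blast
      then show "x \<otimes> y \<in> ?T" using quad S R by (auto intro: subgroup.m_closed)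
    next
      fix x assume "x \<in> ?T"
      then obtain s t where st: "s \<in> S" "t \<in> R" "x = s \<otimes> t" by blast
      then have "inv x = inv s \<otimes> inv t" using SR[of s t] Sc Rc by (simp add: inv_mult_group)
      then show "inv x \<in> ?T" using st S R by (auto intro: subgroup.m_inv_closed)
    qed
    moreover have "{A, B} \<subseteq> ?T" using AA BB in_S in_R by blast
    ultimately have "generate G {A, B} \<subseteq> ?T" by (rule generate_subgroup_incl[rotated])
    then show ?thesis using g gen by blast
  qed
  note td = two_decomposition[OF S R SR dec two odd]
  have "proj2 G A = A2" "proj2 G B = B2" "proj2 G C = C2"
    using td(2) in_S in_R C1 C2 by (simp_all only: AA BB CC)
  then show ?thesis using a e1 m2 td(1) ge
    by (intro exI[of _ a] exI[of _ e]) (simp add: A2_def B2_def C2_def S_def)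
qed

lemma (in macd2) nilpotency_class_5:
  assumes gen: "generate G {A, B} = carrier G" and o: "ord A = 2 ^ (3 * m - 1)"
  shows "nilpotency_class G 5"
proof -
  have "lcs G 5 \<subseteq> {\<one>}" using lcs_ucs[OF ucs5[OF gen], of 5] by simp
  moreover have "\<one> \<in> lcs G (Suc 4)" by (simp only: lcs.simps) (rule generate.one)
  then have "\<one> \<in> lcs G 5" by (simp only: Suc_numeral semiring_norm)
  ultimately have "lcs G 5 = {\<one>}" by blast
  moreover have "lcs G k \<noteq> {\<one>}" if "k < 5" for k
    using lcs4_nontrivial[OF o] lcs_trivial_mono[of k 4] that by auto
  ultimately show ?thesis by (simp add: nilpotency_class_def)
qed

lemma (in group) macd_subgroup:
  assumes "subgroup H G" "macd G A B C \<alpha> \<beta>" "A \<in> H" "B \<in> H" "C \<in> H"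
  shows "macd (G\<lparr>carrier := H\<rparr>) A B C \<alpha> \<beta>"
proof -
  interpret m: macd G A B C \<alpha> \<beta> by fact
  interpret H: group "G\<lparr>carrier := H\<rparr>" by (rule subgroup_imp_group) fact
  show ?thesis using assms(3-) m.AC m.CB m.AB
    by unfold_locales (simp_all flip: int_pow_consistent[OF assms(1)])
qed

theorem theorem16p1:
  fixes G :: "'a monoid" and A B :: 'a and \<alpha> \<beta> :: int and m :: nat
  assumes "infinite (UNIV :: 'a set)"
    and "presents_G G A B \<alpha> \<beta>"
    and "\<alpha> \<noteq> 1" and "\<beta> \<noteq> 1"
    and "multiplicity 2 (\<alpha> - 1) = m" and "multiplicity 2 (\<beta> - 1) = m" and "m > 1"
    and "\<alpha> \<noteq> \<beta>" and "multiplicity 2 (\<alpha> - \<beta>) = 2 * m - 1"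
  shows "card (sylow2_set G) = 2 ^ (7 * m - 3)
       \<and> nilpotency_class (G\<lparr>carrier := sylow2_set G\<rparr>) 5
       \<and> group.ord G (proj2 G A) = 2 ^ (3 * m - 1)
       \<and> group.ord G (proj2 G B) = 2 ^ (3 * m - 1)
       \<and> group.ord G (proj2 G (gcomm G A B)) = 2 ^ (2 * m)"
proof -
  define C where "C = gcomm G A B"
  have G: "group G" and AB: "A \<in> carrier G" "B \<in> carrier G" and gen: "generate G {A, B} = carrier G"
    and rel: "rels G A B \<alpha> \<beta>"
    and univ: "\<And>(H :: 'a monoid) x y. group H \<Longrightarrow> x \<in> carrier H \<Longrightarrow> y \<in> carrier H \<Longrightarrow> rels H x y \<alpha> \<beta>
        \<Longrightarrow> \<exists>h \<in> hom G H. h A = x \<and> h B = y"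
    using assms(2) unfolding presents_G_def by blast+
  interpret group G by (rule G)
  interpret macd G A B C \<alpha> \<beta> unfolding C_def by (rule rels_macd[OF AB rel])
  have dec: "\<exists>q. x = 2 ^ multiplicity 2 x * q \<and> odd q" if "x \<noteq> 0" for x :: int
    using multiplicity_decompose'[of x 2] that by fastforce
  obtain u where u: "\<alpha> - 1 = 2 ^ m * u" "odd u" using dec[of "\<alpha> - 1"] assms by auto
  obtain v where v: "\<beta> - 1 = 2 ^ m * v" "odd v" using dec[of "\<beta> - 1"] assms by auto
  obtain w where w: "\<alpha> - \<beta> = 2 ^ (2 * m - 1) * w" "odd w" using dec[of "\<alpha> - \<beta>"] assms by auto
  have al: "\<alpha> = 1 + 2 ^ m * u" and be: "\<beta> = 1 + 2 ^ m * v" using u v by simp_all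
  have "(2::int)^2 dvd 2 ^ m" using assms(7) by (intro le_imp_power_dvd) simp
  then have four: "4 dvd \<alpha> - 1" "4 dvd \<beta> - 1" using u v by simp_all
  \<comment> \<open>Being 1 modulo 4 excludes 0 and -1, the remaining cases in which
    \<open>ord_B_gt_0\<close> does not apply.\<close>
  have unit: "\<not> q dvd 1 \<and> q \<noteq> 0" if "4 dvd q - 1" "q \<noteq> 1" for q :: int
  proof (intro conjI notI)
    assume "q dvd 1"
    then have "q = -1" using that by (auto simp: abs_if split: if_splits)
    then show False using that by simp
  next
    assume "q = 0"
    then show False using that by simp
  qed
  have oB: "ord B > 0" using ord_B_gt_0 unit four assms by blast
  have oA: "ord A > 0" using macd.ord_B_gt_0[OF swap] unit four assms by blast
  \<comment> \<open>2^(3m+1) = 16P^3 is the period of the model, so this lower bound for a makes e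
    act as 1 on x and y.\<close>
  obtain a e :: nat where a: "3 * m + 1 \<le> a" and e: "[e = 1] (mod 2 ^ a)"
    and pw: "(A [^]\<^bsub>G\<^esub> e) [^]\<^bsub>G\<^esub> (2 ^ a :: nat) = \<one>\<^bsub>G\<^esub>" "(B [^]\<^bsub>G\<^esub> e) [^]\<^bsub>G\<^esub> (2 ^ a :: nat) = \<one>\<^bsub>G\<^esub>"
    and m2: "macd G (A [^]\<^bsub>G\<^esub> e) (B [^]\<^bsub>G\<^esub> e) (gcomm G (A [^]\<^bsub>G\<^esub> e) (B [^]\<^bsub>G\<^esub> e)) \<alpha> \<beta>"
    and syl: "sylow2_set G = generate G {A [^]\<^bsub>G\<^esub> e, B [^]\<^bsub>G\<^esub> e}"
    and proj: "proj2 G A = A [^]\<^bsub>G\<^esub> e" "proj2 G B = B [^]\<^bsub>G\<^esub> e" "proj2 G C = gcomm G (A [^]\<^bsub>G\<^esub> e) (B [^]\<^bsub>G\<^esub> e)"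
    using two_factor[OF gen oA oB four, of "3 * m + 1"] by blast
  define a2 b2 c2 where "a2 = A [^]\<^bsub>G\<^esub> e" and "b2 = B [^]\<^bsub>G\<^esub> e" and "c2 = gcomm G a2 b2"
  interpret T: macd2 G a2 b2 c2 \<alpha> \<beta> m a u v w
    unfolding macd2_def macd2_axioms_def a2_def b2_def c2_def using m2 pw assms(7) u v w al be by blast
  define S where "S = generate G {a2, b2}"
  have syl: "sylow2_set G = S" by (simp add: syl S_def a2_def b2_def)
  have subS: "subgroup S G" unfolding S_def by (simp add: generate_is_subgroup)
  have finS: "finite S" unfolding S_def using T.card_generate_dvd(1) T.ords by blast
  have in_S: "a2 \<in> S" "b2 \<in> S" "c2 \<in> S" using T.C_in_generate unfolding S_def by (auto intro: generate.incl)
  obtain H :: "'a monoid" and x y c f where H: "macd H x y c \<alpha> \<beta>"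
    and xT: "x [^]\<^bsub>H\<^esub> (2 ^ (3 * m + 1) :: nat) = \<one>\<^bsub>H\<^esub>" and yT: "y [^]\<^bsub>H\<^esub> (2 ^ (3 * m + 1) :: nat) = \<one>\<^bsub>H\<^esub>"
    and f: "\<And>(j::nat) (k::nat) (i::nat). f (y [^]\<^bsub>H\<^esub> j \<otimes>\<^bsub>H\<^esub> (c [^]\<^bsub>H\<^esub> k \<otimes>\<^bsub>H\<^esub> x [^]\<^bsub>H\<^esub> i))
         = theta (2 ^ (m - 1)) (j, k, i)"
    using model_exists[OF assms(1,7) u(2) v(2) w(2) al be w(1)] by blast
  interpret H: macd H x y c \<alpha> \<beta> by (rule H)
  obtain h where h: "h \<in> hom G H" "h A = x" "h B = y"
    using univ[OF H.is_group H.A_closed H.B_closed H.macd_rels] by blast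
  interpret h: group_hom G H h by unfold_locales (rule h)
  have pe: "z [^]\<^bsub>H\<^esub> e = z" if z: "z \<in> carrier H" "z [^]\<^bsub>H\<^esub> (2 ^ (3 * m + 1) :: nat) = \<one>\<^bsub>H\<^esub>" for z
  proof -
    have "H.ord z dvd 2 ^ (3 * m + 1)" using z by (simp only: H.pow_eq_id)
    also have "(2::nat) ^ (3 * m + 1) dvd 2 ^ a" using a by (rule le_imp_power_dvd)
    finally have "int (H.ord z) dvd int (2 ^ a)" by (simp only: of_nat_dvd_iff)
    moreover have "[int e = int 1] (mod int (2 ^ a))" using e by (simp only: cong_int_iff)
    then have "int (2 ^ a) dvd int e - int 1" by (simp only: cong_iff_dvd_diff)
    ultimately have "int (H.ord z) dvd int e - 1" using dvd_trans by fastforce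
    then have "z [^]\<^bsub>H\<^esub> (1::int) = z [^]\<^bsub>H\<^esub> int e" using z by (simp only: H.int_pow_eq)
    then show ?thesis using z by (simp add: int_pow_int)
  qed
  \<comment> \<open>The homomorphism is prescribed on A and B; because x^e = x and y^e = y it takes
    the same values on their 2-parts.\<close>
  have hx: "h a2 = x" "h b2 = y"
    unfolding a2_def b2_def using h pe[OF _ xT] pe[OF _ yT] by (simp_all add: h.hom_nat_pow)
  have hc: "h c2 = c" unfolding c2_def by (simp add: h.hom_gcomm hx H.C_eq)
  define F where "F = f \<circ> h"
  have F: "F (b2 [^]\<^bsub>G\<^esub> j \<otimes>\<^bsub>G\<^esub> (c2 [^]\<^bsub>G\<^esub> k \<otimes>\<^bsub>G\<^esub> a2 [^]\<^bsub>G\<^esub> i)) = theta T.P (j, k, i)" for j k i :: nat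
    unfolding F_def T.P_def using f by (simp add: h.hom_nat_pow hx hc)
  obtain l where l: "m = Suc l" using assms(7) by (cases m) auto
  have Pl: "T.P = 2 ^ l" unfolding T.P_def by (simp add: l)
  have P: "T.P > 0" "even T.P" using T.P_even by (simp_all add: Pl)
  have Th: "range (theta T.P) \<subseteq> F ` S"
  proof (rule image_subsetI)
    fix p :: point
    obtain j k i where p: "p = (j, k, i)" by (cases p)
    have pow: "z [^]\<^bsub>G\<^esub> (n::nat) \<in> S" if "z \<in> S" for z n
      using subgroup_int_pow_closed[OF subS that, of "int n"] by (simp add: int_pow_int)
    have "b2 [^]\<^bsub>G\<^esub> j \<otimes>\<^bsub>G\<^esub> (c2 [^]\<^bsub>G\<^esub> k \<otimes>\<^bsub>G\<^esub> a2 [^]\<^bsub>G\<^esub> i) \<in> S"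
      using pow in_S subS by (intro subgroup.m_closed) auto
    then show "theta T.P p \<in> F ` S" unfolding p F[symmetric] by (rule imageI)
  qed
  have M: "nat (2 * T.P^2) = 2 ^ (2 * m - 1)" "nat (4 * T.P^3) = 2 ^ (3 * m - 1)"
    by (simp_all add: nat_power_eq T.pows(2,4)[symmetric])
  have "card (range (theta T.P)) = 2 ^ (2 * m - 1) * (2 ^ (2 * m - 1) * 2 ^ (3 * m - 1))"
    unfolding range_theta[OF P(1)] by (simp add: card_cartesian_product M)
  also have "\<dots> = 2 ^ ((2 * m - 1) + ((2 * m - 1) + (3 * m - 1)))" by (simp only: power_add)
  also have "(2 * m - 1) + ((2 * m - 1) + (3 * m - 1)) = 7 * m - 3" using assms(7) by simp
  finally have "2 ^ (7 * m - 3) \<le> card S"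
    using card_mono[OF finite_imageI[OF finS] Th] card_image_le[OF finS, of F] by linarith
  moreover have "card S \<le> 2 ^ (7 * m - 3)" unfolding S_def by (rule T.card_generate_le)
  ultimately have card: "card S = 2 ^ (7 * m - 3)" by linarith
  \<comment> \<open>A trivial power has the \<open>theta\<close> value of the base point. The third
    coordinate then bounds the orders below: 4P^3 for a2 with weight 1, 4P^3 for b2 with the odd
    weight P - 1, and 4P^2 for c2 with weight P.\<close>
  have one: "F \<one>\<^bsub>G\<^esub> = theta T.P (0, 0, 0)" using F[of 0 0 0] by simp
  have dvd: "n dvd l" if "int n dvd int l" for n l using that by simp
  have oa: "ord a2 = 2 ^ (3 * m - 1)"
  proof (rule dvd_antisym)
    show "ord a2 dvd 2 ^ (3 * m - 1)" using T.A_order_and_C_pow(1) by (simp only: pow_eq_id T.A_closed)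
    have "F (a2 [^]\<^bsub>G\<^esub> ord a2) = theta T.P (0, 0, ord a2)" using F[of 0 0 "ord a2"] by (simp del: pow_ord_eq_1)
    then have "theta T.P (0, 0, ord a2) = theta T.P (0, 0, 0)" by (simp add: one)
    then have "4 * T.P^3 dvd int (ord a2)" by (simp add: theta_eq_iff)
    then have "2 ^ (3 * m - 1) dvd int (ord a2)" by (simp only: T.pows)
    then show "2 ^ (3 * m - 1) dvd ord a2" by (intro dvd) simp
  qed
  have ob: "ord b2 = 2 ^ (3 * m - 1)"
  proof (rule dvd_antisym)
    show "ord b2 dvd 2 ^ (3 * m - 1)"
      using macd2.A_order_and_C_pow(1)[OF T.swap2] by (simp only: pow_eq_id T.B_closed)
    have "F (b2 [^]\<^bsub>G\<^esub> ord b2) = theta T.P (ord b2, 0, 0)" using F[of "ord b2" 0 0] by (simp del: pow_ord_eq_1)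
    then have "theta T.P (ord b2, 0, 0) = theta T.P (0, 0, 0)" by (simp add: one)
    then have "4 * T.P^3 dvd (T.P - 1) * int (ord b2)" by (simp add: theta_eq_iff)
    then have "2 ^ (3 * m - 1) dvd (T.P - 1) * int (ord b2)" by (simp only: T.pows)
    moreover have "coprime (2 ^ (3 * m - 1)) (T.P - 1)" using P(2) by simp
    ultimately have "2 ^ (3 * m - 1) dvd int (ord b2)" by (simp only: coprime_dvd_mult_right_iff)
    then show "2 ^ (3 * m - 1) dvd ord b2" by (intro dvd) simp
  qed
  have oc: "ord c2 = 2 ^ (2 * m)"
  proof (rule dvd_antisym)
    have "c2 [^]\<^bsub>G\<^esub> (2 * T.P^2 * 2) = (c2 [^]\<^bsub>G\<^esub> (2 * T.P^2)) [^]\<^bsub>G\<^esub> (2::int)" by (simp add: int_pow_pow)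
    also have "\<dots> = a2 [^]\<^bsub>G\<^esub> (4 * T.P^3)" unfolding T.structure_relations(3) by (simp add: int_pow_pow)
    finally have "c2 [^]\<^bsub>G\<^esub> (2 ^ (2 * m) :: int) = \<one>\<^bsub>G\<^esub>" using T.structure_relations(1) by (simp add: T.pows)
    then have "int (ord c2) dvd 2 ^ (2 * m)" by (simp only: int_pow_eq_id T.C_closed)
    then show "ord c2 dvd 2 ^ (2 * m)" by (intro dvd) simp
    have "F (c2 [^]\<^bsub>G\<^esub> ord c2) = theta T.P (0, ord c2, 0)" using F[of 0 "ord c2" 0] by (simp del: pow_ord_eq_1)
    then have "theta T.P (0, ord c2, 0) = theta T.P (0, 0, 0)" by (simp add: one)
    then have "4 * T.P^3 dvd T.P * int (ord c2)" by (simp add: theta_eq_iff)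
    then have "T.P * (4 * T.P^2) dvd T.P * int (ord c2)" by (simp add: power2_eq_square power3_eq_cube mult.left_commute)
    then have "4 * T.P^2 dvd int (ord c2)" using P(1) unfolding dvd_mult_cancel_left by simp
    then have "2 ^ (2 * m) dvd int (ord c2)" by (simp only: T.pows)
    then show "2 ^ (2 * m) dvd ord c2" by (intro dvd) simp
  qed
  have "nilpotency_class (G\<lparr>carrier := S\<rparr>) 5"
  proof -
    have S2: "macd2 (G\<lparr>carrier := S\<rparr>) a2 b2 c2 \<alpha> \<beta> m a u v w"
      unfolding macd2_def macd2_axioms_def
      using macd_subgroup[OF subS T.macd_axioms in_S] T.A_2 T.B_2 assms(7) u v w al be
      by (simp flip: nat_pow_consistent)
    show ?thesis
    proof (rule macd2.nilpotency_class_5[OF S2])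
      show "generate (G\<lparr>carrier := S\<rparr>) {a2, b2} = carrier (G\<lparr>carrier := S\<rparr>)"
        using generate_consistent[OF _ subS, of "{a2, b2}"] in_S by (simp add: S_def)
      show "group.ord (G\<lparr>carrier := S\<rparr>) a2 = 2 ^ (3 * m - 1)" using ord_subgroup[OF subS in_S(1)] oa by simp
    qed
  qed
  then show ?thesis using card oa ob oc proj unfolding syl C_def[symmetric] by (simp add: a2_def b2_def c2_def)
qed

end
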